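(* Let $H$ be a quaternion algebra over a field $F$ of characteristic not $2$, with orthogonal involution $\ddagger$. Let $H^+ = \{x\in H : x^\ddagger = x\}$ and define the quadratic form $q_H$ on $F^2 \oplus H^+$ by $q_H(s,t,z) = st - \text{nrm}(z)$. Then there is an exact sequence of algebraic groups $$1 \rightarrow \{\pm 1\} \rightarrow SL^\ddagger(2,H) \rightarrow O^0(q_H) \rightarrow 1,$$ where $O^0(q_H)$ is the connected component of the identity of the orthogonal group of $q_H$.
   Context: A quaternion algebra over $F$ is a central simple $F$-algebra of dimension $4$, with standard involution (quaternion conjugation) $x\mapsto\overline{x}$ and reduced norm $\text{nrm}(x) = x\overline{x}\in F$. An orthogonal involution on $H$ is an $F$-linear map $\ddagger$ with $x^{\ddagger\ddagger}=x$ and $(xy)^\ddagger=y^\ddagger x^\ddagger$ which is not quaternion conjugation; in a suitable basis $1,i,j,ij$ it is $(x+yi+zj+tij)^\ddagger = x+yi+zj-tij$ (so $\dim_F H^+ = 3$). Define $\hat{\ddagger}\begin{pmatrix} a & b \\ c & d\end{pmatrix} = \begin{pmatrix} d^\ddagger & -b^\ddagger \\ -c^\ddagger & a^\ddagger\end{pmatrix}$ and $SL^{\ddagger}(2,H) = \{M\in\text{Mat}(2,H): M\hat{\ddagger}(M)=I\}$. *)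

theory Defs
  imports "HOL-Analysis.Analysis" "HOL-Algebra.Algebraic_Closure_Type"
begin

section \<open>Quaternion algebras and orthogonal involutions\<close>

text \<open>
  The standard involution of a quaternion algebra is unique, so it is carried along as a
  parameter of the locale, characterised by \<open>x * bar x \<in> F\<close>.
\<close>

locale quaternion_algebra = vector_space scl
  for scl :: "'a::field \<Rightarrow> 'h::ring_1 \<Rightarrow> 'h" +
  fixes bar :: "'h \<Rightarrow> 'h"
  assumes scale_mult_left: "scl c x * y = scl c (x * y)"
    and scale_mult_right: "x * scl c y = scl c (x * y)"
    and dim_4: "dim UNIV = 4"
    and central: "(\<And>y. x * y = y * x) \<Longrightarrow> \<exists>c. x = scl c 1"
    and simple: "\<lbrakk>0 \<in> (I :: 'h set); \<And>x y. \<lbrakk>x \<in> I; y \<in> I\<rbrakk> \<Longrightarrow> x + y \<in> I;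
        \<And>x y. x \<in> I \<Longrightarrow> x * y \<in> I; \<And>x y. x \<in> I \<Longrightarrow> y * x \<in> I\<rbrakk> \<Longrightarrow> I = {0} \<or> I = UNIV"
    and bar_linear: "Vector_Spaces.linear scl scl bar"
    and bar_bar: "bar (bar x) = x"
    and bar_mult: "bar (x * y) = bar y * bar x"
    and bar_standard: "\<exists>c. x * bar x = scl c 1"

definition orthogonal_involution ::
  "('a::field \<Rightarrow> 'h::ring_1 \<Rightarrow> 'h) \<Rightarrow> ('h \<Rightarrow> 'h) \<Rightarrow> ('h \<Rightarrow> 'h) \<Rightarrow> bool" where
  "orthogonal_involution scl bar dag \<longleftrightarrow>
     Vector_Spaces.linear scl scl dag \<and>
     (\<forall>x. dag (dag x) = x) \<and> (\<forall>x y. dag (x * y) = dag y * dag x) \<and> dag \<noteq> bar"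

definition nrm :: "('a::field \<Rightarrow> 'h::ring_1 \<Rightarrow> 'h) \<Rightarrow> ('h \<Rightarrow> 'h) \<Rightarrow> 'h \<Rightarrow> 'a" where
  "nrm scl bar x = (THE c. scl c 1 = x * bar x)"

definition Hplus :: "('h \<Rightarrow> 'h) \<Rightarrow> 'h set" where
  "Hplus dag = {x. dag x = x}"

definition q_H :: "('a::field \<Rightarrow> 'h::ring_1 \<Rightarrow> 'h) \<Rightarrow> ('h \<Rightarrow> 'h) \<Rightarrow> 'a \<times> 'a \<times> 'h \<Rightarrow> 'a" where
  "q_H scl bar = (\<lambda>(s, t, z). s * t - nrm scl bar z)"

definition scale_FFH ::
  "('a::field \<Rightarrow> 'h::ring_1 \<Rightarrow> 'h) \<Rightarrow> 'a \<Rightarrow> 'a \<times> 'a \<times> 'h \<Rightarrow> 'a \<times> 'a \<times> 'h" where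
  "scale_FFH scl c = (\<lambda>(s, t, z). (c * s, c * t, scl c z))"

definition is_basis :: "('a::field \<Rightarrow> 'm::ab_group_add \<Rightarrow> 'm) \<Rightarrow> ('i \<Rightarrow> 'm) \<Rightarrow> 'm set \<Rightarrow> bool" where
  "is_basis scl e W \<longleftrightarrow>
     inj e \<and> \<not> module.dependent scl (range e) \<and> module.span scl (range e) = W"


section \<open>Linear algebraic groups over a field\<close>

text \<open>
  An algebraic group over a field \<open>F\<close> is taken in the sense of Borel: a group \<open>G\<close> whose carrier is a
  closed subset, defined over \<open>F\<close>, of an affine space \<open>'v \<Rightarrow> 'k\<close> over an algebraically closed
  field \<open>'k\<close> containing \<open>F\<close>. The subfield \<open>F\<close> appears as a set \<open>C :: 'k set\<close>.
  Since \<open>'k\<close> is infinite, polynomials can be identified with polynomial functions.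
\<close>

inductive_set polyfun :: "'k::comm_ring_1 set \<Rightarrow> (('v \<Rightarrow> 'k) \<Rightarrow> 'k) set" for C where
  const: "c \<in> C \<Longrightarrow> (\<lambda>_. c) \<in> polyfun C"
| coord: "(\<lambda>x. x v) \<in> polyfun C"
| add: "\<lbrakk>p \<in> polyfun C; q \<in> polyfun C\<rbrakk> \<Longrightarrow> (\<lambda>x. p x + q x) \<in> polyfun C"
| mult: "\<lbrakk>p \<in> polyfun C; q \<in> polyfun C\<rbrakk> \<Longrightarrow> (\<lambda>x. p x * q x) \<in> polyfun C"

inductive_set poly_ideal :: "(('v \<Rightarrow> 'k::comm_ring_1) \<Rightarrow> 'k) set \<Rightarrow> (('v \<Rightarrow> 'k) \<Rightarrow> 'k) set" for A where
  gen: "p \<in> A \<Longrightarrow> p \<in> poly_ideal A"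
| zero: "(\<lambda>_. 0) \<in> poly_ideal A"
| add: "\<lbrakk>p \<in> poly_ideal A; q \<in> poly_ideal A\<rbrakk> \<Longrightarrow> (\<lambda>x. p x + q x) \<in> poly_ideal A"
| mult: "\<lbrakk>r \<in> polyfun UNIV; p \<in> poly_ideal A\<rbrakk> \<Longrightarrow> (\<lambda>x. r x * p x) \<in> poly_ideal A"

definition zero_set :: "(('v \<Rightarrow> 'k::comm_ring_1) \<Rightarrow> 'k) set \<Rightarrow> ('v \<Rightarrow> 'k) set" where
  "zero_set E = {x. \<forall>p\<in>E. p x = 0}"

definition vanishing_ideal ::
  "'k::comm_ring_1 set \<Rightarrow> ('v \<Rightarrow> 'k) set \<Rightarrow> (('v \<Rightarrow> 'k) \<Rightarrow> 'k) set" where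
  "vanishing_ideal C S = {p \<in> polyfun C. \<forall>x\<in>S. p x = 0}"

definition zariski :: "('v \<Rightarrow> 'k::idom) topology" where
  "zariski = topology (\<lambda>U. \<exists>E \<subseteq> polyfun UNIV. - U = zero_set E)"

lemma openin_zariski:
  "openin zariski (U :: ('v \<Rightarrow> 'k::idom) set) \<longleftrightarrow> (\<exists>E \<subseteq> polyfun UNIV. - U = zero_set E)"
proof -
  have "istopology (\<lambda>U :: ('v \<Rightarrow> 'k::idom) set. \<exists>E \<subseteq> polyfun UNIV. - U = zero_set E)"
    unfolding istopology_def
  proof (intro conjI allI impI)
    fix S T :: "('v \<Rightarrow> 'k) set"
    assume "\<exists>E\<subseteq>polyfun UNIV. - S = zero_set E" "\<exists>E\<subseteq>polyfun UNIV. - T = zero_set E"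
    then obtain D E where D: "D \<subseteq> polyfun UNIV" "- S = zero_set D"
      and E: "E \<subseteq> polyfun UNIV" "- T = zero_set E" by blast
    let ?P = "(\<lambda>(p, q) x. p x * q x) ` (D \<times> E)"
    have "?P \<subseteq> polyfun UNIV" using D(1) E(1) by (auto intro!: polyfun.mult)
    moreover have "- (S \<inter> T) = zero_set ?P"
    proof (rule Set.set_eqI)
      fix x
      have "x \<in> - (S \<inter> T) \<longleftrightarrow> x \<in> zero_set D \<or> x \<in> zero_set E" using D(2) E(2) by blast
      also have "\<dots> \<longleftrightarrow> (\<forall>p\<in>D. \<forall>q\<in>E. p x * q x = 0)" by (auto simp: zero_set_def)
      also have "\<dots> \<longleftrightarrow> x \<in> zero_set ?P" by (auto simp: zero_set_def)
      finally show "x \<in> - (S \<inter> T) \<longleftrightarrow> x \<in> zero_set ?P" .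
    qed
    ultimately show "\<exists>E\<subseteq>polyfun UNIV. - (S \<inter> T) = zero_set E" by blast
  next
    fix \<U> :: "('v \<Rightarrow> 'k) set set"
    assume "\<forall>U\<in>\<U>. \<exists>E\<subseteq>polyfun UNIV. - U = zero_set E"
    then obtain D where D: "\<And>U. U \<in> \<U> \<Longrightarrow> D U \<subseteq> polyfun UNIV \<and> - U = zero_set (D U)"
      by metis
    have "(\<Union>U\<in>\<U>. D U) \<subseteq> polyfun UNIV" using D by blast
    moreover have "- \<Union>\<U> = zero_set (\<Union>U\<in>\<U>. D U)"
    proof -
      have "- \<Union>\<U> = (\<Inter>U\<in>\<U>. - U)" by blast
      also have "\<dots> = (\<Inter>U\<in>\<U>. zero_set (D U))" using D by simp
      also have "\<dots> = zero_set (\<Union>U\<in>\<U>. D U)" by (auto simp: zero_set_def)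
      finally show ?thesis .
    qed
    ultimately show "\<exists>E\<subseteq>polyfun UNIV. - \<Union>\<U> = zero_set E" by blast
  qed
  then show ?thesis unfolding zariski_def by (simp only: topology_inverse')
qed

definition defined_over :: "'k::comm_ring_1 set \<Rightarrow> ('v \<Rightarrow> 'k) set \<Rightarrow> bool" where
  "defined_over C S \<longleftrightarrow>
     zero_set (vanishing_ideal UNIV S) = S \<and>
     vanishing_ideal UNIV S = poly_ideal (vanishing_ideal C S)"

definition regular_on ::
  "'k::comm_ring_1 set \<Rightarrow> ('v \<Rightarrow> 'k) set \<Rightarrow> (('v \<Rightarrow> 'k) \<Rightarrow> ('w \<Rightarrow> 'k)) \<Rightarrow> bool" where
  "regular_on C S f \<longleftrightarrow> (\<forall>w. \<exists>p \<in> polyfun C. \<forall>x\<in>S. f x w = p x)"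

text \<open>
  The product of two affine spaces is the affine space \<open>'v + 'v \<Rightarrow> 'k\<close>.
\<close>

definition algebraic_group :: "'k::comm_ring_1 set \<Rightarrow> ('v \<Rightarrow> 'k) monoid \<Rightarrow> bool" where
  "algebraic_group C G \<longleftrightarrow>
     group G \<and> defined_over C (carrier G) \<and>
     regular_on C {case_sum x y |x y. x \<in> carrier G \<and> y \<in> carrier G}
       (\<lambda>z. (z \<circ> Inl) \<otimes>\<^bsub>G\<^esub> (z \<circ> Inr)) \<and>
     regular_on C (carrier G) (\<lambda>x. inv\<^bsub>G\<^esub> x)"

definition identity_component :: "('v \<Rightarrow> 'k::idom) monoid \<Rightarrow> ('v \<Rightarrow> 'k) monoid" where
  "identity_component G =
     G\<lparr>carrier := connected_component_of_set (subtopology zariski (carrier G)) \<one>\<^bsub>G\<^esub>\<rparr>"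

text \<open>
  The ideal, in the ring of polynomial functions, of the scheme-theoretic kernel of \<open>\<phi>\<close>:
  it is generated by the ideal of \<open>G\<close> (the case \<open>h = 0\<close>) and the pullbacks of the functions
  vanishing at the identity of \<open>Q\<close>.
\<close>

definition kernel_ideal :: "('v \<Rightarrow> 'k::comm_ring_1) monoid \<Rightarrow> ('w \<Rightarrow> 'k) monoid \<Rightarrow>
    (('v \<Rightarrow> 'k) \<Rightarrow> ('w \<Rightarrow> 'k)) \<Rightarrow> (('v \<Rightarrow> 'k) \<Rightarrow> 'k) set" where
  "kernel_ideal G Q \<phi> =
     poly_ideal {p \<in> polyfun UNIV.
       \<exists>h \<in> vanishing_ideal UNIV {\<one>\<^bsub>Q\<^esub>}. \<forall>x\<in>carrier G. p x = h (\<phi> x)}"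

text \<open>
  Exactness of \<open>1 \<rightarrow> N \<rightarrow> G \<rightarrow> Q \<rightarrow> 1\<close> over \<open>C\<close>, where \<open>N \<rightarrow> G\<close> is the inclusion of a closed subgroup:
  \<open>\<phi>\<close> is surjective, and its kernel is \<open>N\<close> as a group scheme and not just on points, so that
  inseparable isogenies are not mistaken for isomorphisms.
\<close>

definition short_exact :: "'k::comm_ring_1 set \<Rightarrow> ('v \<Rightarrow> 'k) monoid \<Rightarrow> ('v \<Rightarrow> 'k) monoid \<Rightarrow>
    ('w \<Rightarrow> 'k) monoid \<Rightarrow> (('v \<Rightarrow> 'k) \<Rightarrow> ('w \<Rightarrow> 'k)) \<Rightarrow> bool" where
  "short_exact C N G Q \<phi> \<longleftrightarrow>
     algebraic_group C N \<and> algebraic_group C G \<and> algebraic_group C Q \<and>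
     subgroup (carrier N) G \<and> N = G\<lparr>carrier := carrier N\<rparr> \<and>
     \<phi> \<in> hom G Q \<and> regular_on C (carrier G) \<phi> \<and>
     kernel G Q \<phi> = carrier N \<and> kernel_ideal G Q \<phi> = vanishing_ideal UNIV (carrier N) \<and>
     \<phi> ` carrier G = carrier Q"


section \<open>The group \<open>SL\<^sup>\<ddagger>(2,H)\<close>\<close>

text \<open>
  Let \<open>K\<close> be the algebraic closure of \<open>F\<close>. An \<open>F\<close>-basis \<open>e\<close> of \<open>H\<close> identifies \<open>H \<otimes>\<^sub>F K\<close> with
  \<open>4 \<Rightarrow> K\<close>; multiplication and \<open>F\<close>-linear maps extend from \<open>H\<close> through their structure constants
  with respect to \<open>e\<close>.
\<close>

definition coords :: "('a::field \<Rightarrow> 'm::ab_group_add \<Rightarrow> 'm) \<Rightarrow> ('i \<Rightarrow> 'm) \<Rightarrow> 'm \<Rightarrow> 'i \<Rightarrow> 'a" where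
  "coords scl e x i = module.representation scl (range e) x (e i)"

definition HK_embed ::
  "('a::field \<Rightarrow> 'h::ring_1 \<Rightarrow> 'h) \<Rightarrow> (4 \<Rightarrow> 'h) \<Rightarrow> 'h \<Rightarrow> (4 \<Rightarrow> 'a alg_closure)" where
  "HK_embed scl e x = (\<lambda>k. to_ac (coords scl e x k))"

definition HK_mult :: "('a::field \<Rightarrow> 'h::ring_1 \<Rightarrow> 'h) \<Rightarrow> (4 \<Rightarrow> 'h) \<Rightarrow>
    (4 \<Rightarrow> 'a alg_closure) \<Rightarrow> (4 \<Rightarrow> 'a alg_closure) \<Rightarrow> (4 \<Rightarrow> 'a alg_closure)" where
  "HK_mult scl e x y = (\<lambda>k. \<Sum>i\<in>UNIV. \<Sum>j\<in>UNIV. x i * y j * HK_embed scl e (e i * e j) k)"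

definition HK_linear :: "('a::field \<Rightarrow> 'h::ring_1 \<Rightarrow> 'h) \<Rightarrow> (4 \<Rightarrow> 'h) \<Rightarrow> ('h \<Rightarrow> 'h) \<Rightarrow>
    (4 \<Rightarrow> 'a alg_closure) \<Rightarrow> (4 \<Rightarrow> 'a alg_closure)" where
  "HK_linear scl e T x = (\<lambda>k. \<Sum>i\<in>UNIV. x i * HK_embed scl e (T (e i)) k)"

text \<open>
  A matrix \<open>M\<close> over \<open>H \<otimes>\<^sub>F K\<close> is a point of the affine space \<open>2 \<times> 2 \<times> 4 \<Rightarrow> K\<close>:
  \<open>M (i, j, k)\<close> is the \<open>k\<close>-th coordinate of its \<open>(i, j)\<close>-entry.
\<close>

definition entry :: "(2 \<times> 2 \<times> 4 \<Rightarrow> 'k) \<Rightarrow> 2 \<Rightarrow> 2 \<Rightarrow> (4 \<Rightarrow> 'k)" where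
  "entry M i j = (\<lambda>k. M (i, j, k))"

definition mat2_mult :: "('a::field \<Rightarrow> 'h::ring_1 \<Rightarrow> 'h) \<Rightarrow> (4 \<Rightarrow> 'h) \<Rightarrow>
    (2 \<times> 2 \<times> 4 \<Rightarrow> 'a alg_closure) \<Rightarrow> (2 \<times> 2 \<times> 4 \<Rightarrow> 'a alg_closure) \<Rightarrow>
    (2 \<times> 2 \<times> 4 \<Rightarrow> 'a alg_closure)" where
  "mat2_mult scl e M N =
     (\<lambda>(i, j, k). \<Sum>l\<in>UNIV. HK_mult scl e (entry M i l) (entry N l j) k)"

definition mat2_one :: "('a::field \<Rightarrow> 'h::ring_1 \<Rightarrow> 'h) \<Rightarrow> (4 \<Rightarrow> 'h) \<Rightarrow>
    (2 \<times> 2 \<times> 4 \<Rightarrow> 'a alg_closure)" where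
  "mat2_one scl e = (\<lambda>(i, j, k). if i = j then HK_embed scl e 1 k else 0)"

definition mat2_hat :: "('a::field \<Rightarrow> 'h::ring_1 \<Rightarrow> 'h) \<Rightarrow> (4 \<Rightarrow> 'h) \<Rightarrow> ('h \<Rightarrow> 'h) \<Rightarrow>
    (2 \<times> 2 \<times> 4 \<Rightarrow> 'a alg_closure) \<Rightarrow> (2 \<times> 2 \<times> 4 \<Rightarrow> 'a alg_closure)" where
  "mat2_hat scl e dag M = (\<lambda>(i, j, k).
     if i = 1 \<and> j = 1 then HK_linear scl e dag (entry M 2 2) k
     else if i = 2 \<and> j = 2 then HK_linear scl e dag (entry M 1 1) k
     else - HK_linear scl e dag (entry M i j) k)"

definition SL_dag :: "('a::field \<Rightarrow> 'h::ring_1 \<Rightarrow> 'h) \<Rightarrow> (4 \<Rightarrow> 'h) \<Rightarrow> ('h \<Rightarrow> 'h) \<Rightarrow>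
    (2 \<times> 2 \<times> 4 \<Rightarrow> 'a alg_closure) monoid" where
  "SL_dag scl e dag =
     \<lparr>carrier = {M. mat2_mult scl e M (mat2_hat scl e dag M) = mat2_one scl e},
      monoid.mult = mat2_mult scl e, one = mat2_one scl e\<rparr>"

definition plus_minus_one :: "('v \<Rightarrow> 'k::comm_ring_1) monoid \<Rightarrow> ('v \<Rightarrow> 'k) monoid" where
  "plus_minus_one G = G\<lparr>carrier := {\<one>\<^bsub>G\<^esub>, (\<lambda>v. - \<one>\<^bsub>G\<^esub> v)}\<rparr>"


section \<open>Orthogonal groups\<close>

text \<open>
  The base change to \<open>K\<close> of a quadratic form \<open>q\<close> on an \<open>F\<close>-vector space with basis \<open>b\<close>, through the
  Gram matrix of the symmetric bilinear form \<open>(q (x + y) - q x - q y) / 2\<close> (characteristic not 2).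
\<close>

definition qform_ac :: "('m::ab_group_add \<Rightarrow> 'a::field) \<Rightarrow> ('n::finite \<Rightarrow> 'm) \<Rightarrow>
    'a alg_closure ^ 'n \<Rightarrow> 'a alg_closure" where
  "qform_ac q b v =
     (\<Sum>i\<in>UNIV. \<Sum>j\<in>UNIV. to_ac ((q (b i + b j) - q (b i) - q (b j)) / 2) * v $ i * v $ j)"

definition to_mat :: "('n::finite \<times> 'n \<Rightarrow> 'k) \<Rightarrow> 'k ^ 'n ^ 'n" where
  "to_mat g = (\<chi> i j. g (i, j))"

definition of_mat :: "'k ^ 'n ^ 'n \<Rightarrow> ('n::finite \<times> 'n \<Rightarrow> 'k)" where
  "of_mat A = (\<lambda>(i, j). A $ i $ j)"

definition orthogonal_group_ac :: "('m::ab_group_add \<Rightarrow> 'a::field) \<Rightarrow> ('n::finite \<Rightarrow> 'm) \<Rightarrow>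
    ('n \<times> 'n \<Rightarrow> 'a alg_closure) monoid" where
  "orthogonal_group_ac q b =
     \<lparr>carrier = {g. invertible (to_mat g) \<and>
        (\<forall>v. qform_ac q b (to_mat g *v v) = qform_ac q b v)},
      monoid.mult = (\<lambda>g h. of_mat (to_mat g ** to_mat h)), one = of_mat (mat 1)\<rparr>"

end

theory Submission
  imports Defs
begin


text \<open>Over the algebraic closure \<open>K\<close> of \<open>F\<close>, the algebra
  \<open>H\<close> becomes the algebra of 2-by-2 matrices, with quaternion conjugation the adjugate
  and the orthogonal involution transposition (\<open>splitting\<close>). Then
  \<open>SL\<^sup>\<ddagger>(2, H)\<close> becomes \<open>Sp(4, K)\<close> in 2-by-2 blocks
  (\<open>sp\<close>). It acts by \<open>M * h * star M\<close> on the hermitian matrices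
  \<open>h\<close> with scalar diagonal entries \<open>s\<close>, \<open>t\<close> and a symmetric
  off-diagonal block \<open>Z\<close>, and it preserves \<open>s * t - det2 Z\<close>, which is
  \<open>q_H\<close> over \<open>K\<close>. The theorem is thus a form over \<open>F\<close> of the
  exceptional isogeny from Sp(4) to SO(5).

  Everything rests on \<open>sp_factorization\<close>: each element of \<open>sp\<close> is a
  product of five block unipotent matrices, in a fixed pattern, with symmetric parameters.
  Identities need therefore be checked only on unipotents (\<open>sp_induct\<close>), and the group
  is the image of an affine space under a map \<open>psi\<close> that is polynomial over
  \<open>F\<close>. Such an image, if closed, is defined over \<open>F\<close>: a polynomial over
  \<open>K\<close> vanishing on it splits along an \<open>F\<close>-basis of \<open>K\<close> into
  polynomials over \<open>F\<close> that vanish on it too (\<open>defined_over_images\<close>). The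
  image is also connected, being a union of images of lines through the origin
  (\<open>connected_component_of_zariski\<close>).

  The action has determinant 1, since over an infinite field the unipotents are commutators
  (\<open>det_act_mat\<close>). Conversely, an isometry can be moved by the group, one basis vector
  at a time, to the identity or to a reflection (\<open>preserves_qf_reduction\<close>). So the
  orthogonal group is the disjoint union of its closed subsets of determinant 1 and -1; the first is
  the image of the action, hence connected, hence the identity component (\<open>carrier_Q\<close>).

  The map \<open>phi\<close> is written through the splitting, which lives over \<open>K\<close>. It
  is regular over \<open>F\<close> because the coordinates of a hermitian matrix can be read off by
  \<open>F\<close>-linear projections of \<open>H\<close> onto \<open>F\<close> and onto
  \<open>H\<^sup>+\<close> (\<open>phi_eq_act_coord\<close>).

  For the kernel as a scheme, \<open>kernel_relations\<close> shows that modulo the kernel ideal the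
  generic matrix is a scalar \<open>c\<close> with \<open>c * c = 1\<close>. Hence every polynomial
  is congruent to some \<open>r + s * c\<close> (\<open>mod_kernel_ideal\<close>), and as 2 is
  invertible, such an expression vanishes at 1 and -1 only if \<open>r = s = 0\<close>
  (\<open>kernel_ideal_eq\<close>).\<close>

no_notation fps_nth (infixl "$" 75)

section \<open>Closure properties of polynomial functions; reduction to one variable\<close>

section \<open>Polynomial functions\<close>

lemma polyfun_sum:
  assumes "0 \<in> C" "\<And>i. i \<in> A \<Longrightarrow> (\<lambda>x. f i x) \<in> polyfun C"
  shows "(\<lambda>x. \<Sum>i\<in>A. f i x) \<in> polyfun C"
  using assms(2)
  by (induction A rule: infinite_finite_induct)
     (auto intro: polyfun.const[OF assms(1)] polyfun.add)

lemma polyfun_prod: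
  assumes "1 \<in> C" "\<And>i. i \<in> A \<Longrightarrow> (\<lambda>x. f i x) \<in> polyfun C"
  shows "(\<lambda>x. \<Prod>i\<in>A. f i x) \<in> polyfun C"
  using assms(2)
  by (induction A rule: infinite_finite_induct)
     (auto intro: polyfun.const[OF assms(1)] polyfun.mult)

lemma polyfun_uminus:
  assumes "- 1 \<in> C" "p \<in> polyfun C"
  shows "(\<lambda>x. - p x) \<in> polyfun C"
  using polyfun.mult[OF polyfun.const[OF assms(1)] assms(2)] by simp

lemma polyfun_diff:
  assumes "- 1 \<in> C" "p \<in> polyfun C" "q \<in> polyfun C"
  shows "(\<lambda>x. p x - q x) \<in> polyfun C"
  using polyfun.add[OF assms(2) polyfun_uminus[OF assms(1,3)]] by simp

lemma polyfun_mono: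
  assumes "C \<subseteq> D"
  shows "p \<in> polyfun C \<Longrightarrow> p \<in> polyfun D"
  by (induction rule: polyfun.induct) (use assms in \<open>auto intro: polyfun.intros\<close>)

lemma polyfun_comp:
  assumes "p \<in> polyfun C" "\<And>v. (\<lambda>x. f x v) \<in> polyfun C"
  shows "(\<lambda>x. p (f x)) \<in> polyfun C"
  using assms(1) by (induction rule: polyfun.induct) (auto intro: polyfun.intros assms(2))

lemma polyfun_det:
  fixes A :: "('v \<Rightarrow> 'k) \<Rightarrow> 'k::field ^ 'n ^ 'n"
  assumes "1 \<in> C" "- 1 \<in> C" "0 \<in> C" "\<And>i j. (\<lambda>x. A x $ i $ j) \<in> polyfun C"
  shows "(\<lambda>x. det (A x)) \<in> polyfun C"
proof -
  have "(of_int (sign p) :: 'k) \<in> C" for p :: "'n \<Rightarrow> 'n"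
    using assms(1,2) by (auto simp: sign_def)
  then show ?thesis unfolding det_def
    by (intro polyfun_sum polyfun.mult polyfun_prod polyfun.const assms)
qed

text \<open>Singles out the variable \<open>v\<close>: \<open>p\<close> becomes a polynomial in
  \<open>x v\<close> whose coefficients are polynomials over \<open>C\<close> in the other
  variables. That \<open>v\<close> does not occur in them is expressed by
  \<open>P (x(v := t)) = P x\<close>. This allows induction on the number of variables.\<close>

lemma polyfun_as_poly_in_one_variable:
  fixes p :: "('v \<Rightarrow> 'k::field) \<Rightarrow> 'k"
  assumes "p \<in> polyfun C" "0 \<in> C" "1 \<in> C"
  shows "\<exists>P :: ('v \<Rightarrow> 'k) \<Rightarrow> 'k poly. (\<forall>j. (\<lambda>x. Polynomial.coeff (P x) j) \<in> polyfun C) \<and>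
    (\<forall>x t. P (x(v := t)) = P x) \<and> (\<forall>x. p x = poly (P x) (x v))"
  using assms(1)
proof (induction rule: polyfun.induct)
  case (const c)
  have "(\<lambda>x. Polynomial.coeff [:c:] j) \<in> polyfun C" for j
    by (rule polyfun.const) (use const assms in \<open>cases j; auto\<close>)
  then show ?case by (intro exI[of _ "\<lambda>_. [:c:]"]) auto
next
  case (coord w)
  show ?case
  proof (cases "w = v")
    case True
    have "(\<lambda>x. Polynomial.coeff [:0, 1:] j) \<in> polyfun C" for j
      by (rule polyfun.const) (use assms in \<open>auto simp: coeff_pCons split: nat.split\<close>)
    then show ?thesis using True by (intro exI[of _ "\<lambda>_. [:0, 1:]"]) auto
  next
    case False
    have "(\<lambda>x. Polynomial.coeff [:x w:] j) \<in> polyfun C" for j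
      by (cases j) (auto intro: polyfun.coord polyfun.const assms)
    then show ?thesis using False by (intro exI[of _ "\<lambda>x. [:x w:]"]) auto
  qed
next
  case (add p q)
  then obtain P Q where
    "\<And>j. (\<lambda>x. Polynomial.coeff (P x) j) \<in> polyfun C" "\<And>x t. P (x(v := t)) = P x" "\<And>x. p x = poly (P x) (x v)"
    "\<And>j. (\<lambda>x. Polynomial.coeff (Q x) j) \<in> polyfun C" "\<And>x t. Q (x(v := t)) = Q x" "\<And>x. q x = poly (Q x) (x v)"
    by blast
  then show ?case by (intro exI[of _ "\<lambda>x. P x + Q x"] conjI allI) (simp_all add: polyfun.add del: fun_upd_apply)
next
  case (mult p q)
  then obtain P Q where
    "\<And>j. (\<lambda>x. Polynomial.coeff (P x) j) \<in> polyfun C" "\<And>x t. P (x(v := t)) = P x" "\<And>x. p x = poly (P x) (x v)"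
    "\<And>j. (\<lambda>x. Polynomial.coeff (Q x) j) \<in> polyfun C" "\<And>x t. Q (x(v := t)) = Q x" "\<And>x. q x = poly (Q x) (x v)"
    by blast
  then show ?case
    by (intro exI[of _ "\<lambda>x. P x * Q x"] conjI allI)
       (simp_all add: coeff_mult polyfun.mult polyfun_sum assms del: fun_upd_apply)
qed

text \<open>Over a finite field, the product of all \<open>X - a\<close>, plus 1, has positive
  degree but no root.\<close>

lemma alg_closed_infinite: "infinite (UNIV :: 'k::alg_closed_field set)"
proof
  assume fin: "finite (UNIV :: 'k set)"
  let ?p = "(\<Prod>a\<in>(UNIV :: 'k set). [:- a, 1:]) + 1"
  have "poly ?p x = 1" for x :: 'k
    using fin by (simp add: poly_prod)
  moreover have "Polynomial.degree (\<Prod>a\<in>(UNIV :: 'k set). [:- a, 1:]) = card (UNIV :: 'k set)"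
    by (subst Polynomial.degree_prod_eq_sum_degree) auto
  then have "Polynomial.degree ?p = card (UNIV :: 'k set)"
    using fin by (subst Polynomial.degree_add_eq_left) (auto simp: card_gt_0_iff)
  ultimately show False
    using alg_closed_imp_poly_has_root[of ?p] fin by (auto simp: card_gt_0_iff)
qed

lemma poly_zero_if_vanishes:
  fixes p :: "'k::alg_closed_field poly"
  assumes "\<And>t. poly p t = 0"
  shows "p = 0"
  using poly_roots_finite[of p] alg_closed_infinite assms by fastforce

text \<open>On a line through the origin a polynomial function is a polynomial in the parameter;
  connectedness arguments then take place in the integral domain of such polynomials.\<close>

lemma polyfun_on_line:
  fixes p :: "('v \<Rightarrow> 'k::field) \<Rightarrow> 'k"
  assumes "p \<in> polyfun UNIV"
  shows "\<exists>P. \<forall>t. p (\<lambda>v. t * x v) = poly P t"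
  using assms
proof (induction rule: polyfun.induct)
  case (const c)
  show ?case by (rule exI[of _ "[:c:]"]) simp
next
  case (coord v)
  show ?case by (rule exI[of _ "[:0, x v:]"]) simp
next
  case (add p q)
  then obtain P Q where "\<forall>t. p (\<lambda>v. t * x v) = poly P t" "\<forall>t. q (\<lambda>v. t * x v) = poly Q t" by blast
  then show ?case by (intro exI[of _ "P + Q"]) simp
next
  case (mult p q)
  then obtain P Q where "\<forall>t. p (\<lambda>v. t * x v) = poly P t" "\<forall>t. q (\<lambda>v. t * x v) = poly Q t" by blast
  then show ?case by (intro exI[of _ "P * Q"]) simp
qed

section \<open>Linear independence over a subfield and descent of vanishing ideals\<close>

section \<open>Images of polynomial maps\<close>

text \<open>
  Linear independence over the subfield \<open>C\<close> carries over from constants to polynomial functions: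
  compare coefficients, one variable at a time. Evaluating at points of \<open>C\<close> would not do, because
  \<open>C\<close> may be finite.
\<close>

lemma polyfun_independent:
  fixes h :: "'k \<Rightarrow> ('v::finite \<Rightarrow> 'k::alg_closed_field) \<Rightarrow> 'k"
  assumes C: "0 \<in> C" "1 \<in> C" "\<And>a b. a \<in> C \<Longrightarrow> b \<in> C \<Longrightarrow> a + b \<in> C"
      "\<And>a b. a \<in> C \<Longrightarrow> b \<in> C \<Longrightarrow> a * b \<in> C"
    and indep: "\<And>c. (\<forall>b\<in>B. c b \<in> C) \<Longrightarrow> (\<Sum>b\<in>B. b * c b) = 0 \<Longrightarrow> \<forall>b\<in>B. c b = 0"
    and h: "\<And>b. b \<in> B \<Longrightarrow> h b \<in> polyfun C"
    and zero: "\<And>x. (\<Sum>b\<in>B. b * h b x) = 0"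
    and b: "b \<in> B"
  shows "h b x = 0"
proof -
  have "\<forall>b\<in>B. \<forall>x. (\<forall>v. v \<notin> V \<longrightarrow> x v = 0) \<longrightarrow> h b x = 0"
    if "finite V" "\<And>b. b \<in> B \<Longrightarrow> h b \<in> polyfun C"
      "\<And>x. (\<forall>v. v \<notin> V \<longrightarrow> x v = 0) \<Longrightarrow> (\<Sum>b\<in>B. b * h b x) = 0" for V and h :: "'k \<Rightarrow> ('v \<Rightarrow> 'k) \<Rightarrow> 'k"
    using that
  proof (induction V arbitrary: h rule: finite_induct)
    case empty
    have const: "p (\<lambda>_. 0) \<in> C" if "p \<in> polyfun C" for p :: "('v \<Rightarrow> 'k) \<Rightarrow> 'k"
      using that by (induction rule: polyfun.induct) (use C in auto)
    have "(\<Sum>b\<in>B. b * h b (\<lambda>_. 0)) = 0" by (rule empty.prems(2)) simp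
    then have "\<forall>b\<in>B. h b (\<lambda>_. 0) = 0"
      using indep[of "\<lambda>b. h b (\<lambda>_. 0)"] const empty.prems(1) by blast
    moreover have "x = (\<lambda>_. 0)" if "\<forall>v. v \<notin> {} \<longrightarrow> x v = 0" for x :: "'v \<Rightarrow> 'k"
      using that by (simp add: fun_eq_iff)
    ultimately show ?case by metis
  next
    case (insert v V)
    have "\<forall>b\<in>B. \<exists>P. (\<forall>j. (\<lambda>x. Polynomial.coeff (P x) j) \<in> polyfun C) \<and>
        (\<forall>x t. P (x(v := t)) = P x) \<and> (\<forall>x. h b x = poly (P x) (x v))"
      using polyfun_as_poly_in_one_variable[OF insert.prems(1) C(1,2)] by blast
    then obtain P where P: "\<And>b j. b \<in> B \<Longrightarrow> (\<lambda>x. Polynomial.coeff (P b x) j) \<in> polyfun C"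
      "\<And>b x t. b \<in> B \<Longrightarrow> P b (x(v := t)) = P b x" "\<And>b x. b \<in> B \<Longrightarrow> h b x = poly (P b x) (x v)"
      by metis
    have coeff0: "(\<Sum>b\<in>B. b * Polynomial.coeff (P b x) j) = 0" if x: "\<forall>w. w \<notin> V \<longrightarrow> x w = 0" for x j
    proof -
      \<comment> \<open>With the other coordinates fixed, this is the given relation along the
        \<open>v\<close>-axis, so it vanishes for all values of the variable and all its
        coefficients are zero.\<close>
      have "poly (\<Sum>b\<in>B. Polynomial.smult b (P b x)) t = 0" for t
      proof -
        have "poly (\<Sum>b\<in>B. Polynomial.smult b (P b x)) t = (\<Sum>b\<in>B. b * h b (x(v := t)))"
          by (simp add: poly_sum P)
        also have "\<dots> = 0" by (rule insert.prems(2)) (use x in auto)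
        finally show ?thesis .
      qed
      then have "(\<Sum>b\<in>B. Polynomial.smult b (P b x)) = 0" by (rule poly_zero_if_vanishes)
      then have "Polynomial.coeff (\<Sum>b\<in>B. Polynomial.smult b (P b x)) j = 0" by simp
      then show ?thesis by (simp add: coeff_sum)
    qed
    have coeff_P: "Polynomial.coeff (P b x) j = 0" if "b \<in> B" "\<forall>w. w \<notin> V \<longrightarrow> x w = 0" for b x j
      using insert.IH[of "\<lambda>b x. Polynomial.coeff (P b x) j"] P(1) coeff0 that by blast
    show ?case
    proof (intro ballI allI impI)
      fix b and x :: "'v \<Rightarrow> 'k" assume b: "b \<in> B" and x: "\<forall>w. w \<notin> insert v V \<longrightarrow> x w = 0"
      \<comment> \<open>After \<open>v\<close> is reset to 0 the point is supported in
        \<open>V\<close>, where the induction hypothesis applies, and \<open>P b\<close> does not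
        notice the change.\<close>
      have "P b (x(v := 0)) = 0" by (rule poly_eqI) (use coeff_P b x in auto)
      then show "h b x = 0" using P b by simp
    qed
  qed
  from this[of UNIV h] show ?thesis using h zero b by auto
qed

interpretation ac: vector_space "\<lambda>(c :: 'a::field) (x :: 'a alg_closure). to_ac c * x"
  by unfold_locales (auto simp: algebra_simps)

text \<open>The linear span, with arbitrary scalars, of the polynomial functions over
  \<open>C\<close>. It turns out to be all of \<open>polyfun UNIV\<close>; this form isolates the
  scalars that are to be expanded in a basis.\<close>

inductive_set scalar_multiples :: "'k::comm_ring_1 set \<Rightarrow> (('v \<Rightarrow> 'k) \<Rightarrow> 'k) set" for C where
  gen: "p \<in> polyfun C \<Longrightarrow> (\<lambda>x. c * p x) \<in> scalar_multiples C"
| add: "\<lbrakk>p \<in> scalar_multiples C; q \<in> scalar_multiples C\<rbrakk> \<Longrightarrow> (\<lambda>x. p x + q x) \<in> scalar_multiples C"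

lemma scalar_multiples_mult:
  assumes "p \<in> scalar_multiples C" "q \<in> scalar_multiples C"
  shows "(\<lambda>x. p x * q x) \<in> scalar_multiples C"
  using assms(1)
proof (induction rule: scalar_multiples.induct)
  case p: (gen p c)
  show ?case using assms(2)
  proof (induction rule: scalar_multiples.induct)
    case (gen q d)
    have "(\<lambda>x. (c * d) * (p x * q x)) \<in> scalar_multiples C"
      by (intro scalar_multiples.gen polyfun.mult p gen)
    then show ?case by (simp add: algebra_simps)
  next
    case (add q q')
    from scalar_multiples.add[OF add.IH] show ?case by (simp add: algebra_simps)
  qed
next
  case (add p p')
  from scalar_multiples.add[OF add.IH] show ?case by (simp add: algebra_simps)
qed

lemma polyfun_UNIV_scalar_multiples:
  assumes "1 \<in> C" "p \<in> polyfun UNIV"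
  shows "p \<in> scalar_multiples C"
  using assms(2)
proof (induction rule: polyfun.induct)
  case (const c)
  from scalar_multiples.gen[OF polyfun.const[OF assms(1)], of c] show ?case by simp
next
  case (coord v)
  from scalar_multiples.gen[OF polyfun.coord, of 1] show ?case by simp
qed (auto intro: scalar_multiples.add scalar_multiples_mult)

lemma range_to_ac_closed:
  "0 \<in> range to_ac" "1 \<in> range to_ac" "- 1 \<in> range to_ac"
  "\<And>x y. x \<in> range to_ac \<Longrightarrow> y \<in> range to_ac \<Longrightarrow> x + y \<in> range to_ac"
  "\<And>x y. x \<in> range to_ac \<Longrightarrow> y \<in> range to_ac \<Longrightarrow> x * y \<in> range to_ac"
proof -
  show "0 \<in> range to_ac" by (rule range_eqI[of _ _ 0]) simp
  show "1 \<in> range to_ac" by (rule range_eqI[of _ _ 1]) simp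
  show "- 1 \<in> range to_ac" by (rule range_eqI[of _ _ "- 1"]) simp
qed (auto simp flip: to_ac_add to_ac_mult)

text \<open>Expanding the scalars in an \<open>F\<close>-basis of \<open>K\<close> shows that the
  polynomials over \<open>K\<close> are sums of basis elements times polynomials over
  \<open>F\<close>.\<close>

lemma polyfun_UNIV_decompose:
  fixes p :: "('v \<Rightarrow> 'a::field alg_closure) \<Rightarrow> 'a alg_closure"
  assumes "p \<in> polyfun UNIV"
  shows "\<exists>B g. finite B \<and> ac.independent B \<and> (\<forall>b. g b \<in> polyfun (range to_ac)) \<and>
    (\<forall>x. p x = (\<Sum>b\<in>B. b * g b x))"
proof -
  define B where "B = ac.extend_basis ({} :: 'a alg_closure set)"
  have B: "ac.independent B" "ac.span B = UNIV"
    unfolding B_def using ac.independent_extend_basis ac.span_extend_basis ac.independent_empty by blast+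
  have "p \<in> scalar_multiples (range to_ac)"
    using assms polyfun_UNIV_scalar_multiples range_to_ac_closed by blast
  \<comment> \<open>Keeping \<open>A\<close> inside one fixed basis and \<open>g\<close> zero
    outside \<open>A\<close> lets two expansions be added over the union of their index
    sets.\<close>
  then have "\<exists>A g. finite A \<and> A \<subseteq> B \<and> (\<forall>b. g b \<in> polyfun (range to_ac)) \<and>
      (\<forall>b x. b \<notin> A \<longrightarrow> g b x = 0) \<and> (\<forall>x. p x = (\<Sum>b\<in>A. b * g b x))"
  proof (induction rule: scalar_multiples.induct)
    case (gen p c)
    define r where "r = ac.representation B c"
    let ?A = "{b. r b \<noteq> 0}"
    have "?A \<subseteq> B" unfolding r_def using ac.representation_ne_zero by blast
    moreover have "c = (\<Sum>b\<in>?A. to_ac (r b) * b)"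
      unfolding r_def using ac.sum_nonzero_representation_eq[OF B(1)] B(2) by auto
    from arg_cong[OF this, of "\<lambda>y. y * p x" for x]
    have "c * p x = (\<Sum>b\<in>?A. b * (to_ac (r b) * p x))" for x
      by (simp add: sum_distrib_right mult.assoc mult.left_commute)
    moreover have "finite ?A" unfolding r_def by (rule ac.finite_representation)
    moreover have "(\<lambda>x. to_ac (r b) * p x) \<in> polyfun (range to_ac)" for b
      by (intro polyfun.mult polyfun.const gen) auto
    ultimately show ?case
      by (intro exI[of _ ?A] exI[of _ "\<lambda>b x. to_ac (r b) * p x"] conjI allI) simp_all
  next
    case (add p q)
    from add.IH(1) obtain A g where "finite A \<and> A \<subseteq> B \<and> (\<forall>b. g b \<in> polyfun (range to_ac)) \<and>
      (\<forall>b x. b \<notin> A \<longrightarrow> g b x = 0) \<and> (\<forall>x. p x = (\<Sum>b\<in>A. b * g b x))" by (elim exE)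
    then have A: "finite A" "A \<subseteq> B" "\<And>b. g b \<in> polyfun (range to_ac)" "\<And>b x. b \<notin> A \<Longrightarrow> g b x = 0"
        "\<And>x. p x = (\<Sum>b\<in>A. b * g b x)" by simp_all
    from add.IH(2) obtain D h where "finite D \<and> D \<subseteq> B \<and> (\<forall>b. h b \<in> polyfun (range to_ac)) \<and>
      (\<forall>b x. b \<notin> D \<longrightarrow> h b x = 0) \<and> (\<forall>x. q x = (\<Sum>b\<in>D. b * h b x))" by (elim exE)
    then have D: "finite D" "D \<subseteq> B" "\<And>b. h b \<in> polyfun (range to_ac)" "\<And>b x. b \<notin> D \<Longrightarrow> h b x = 0"
        "\<And>x. q x = (\<Sum>b\<in>D. b * h b x)" by simp_all
    have "p x = (\<Sum>b\<in>A \<union> D. b * g b x)" for x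
      unfolding A(5) by (rule sum.mono_neutral_left) (use A D in auto)
    moreover have "q x = (\<Sum>b\<in>A \<union> D. b * h b x)" for x
      unfolding D(5) by (rule sum.mono_neutral_left) (use A D in auto)
    ultimately have "p x + q x = (\<Sum>b\<in>A \<union> D. b * (g b x + h b x))" for x
      by (simp add: distrib_left sum.distrib)
    then show ?case using A(1-4) D(1-4)
      by (intro exI[of _ "A \<union> D"] exI[of _ "\<lambda>b x. g b x + h b x"] conjI allI) (simp_all add: polyfun.add)
  qed
  then show ?thesis using B(1) ac.independent_mono by blast
qed

lemma zero_set_vanishing_ideal:
  assumes "E \<subseteq> polyfun UNIV"
  shows "zero_set (vanishing_ideal UNIV (zero_set E)) = zero_set E"
  using assms by (auto simp: zero_set_def vanishing_ideal_def)

lemma poly_ideal_vanishes: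
  assumes "p \<in> poly_ideal A" "\<And>q. q \<in> A \<Longrightarrow> q x = 0"
  shows "p x = 0"
  using assms(1) by (induction rule: poly_ideal.induct) (auto simp: assms(2))

lemma poly_ideal_polyfun:
  assumes "p \<in> poly_ideal A" "A \<subseteq> polyfun UNIV"
  shows "p \<in> polyfun UNIV"
  using assms(1)
  by (induction rule: poly_ideal.induct) (use assms(2) in \<open>auto intro: polyfun.intros\<close>)

lemma poly_ideal_sum:
  assumes "\<And>i. i \<in> B \<Longrightarrow> f i \<in> poly_ideal A"
  shows "(\<lambda>x. \<Sum>i\<in>B. f i x) \<in> poly_ideal A"
  using assms by (induction B rule: infinite_finite_induct) (auto intro: poly_ideal.zero poly_ideal.add)

text \<open>If \<open>p\<close> vanishes on \<open>S\<close>, write it as a sum of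
  \<open>b * g b\<close> with \<open>g b\<close> over \<open>F\<close>. Pulled back along
  \<open>\<psi> i\<close>, this is a relation among polynomials over \<open>F\<close> on an affine
  space, so \<open>polyfun_independent\<close> makes every pullback of \<open>g b\<close> zero.
  Hence each \<open>g b\<close> vanishes on \<open>S\<close>, and \<open>p\<close> lies in the ideal
  generated over \<open>F\<close>. The index \<open>i\<close> allows several components, as for the
  group of two points.\<close>

lemma defined_over_images:
  fixes \<psi> :: "'i \<Rightarrow> ('u::finite \<Rightarrow> 'a::field alg_closure) \<Rightarrow> 'v \<Rightarrow> 'a alg_closure"
  assumes S: "S = (\<Union>i. range (\<psi> i))"
    and \<psi>: "\<And>i v. (\<lambda>x. \<psi> i x v) \<in> polyfun (range to_ac)"
    and closed: "S = zero_set E" "E \<subseteq> polyfun UNIV"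
  shows "defined_over (range to_ac) S"
  unfolding defined_over_def
proof
  show "zero_set (vanishing_ideal UNIV S) = S" using zero_set_vanishing_ideal closed by simp
  let ?C = "range to_ac :: 'a alg_closure set"
  show "vanishing_ideal UNIV S = poly_ideal (vanishing_ideal ?C S)"
  proof
    show "poly_ideal (vanishing_ideal ?C S) \<subseteq> vanishing_ideal UNIV S"
    proof
      fix p assume p: "p \<in> poly_ideal (vanishing_ideal ?C S)"
      have "vanishing_ideal ?C S \<subseteq> polyfun UNIV"
        using polyfun_mono[OF subset_UNIV] by (auto simp: vanishing_ideal_def)
      with p have "p \<in> polyfun UNIV" by (rule poly_ideal_polyfun)
      moreover have "p x = 0" if "x \<in> S" for x
        by (rule poly_ideal_vanishes[OF p]) (use that in \<open>auto simp: vanishing_ideal_def\<close>)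
      ultimately show "p \<in> vanishing_ideal UNIV S" by (simp add: vanishing_ideal_def)
    qed
    show "vanishing_ideal UNIV S \<subseteq> poly_ideal (vanishing_ideal ?C S)"
    proof
      fix p assume p: "p \<in> vanishing_ideal UNIV S"
      then have "p \<in> polyfun UNIV" by (simp add: vanishing_ideal_def)
      from polyfun_UNIV_decompose[OF this]
      obtain B g where "finite B \<and> ac.independent B \<and> (\<forall>b. g b \<in> polyfun ?C) \<and>
        (\<forall>x. p x = (\<Sum>b\<in>B. b * g b x))" by (elim exE)
      then have B: "finite B" "ac.independent B" and g: "\<And>b. g b \<in> polyfun ?C"
        and p_eq: "\<And>x. p x = (\<Sum>b\<in>B. b * g b x)" by simp_all
      have indep: "\<forall>b\<in>B. c b = 0" if c: "\<forall>b\<in>B. c b \<in> ?C" and eq: "(\<Sum>b\<in>B. b * c b) = 0" for c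
      proof -
        from c obtain d where d: "\<And>b. b \<in> B \<Longrightarrow> c b = to_ac (d b)"
          using bchoice[of B "\<lambda>b d. c b = to_ac d"] by blast
        have "(\<Sum>b\<in>B. to_ac (d b) * b) = 0"
          using eq d by (simp add: mult.commute)
        then have "\<forall>b\<in>B. d b = 0"
          using B ac.dependent_finite by blast
        then show ?thesis using d by simp
      qed
      have "g b s = 0" if b: "b \<in> B" and s: "s \<in> S" for b s
      proof -
        from s S obtain i x where s_eq: "s = \<psi> i x" by auto
        have "(\<Sum>b\<in>B. b * g b (\<psi> i x)) = 0" for x
          using p S unfolding vanishing_ideal_def p_eq[symmetric] by blast
        moreover have "(\<lambda>x. g b (\<psi> i x)) \<in> polyfun ?C" for b
          by (rule polyfun_comp[OF g \<psi>])
        ultimately show ?thesis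
          using polyfun_independent[of ?C B "\<lambda>b x. g b (\<psi> i x)" b x] range_to_ac_closed indep b s_eq
          by blast
      qed
      then have gI: "g b \<in> poly_ideal (vanishing_ideal ?C S)" if "b \<in> B" for b
        using that g by (auto intro: poly_ideal.gen simp: vanishing_ideal_def)
      have "(\<lambda>x. \<Sum>b\<in>B. b * g b x) \<in> poly_ideal (vanishing_ideal ?C S)"
        by (rule poly_ideal_sum) (use poly_ideal.mult[OF polyfun.const gI] in auto)
      then show "p \<in> poly_ideal (vanishing_ideal ?C S)"
        using p_eq by presburger
    qed
  qed
qed

section \<open>The Zariski topology and connected images of affine spaces\<close>

lemma topspace_zariski [simp]: "topspace zariski = (UNIV :: ('v \<Rightarrow> 'k::idom) set)"
proof -
  have "openin zariski (UNIV :: ('v \<Rightarrow> 'k) set)"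
    unfolding openin_zariski
    by (rule exI[of _ "{\<lambda>_. 1}"]) (auto simp: zero_set_def intro: polyfun.const)
  then show ?thesis by (simp add: openin_subset top.extremum_uniqueI)
qed

lemma closedin_zariski: "E \<subseteq> polyfun UNIV \<Longrightarrow> closedin zariski (zero_set E)"
  by (auto simp: closedin_def openin_zariski)

lemma closedin_zariskiE:
  assumes "closedin zariski S"
  obtains E where "E \<subseteq> polyfun UNIV" "S = zero_set E"
  using assms by (auto simp: closedin_def openin_zariski)

text \<open>If two closed sets separated the line, there would be an equation of each that is not
  identically zero on the line, while their product vanishes on all of it; but polynomials in one
  variable form an integral domain.\<close>

lemma connectedin_zariski_line:
  fixes \<psi> :: "('u \<Rightarrow> 'k::alg_closed_field) \<Rightarrow> 'v \<Rightarrow> 'k"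
  assumes "\<And>v. (\<lambda>x. \<psi> x v) \<in> polyfun UNIV"
  shows "connectedin zariski (range (\<lambda>t. \<psi> (\<lambda>u. t * x u)))" (is "connectedin _ ?L")
  unfolding connectedin_closedin
proof (intro conjI notI)
  assume "\<exists>E1 E2. closedin zariski E1 \<and> closedin zariski E2 \<and> ?L \<subseteq> E1 \<union> E2 \<and>
    E1 \<inter> E2 \<inter> ?L = {} \<and> E1 \<inter> ?L \<noteq> {} \<and> E2 \<inter> ?L \<noteq> {}"
  then obtain D E where D: "D \<subseteq> polyfun UNIV" and E: "E \<subseteq> polyfun UNIV"
    and cover: "?L \<subseteq> zero_set D \<union> zero_set E" "zero_set D \<inter> zero_set E \<inter> ?L = {}"
      "zero_set D \<inter> ?L \<noteq> {}" "zero_set E \<inter> ?L \<noteq> {}"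
    by (metis closedin_zariskiE)
  have line: "\<exists>P. \<forall>t. p (\<psi> (\<lambda>u. t * x u)) = poly P t" if "p \<in> polyfun UNIV" for p
    by (rule polyfun_on_line) (rule polyfun_comp[OF that assms])
  from cover(2,4) obtain s where "\<psi> (\<lambda>u. s * x u) \<notin> zero_set D" by auto
  then obtain p where p: "p \<in> D" "p (\<psi> (\<lambda>u. s * x u)) \<noteq> 0" by (auto simp: zero_set_def)
  from cover(2,3) obtain t where "\<psi> (\<lambda>u. t * x u) \<notin> zero_set E" by auto
  then obtain q where q: "q \<in> E" "q (\<psi> (\<lambda>u. t * x u)) \<noteq> 0" by (auto simp: zero_set_def)
  obtain P Q where P: "\<And>t. p (\<psi> (\<lambda>u. t * x u)) = poly P t"
    and Q: "\<And>t. q (\<psi> (\<lambda>u. t * x u)) = poly Q t"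
    using line p q D E by (metis subsetD)
  have "poly (P * Q) r = 0" for r
  proof -
    have "\<psi> (\<lambda>u. r * x u) \<in> zero_set D \<union> zero_set E" using cover(1) by blast
    then have "p (\<psi> (\<lambda>u. r * x u)) = 0 \<or> q (\<psi> (\<lambda>u. r * x u)) = 0"
      using p(1) q(1) by (auto simp: zero_set_def)
    then show ?thesis using P Q by auto
  qed
  then have "P * Q = 0" by (rule poly_zero_if_vanishes)
  then show False using p q P Q by auto
qed simp

text \<open>The image of \<open>\<psi>\<close> is connected because each of its points lies on the
  image of a line through the origin, which contains \<open>e\<close>. It is the whole component
  because both it and the rest of \<open>S\<close> are closed.\<close>

lemma connected_component_of_zariski:
  fixes \<psi> :: "('u \<Rightarrow> 'k::alg_closed_field) \<Rightarrow> 'v \<Rightarrow> 'k"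
  assumes \<psi>: "\<And>v. (\<lambda>x. \<psi> x v) \<in> polyfun UNIV" and one: "\<psi> (\<lambda>_. 0) = e"
    and closed: "D \<subseteq> polyfun UNIV" "E \<subseteq> polyfun UNIV" "range \<psi> = zero_set D"
    and S: "S = zero_set D \<union> zero_set E" "zero_set D \<inter> zero_set E = {}"
  shows "connected_component_of_set (subtopology zariski S) e = range \<psi>"
proof
  have e: "e \<in> range \<psi>" using one by blast
  show "range \<psi> \<subseteq> connected_component_of_set (subtopology zariski S) e"
  proof
    fix y assume "y \<in> range \<psi>"
    then obtain x where y: "y = \<psi> x" by blast
    let ?L = "range (\<lambda>t. \<psi> (\<lambda>u. t * x u))"
    have "connectedin (subtopology zariski S) ?L"
      unfolding connectedin_subtopology using connectedin_zariski_line[OF \<psi>] closed S by fastforce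
    moreover have "e \<in> ?L" using one by (intro range_eqI[of _ _ 0]) simp
    moreover have "y \<in> ?L" using y by (intro range_eqI[of _ _ 1]) simp
    ultimately show "y \<in> connected_component_of_set (subtopology zariski S) e"
      by (auto simp: connected_component_of_def)
  qed
  show "connected_component_of_set (subtopology zariski S) e \<subseteq> range \<psi>"
  proof
    fix y assume "y \<in> connected_component_of_set (subtopology zariski S) e"
    then obtain T where T: "connectedin zariski T" "T \<subseteq> S" "e \<in> T" "y \<in> T"
      by (auto simp: connected_component_of_def connectedin_subtopology)
    have "closedin zariski (zero_set D)" "closedin zariski (zero_set E)"
      using closed closedin_zariski by blast+
    with T(1) have "\<not> (T \<subseteq> zero_set D \<union> zero_set E \<and> zero_set D \<inter> zero_set E \<inter> T = {} \<and>
        zero_set D \<inter> T \<noteq> {} \<and> zero_set E \<inter> T \<noteq> {})"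
      unfolding connectedin_closedin by blast
    then show "y \<in> range \<psi>" using T S e closed by auto
  qed
qed



section \<open>The split quaternion algebra and its two involutions\<close>

section \<open>Two-by-two matrices over a ring\<close>

text \<open>
  The type is iterated: \<open>'k m2\<close> is the split quaternion algebra, with quaternion conjugation
  \<open>adj\<close> and orthogonal involution \<open>tp\<close>, and \<open>'k m2 m2\<close> contains \<open>SL\<^sup>\<ddagger>(2, H)\<close>.
\<close>

datatype 'a m2 = M2 (m11: 'a) (m12: 'a) (m21: 'a) (m22: 'a)

instantiation m2 :: (ring_1) ring_1
begin

fun plus_m2 :: "'a m2 \<Rightarrow> 'a m2 \<Rightarrow> 'a m2" where
  "M2 a b c d + M2 a' b' c' d' = M2 (a + a') (b + b') (c + c') (d + d')"
fun minus_m2 :: "'a m2 \<Rightarrow> 'a m2 \<Rightarrow> 'a m2" where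
  "M2 a b c d - M2 a' b' c' d' = M2 (a - a') (b - b') (c - c') (d - d')"
fun uminus_m2 :: "'a m2 \<Rightarrow> 'a m2" where
  "- M2 a b c d = M2 (- a) (- b) (- c) (- d)"
fun times_m2 :: "'a m2 \<Rightarrow> 'a m2 \<Rightarrow> 'a m2" where
  "M2 a b c d * M2 a' b' c' d' =
     M2 (a * a' + b * c') (a * b' + b * d') (c * a' + d * c') (c * b' + d * d')"
definition "0 = M2 0 0 0 0"
definition "1 = M2 1 0 0 1"

instance
proof
  fix a b c :: "'a m2"
  show "a + b + c = a + (b + c)" by (cases a; cases b; cases c) simp
  show "a + b = b + a" by (cases a; cases b) simp
  show "0 + a = a" by (cases a) (simp add: zero_m2_def)
  show "- a + a = 0" by (cases a) (simp add: zero_m2_def)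
  show "a - b = a + - b" by (cases a; cases b) simp
  show "a * b * c = a * (b * c)" by (cases a; cases b; cases c) (simp add: algebra_simps)
  show "1 * a = a" by (cases a) (simp add: one_m2_def)
  show "a * 1 = a" by (cases a) (simp add: one_m2_def)
  show "(a + b) * c = a * c + b * c" by (cases a; cases b; cases c) (simp add: algebra_simps)
  show "a * (b + c) = a * b + a * c" by (cases a; cases b; cases c) (simp add: algebra_simps)
  show "(0 :: 'a m2) \<noteq> 1" by (simp add: zero_m2_def one_m2_def)
qed

end

lemma m2_sel_simps [simp]:
  "m11 (x + y) = m11 x + m11 y" "m12 (x + y) = m12 x + m12 y"
  "m21 (x + y) = m21 x + m21 y" "m22 (x + y) = m22 x + m22 y"
  "m11 (x - y) = m11 x - m11 y" "m12 (x - y) = m12 x - m12 y"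
  "m21 (x - y) = m21 x - m21 y" "m22 (x - y) = m22 x - m22 y"
  "m11 (- x) = - m11 x" "m12 (- x) = - m12 x" "m21 (- x) = - m21 x" "m22 (- x) = - m22 x"
  "m11 (x * y) = m11 x * m11 y + m12 x * m21 y" "m12 (x * y) = m11 x * m12 y + m12 x * m22 y"
  "m21 (x * y) = m21 x * m11 y + m22 x * m21 y" "m22 (x * y) = m21 x * m12 y + m22 x * m22 y"
  "m11 0 = 0" "m12 0 = 0" "m21 0 = 0" "m22 0 = 0"
  "m11 1 = 1" "m12 1 = 0" "m21 1 = 0" "m22 1 = 1"
  for x y :: "'a::ring_1 m2"
  by (cases x; cases y; simp add: zero_m2_def one_m2_def)+

lemma m2_eq_iff: "x = y \<longleftrightarrow> m11 x = m11 y \<and> m12 x = m12 y \<and> m21 x = m21 y \<and> m22 x = m22 y"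
  by (cases x; cases y) simp

lemma m2_sel_sum:
  fixes f :: "'i \<Rightarrow> 'a::ring_1 m2"
  shows "m11 (sum f A) = (\<Sum>i\<in>A. m11 (f i))" "m12 (sum f A) = (\<Sum>i\<in>A. m12 (f i))"
    "m21 (sum f A) = (\<Sum>i\<in>A. m21 (f i))" "m22 (sum f A) = (\<Sum>i\<in>A. m22 (f i))"
  by (induction A rule: infinite_finite_induct; simp)+

definition scal :: "'k::ring_1 \<Rightarrow> 'k m2" where "scal k = M2 k 0 0 k"
definition adj :: "'k::ring_1 m2 \<Rightarrow> 'k m2" where "adj x = M2 (m22 x) (- m12 x) (- m21 x) (m11 x)"
definition tp :: "'k m2 \<Rightarrow> 'k m2" where "tp x = M2 (m11 x) (m21 x) (m12 x) (m22 x)"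
definition det2 :: "'k::ring_1 m2 \<Rightarrow> 'k" where "det2 x = m11 x * m22 x - m12 x * m21 x"
definition hat :: "'k::ring_1 m2 m2 \<Rightarrow> 'k m2 m2" where
  "hat M = M2 (tp (m22 M)) (- tp (m12 M)) (- tp (m21 M)) (tp (m11 M))"
text \<open>The conjugate transpose with respect to quaternion conjugation, in contrast to
  \<open>hat\<close>, which is built from the orthogonal involution.\<close>

definition star :: "'k::ring_1 m2 m2 \<Rightarrow> 'k m2 m2" where
  "star M = M2 (adj (m11 M)) (adj (m21 M)) (adj (m12 M)) (adj (m22 M))"

lemma scal_sel [simp]: "m11 (scal k) = k" "m12 (scal k) = 0" "m21 (scal k) = 0" "m22 (scal k) = k"
  by (simp_all add: scal_def)

lemma adj_sel [simp]: "m11 (adj x) = m22 x" "m12 (adj x) = - m12 x" "m21 (adj x) = - m21 x" "m22 (adj x) = m11 x"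
  by (simp_all add: adj_def)

lemma tp_sel [simp]: "m11 (tp x) = m11 x" "m12 (tp x) = m21 x" "m21 (tp x) = m12 x" "m22 (tp x) = m22 x"
  by (simp_all add: tp_def)

lemma hat_sel [simp]: "m11 (hat M) = tp (m22 M)" "m12 (hat M) = - tp (m12 M)"
    "m21 (hat M) = - tp (m21 M)" "m22 (hat M) = tp (m11 M)"
  by (simp_all add: hat_def)

lemma star_sel [simp]: "m11 (star M) = adj (m11 M)" "m12 (star M) = adj (m21 M)"
    "m21 (star M) = adj (m12 M)" "m22 (star M) = adj (m22 M)"
  by (simp_all add: star_def)

lemma adj_mult_self: "adj x * x = scal (det2 x)" "x * adj x = scal (det2 x)" for x :: "'k::comm_ring_1 m2"
  by (simp_all add: m2_eq_iff det2_def algebra_simps)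

lemma tp_mult: "tp (x * y) = tp y * tp x" for x y :: "'k::comm_ring_1 m2"
  by (simp add: m2_eq_iff algebra_simps)

lemma det2_mult: "det2 (x * y) = det2 x * det2 y" for x y :: "'k::comm_ring_1 m2"
  by (simp add: det2_def algebra_simps)

lemma det2_1 [simp]: "det2 1 = 1" and det2_tp [simp]: "det2 (tp y) = det2 y"
 for y :: "'k::comm_ring_1 m2"
  by (simp_all add: det2_def algebra_simps)

lemma hat_mult: "hat (M * Y) = hat Y * hat M" for M Y :: "'k::comm_ring_1 m2 m2"
  by (simp add: m2_eq_iff algebra_simps)

lemma hat_1 [simp]: "hat 1 = 1" and hat_hat [simp]: "hat (hat M) = M"
  and hat_uminus [simp]: "hat (- M) = - hat M" for M :: "'k::comm_ring_1 m2 m2"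
  by (simp_all add: m2_eq_iff)

lemma star_mult: "star (M * Y) = star Y * star M" for M Y :: "'k::comm_ring_1 m2 m2"
  by (simp add: m2_eq_iff algebra_simps)

lemma star_1 [simp]: "star 1 = 1" by (simp add: m2_eq_iff)

section \<open>The symplectic group Sp(4) and its generation by unipotents\<close>

section \<open>The split form of \<open>SL\<^sup>\<ddagger>(2, H)\<close>\<close>

text \<open>For transposition as the involution, \<open>hat\<close> is the adjoint with respect to
  the standard symplectic form, so this is Sp(4) in 2-by-2 blocks.\<close>

definition sp :: "'k::comm_ring_1 m2 m2 set" where "sp = {M. M * hat M = 1}"

definition symm :: "'k m2 \<Rightarrow> bool" where "symm x \<longleftrightarrow> tp x = x"

definition upper :: "'k::ring_1 m2 \<Rightarrow> 'k m2 m2" where "upper x = M2 1 x 0 1"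
definition lower :: "'k::ring_1 m2 \<Rightarrow> 'k m2 m2" where "lower x = M2 1 0 x 1"

lemma upper_sel [simp]: "m11 (upper x) = 1" "m12 (upper x) = x" "m21 (upper x) = 0" "m22 (upper x) = 1"
  and lower_sel [simp]: "m11 (lower x) = 1" "m12 (lower x) = 0" "m21 (lower x) = x" "m22 (lower x) = 1"
  by (simp_all add: upper_def lower_def)

lemma symm_iff: "symm x \<longleftrightarrow> m12 x = m21 x" by (auto simp: symm_def m2_eq_iff)

lemma tp_1 [simp]: "tp 1 = 1" "tp 0 = 0" "adj 1 = 1" "adj 0 = 0"
  by (simp_all add: m2_eq_iff)

lemma mult_scal_adj:
  fixes x :: "'k::field m2"
  assumes "det2 x \<noteq> 0"
  shows "x * (scal (1 / det2 x) * adj x) = 1"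
proof -
  have "x * (scal k * adj x) = scal (k * det2 x)" for k
    by (simp add: m2_eq_iff det2_def algebra_simps)
  from this[of "1 / det2 x"] show ?thesis using assms by (simp add: scal_def one_m2_def)
qed

text \<open>The hypothesis and both conclusions are the same single scalar equation. For invertible
  \<open>a\<close> it says that the quotient of \<open>b\<close> by \<open>a\<close> is
  symmetric.\<close>

lemma symm_adj_mult:
  fixes a b :: "'k::comm_ring_1 m2"
  assumes "symm (a * tp b)"
  shows "symm (adj a * b)" "symm (adj b * a)"
  using assms by (auto simp: symm_iff algebra_simps)

lemma symm_closed:
  "symm x \<Longrightarrow> symm y \<Longrightarrow> symm (x - y)" "symm x \<Longrightarrow> symm (- x)" "symm x \<Longrightarrow> symm (scal k * x)"
  "symm x \<Longrightarrow> symm (adj x)" "symm 1" "symm 0"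
  for x y :: "'k::comm_ring_1 m2"
  by (auto simp: symm_iff)

lemma sp_upper: "symm x \<Longrightarrow> upper x \<in> sp" and sp_lower: "symm x \<Longrightarrow> lower x \<in> sp"
  for x :: "'k::comm_ring_1 m2"
  by (simp_all add: sp_def symm_iff m2_eq_iff)

lemma sp_1 [simp]: "1 \<in> sp" by (simp add: sp_def)

lemma sp_mult:
  assumes "M \<in> sp" "Y \<in> sp"
  shows "M * Y \<in> sp"
proof -
  have "M * Y * hat (M * Y) = M * (Y * hat Y) * hat M" by (simp only: hat_mult mult.assoc)
  then show ?thesis using assms by (simp add: sp_def)
qed

lemma upper_lower_inverse:
  "upper x * upper (- x) = 1" "upper (- x) * upper x = 1"
  "lower x * lower (- x) = 1" "lower (- x) * lower x = 1"
  by (simp_all add: m2_eq_iff)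

text \<open>The two diagonal blocks of \<open>M * hat M\<close> are transposes of each other, and
  each off-diagonal block is, up to sign, the failure of a product of blocks to be
  symmetric.\<close>

lemma sp_iff:
  "M \<in> sp \<longleftrightarrow> m11 M * tp (m22 M) - m12 M * tp (m21 M) = 1 \<and>
     symm (m11 M * tp (m12 M)) \<and> symm (m21 M * tp (m22 M))"
  for M :: "'k::comm_ring_1 m2 m2"
proof -
  have tp_simps: "tp (x - y) = tp x - tp y" "tp (tp x) = x" for x y :: "'k m2"
    by (simp_all add: m2_eq_iff)
  define p where "p = m11 M * tp (m22 M) - m12 M * tp (m21 M)"
  have 1: "m11 (M * hat M) = p" by (simp add: p_def)
  have 2: "m22 (M * hat M) = tp p" by (simp add: p_def tp_simps tp_mult)
  have 3: "tp p = 1 \<longleftrightarrow> p = 1" by (metis tp_simps(2) tp_1(1))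
  have 4: "m12 (M * hat M) = 0 \<longleftrightarrow> symm (m11 M * tp (m12 M))"
  proof -
    have "m12 (M * hat M) = tp (m11 M * tp (m12 M)) - m11 M * tp (m12 M)" by (simp add: tp_simps tp_mult)
    then show ?thesis by (simp only: symm_def right_minus_eq)
  qed
  have 5: "m21 (M * hat M) = 0 \<longleftrightarrow> symm (m21 M * tp (m22 M))"
  proof -
    have "m21 (M * hat M) = - (tp (m21 M * tp (m22 M)) - m21 M * tp (m22 M))" by (simp add: tp_simps tp_mult)
    then show ?thesis by (simp only: symm_def right_minus_eq neg_equal_0_iff_equal)
  qed
  have "M \<in> sp \<longleftrightarrow> m11 (M * hat M) = 1 \<and> m12 (M * hat M) = 0 \<and> m21 (M * hat M) = 0 \<and> m22 (M * hat M) = 1"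
    unfolding sp_def mem_Collect_eq m2_eq_iff[of "M * hat M" 1] m2_sel_simps(21-24) ..
  then show ?thesis unfolding 1 2 3 4 5 p_def[symmetric] by blast
qed

text \<open>Multiplying by \<open>lower x\<close> on the right replaces the block \<open>a\<close>
  by \<open>a + b * x\<close>; the lemma makes that block invertible. When both blocks are singular,
  \<open>det2 (a + b * x)\<close> is linear in \<open>x\<close>, with coefficients the entries of
  \<open>adj a * b\<close>. If these all vanished, the first relation would force
  \<open>a = 0\<close> and then make \<open>b\<close> invertible.\<close>

lemma exists_symm_det2_nonzero:
  fixes a b c d :: "'k::field m2"
  assumes "(2 :: 'k) \<noteq> 0" and one: "a * tp d - b * tp c = 1" and "symm (a * tp b)"
  shows "\<exists>x. symm x \<and> det2 (a + b * x) \<noteq> 0"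
proof -
  consider "det2 b \<noteq> 0" | "det2 b = 0" "det2 a \<noteq> 0" | "det2 b = 0" "det2 a = 0" by blast
  then show ?thesis
  proof cases
    case 1
    \<comment> \<open>Here \<open>x\<close> is 1 minus the inverse of \<open>b\<close> times
      \<open>a\<close>, so that \<open>a + b * x = b\<close>.\<close>
    let ?x = "1 - scal (1 / det2 b) * (adj b * a)"
    have "a + b * ?x = b"
      using mult_scal_adj[OF 1] by (simp add: right_diff_distrib flip: mult.assoc)
    moreover have "symm ?x" using symm_adj_mult(2)[OF assms(3)] symm_closed by metis
    ultimately show ?thesis using 1 by (intro exI[of _ ?x]) simp
  next
    case 2
    then show ?thesis by (intro exI[of _ 0]) (simp add: symm_iff)
  next
    case 3
    define m where "m = adj a * b"
    have m: "m12 m = m21 m" using assms(3) by (simp add: m_def symm_iff algebra_simps)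
    have det: "det2 (a + b * x) = m11 m * m11 x + m12 m * m21 x + m21 m * m12 x + m22 m * m22 x" for x
    proof -
      have "det2 (a + b * x) = det2 a + det2 b * det2 x
          + (m11 m * m11 x + m12 m * m21 x + m21 m * m12 x + m22 m * m22 x)"
        by (simp add: m_def det2_def algebra_simps)
      then show ?thesis using 3 by simp
    qed
    have "m \<noteq> 0"
    proof
      assume "m = 0"
      have "adj a * (a * tp d - b * tp c) = scal (det2 a) * tp d - m * tp c"
        by (simp add: right_diff_distrib m_def adj_mult_self flip: mult.assoc)
      then have "adj a = 0" using one 3 \<open>m = 0\<close> by (simp add: m2_eq_iff)
      then have "a = 0" by (simp add: m2_eq_iff)
      then have "det2 b * det2 (- tp c) = 1" using one by (simp flip: det2_mult)
      then show False using 3 by simp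
    qed
    then consider "m11 m \<noteq> 0" | "m22 m \<noteq> 0" | "m12 m \<noteq> 0" using m by (auto simp: m2_eq_iff)
    then show ?thesis
    proof cases
      case 1
      then show ?thesis using det by (intro exI[of _ "M2 1 0 0 0"]) (simp add: symm_iff)
    next
      case 2
      then show ?thesis using det by (intro exI[of _ "M2 0 0 0 1"]) (simp add: symm_iff)
    next
      case 3
      \<comment> \<open>As \<open>m\<close> is symmetric, the two off-diagonal terms add up to twice
        an entry, which is nonzero in characteristic not 2.\<close>
      then show ?thesis using det m assms(1)
        by (intro exI[of _ "M2 0 1 1 0"]) (simp add: symm_iff flip: mult_2)
    qed
  qed
qed

text \<open>Every 2-by-2 matrix is a symmetric matrix times the inverse of a symmetric one. Symmetry
  of \<open>a * w\<close> is a single linear equation in the three entries of \<open>w\<close>; the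
  witnesses are invertible solutions of it.\<close>

lemma exists_symm_symmetrizer:
  fixes a :: "'k::field m2"
  shows "\<exists>w. symm w \<and> det2 w \<noteq> 0 \<and> symm (a * w)"
proof -
  consider "m12 a = 0" "m21 a = 0" | "m12 a \<noteq> 0" "m21 a \<noteq> 0" | "m12 a = 0" "m21 a \<noteq> 0" | "m12 a \<noteq> 0" "m21 a = 0"
    by blast
  then show ?thesis
  proof cases
    case 1
    then show ?thesis by (intro exI[of _ 1]) (simp add: symm_iff)
  next
    case 2
    then show ?thesis by (intro exI[of _ "M2 (m12 a) 0 0 (m21 a)"]) (simp add: symm_iff det2_def)
  next
    case 3
    then show ?thesis
      by (intro exI[of _ "M2 ((m11 a - m22 a) / m21 a) 1 1 0"]) (simp add: symm_iff det2_def)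
  next
    case 4
    then show ?thesis
      by (intro exI[of _ "M2 0 1 1 ((m22 a - m11 a) / m12 a)"]) (simp add: symm_iff det2_def)
  qed
qed

text \<open>Block elimination by column operations. A lower factor makes the top left block
  invertible, an upper factor makes the top right block symmetric and invertible, and then one lower
  and one upper factor turn the top row into \<open>(1, 0)\<close>; the relations of
  \<open>sp\<close> leave only a lower unipotent. The fixed pattern of factors is what later yields
  one parametrization of the whole group.\<close>

lemma sp_factorization:
  fixes M :: "'k::field m2 m2"
  assumes two: "(2 :: 'k) \<noteq> 0" and M: "M \<in> sp"
  shows "\<exists>s1 s2 s3 s4 s5. symm s1 \<and> symm s2 \<and> symm s3 \<and> symm s4 \<and> symm s5 \<and>
    M = lower s1 * upper s2 * lower s3 * upper s4 * lower s5"
proof -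
  have "m11 M * tp (m22 M) - m12 M * tp (m21 M) = 1" "symm (m11 M * tp (m12 M))"
    using M sp_iff by blast+
  then obtain x where x: "symm x" "det2 (m11 M + m12 M * x) \<noteq> 0"
    using exists_symm_det2_nonzero[OF two] by blast
  define Y where "Y = M * lower x"
  have Y: "Y \<in> sp" unfolding Y_def by (intro sp_mult M sp_lower x)
  define a where "a = m11 Y"
  define b where "b = m12 Y"
  have a: "det2 a \<noteq> 0" using x(2) by (simp add: a_def Y_def)
  obtain w where w: "symm w" "det2 w \<noteq> 0" "symm (a * w)" using exists_symm_symmetrizer by blast
  let ?ai = "scal (1 / det2 a) * adj a"
  have ai: "a * ?ai = 1" using mult_scal_adj[OF a] .
  \<comment> \<open>Chosen so that the new top right block \<open>a * y + b\<close> equals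
    \<open>a * w\<close>, which is symmetric and invertible.\<close>
  define y where "y = w - ?ai * b"
  have "symm (a * tp b)" using Y sp_iff unfolding a_def b_def by blast
  then have "symm (?ai * b)" unfolding mult.assoc by (metis symm_closed(3) symm_adj_mult(1))
  then have y: "symm y" unfolding y_def by (rule symm_closed(1)[OF w(1)])
  define Z where "Z = Y * upper y"
  have Z: "Z \<in> sp" unfolding Z_def by (intro sp_mult Y sp_upper y)
  define c where "c = m12 Z"
  have "c = a * y + b" by (simp add: c_def Z_def a_def b_def)
  also have "\<dots> = a * w"
    using arg_cong[OF ai, of "\<lambda>x. x * b"] unfolding mult.assoc y_def by (simp add: right_diff_distrib)
  finally have c: "c = a * w" .
  have "m11 Z = a" by (simp add: Z_def a_def)
  have dc: "det2 c \<noteq> 0" using a w(2) by (simp add: c det2_mult)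
  let ?ci = "scal (1 / det2 c) * adj c"
  have ci: "c * ?ci = 1" using mult_scal_adj[OF dc] .
  \<comment> \<open>The solution of \<open>c * t = m11 Z - 1\<close>. It is symmetric as a
    difference: the relations of \<open>sp\<close> give symmetry of the term with
    \<open>m11 Z\<close>, and \<open>c\<close> itself is symmetric.\<close>
  define t where "t = ?ci * (m11 Z - 1)"
  have "symm (m11 Z * tp c)" using Z sp_iff unfolding c_def by blast
  note symm_closed(3)[OF symm_adj_mult(2)[OF this], of "1 / det2 c"]
  moreover have sc: "symm c" using w(3) c by simp
  note symm_closed(3)[OF symm_closed(4)[OF this], of "1 / det2 c"]
  ultimately have t: "symm t"
    unfolding t_def right_diff_distrib mult_1_right mult.assoc by (rule symm_closed(1))
  \<comment> \<open>\<open>lower (- t)\<close> turns the top left block into 1, after which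
    \<open>upper (- c)\<close> clears the block \<open>c\<close> next to it.\<close>
  define V where "V = Z * lower (- t) * upper (- c)"
  have V: "V \<in> sp" unfolding V_def
    by (intro sp_mult Z sp_lower sp_upper) (use t sc in \<open>auto simp: symm_iff\<close>)
  have ct: "c * t = m11 Z - 1"
    using arg_cong[OF ci, of "\<lambda>x. x * (m11 Z - 1)"] unfolding mult.assoc t_def by simp
  have "m11 V = 1" by (simp add: V_def ct flip: c_def)
  moreover have "m12 V = c - (m11 Z - c * t) * c" by (simp add: V_def algebra_simps flip: c_def)
  then have "m12 V = 0" by (simp add: ct)
  moreover have V_rel: "m11 V * tp (m22 V) - m12 V * tp (m21 V) = 1" "symm (m21 V * tp (m22 V))"
    using V sp_iff by blast+
  ultimately have "tp (m22 V) = 1" by simp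
  define v where "v = m21 V"
  have v: "symm v" using V_rel(2) by (simp add: v_def \<open>tp (m22 V) = 1\<close>)
  have "m22 V = tp (tp (m22 V))" by (simp add: m2_eq_iff)
  then have "m22 V = 1" using \<open>tp (m22 V) = 1\<close> by simp
  with \<open>m11 V = 1\<close> \<open>m12 V = 0\<close> have V_eq: "V = lower v" by (simp add: m2_eq_iff v_def)
  have "V * upper c * lower t = Z * (lower (- t) * (upper (- c) * upper c) * lower t)"
    by (simp add: V_def mult.assoc)
  also have "\<dots> = Z" by (simp add: upper_lower_inverse)
  finally have Z_eq: "Z = V * upper c * lower t" ..
  have "M = Y * lower (- x)" by (simp add: Y_def mult.assoc upper_lower_inverse)
  also have "Y = Z * upper (- y)" by (simp add: Z_def mult.assoc upper_lower_inverse)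
  finally have "M = lower v * upper c * lower t * upper (- y) * lower (- x)"
    unfolding Z_eq V_eq .
  moreover have "symm (- y)" "symm (- x)" by (rule symm_closed(2), fact)+
  ultimately show ?thesis using t sc v
    by (intro exI[of _ v] exI[of _ c] exI[of _ t] exI[of _ "- y"] exI[of _ "- x"] conjI)
qed

text \<open>By the factorization, a property closed under products holds on all of \<open>sp\<close>
  once it holds on the symmetric unipotents.\<close>

lemma sp_induct [consumes 2, case_names upper lower mult]:
  fixes M :: "'k::field m2 m2"
  assumes "(2 :: 'k) \<noteq> 0" "M \<in> sp"
    and "\<And>x. symm x \<Longrightarrow> P (upper x)" "\<And>x. symm x \<Longrightarrow> P (lower x)"
    and "\<And>M Y. M \<in> sp \<Longrightarrow> Y \<in> sp \<Longrightarrow> P M \<Longrightarrow> P Y \<Longrightarrow> P (M * Y)"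
  shows "P M"
proof -
  obtain s1 s2 s3 s4 s5 where s: "symm s1" "symm s2" "symm s3" "symm s4" "symm s5"
    and M: "M = lower s1 * upper s2 * lower s3 * upper s4 * lower s5"
    using sp_factorization[OF assms(1,2)] by (elim exE conjE)
  show ?thesis unfolding M by (intro assms(3-5) sp_mult sp_upper sp_lower s)
qed

text \<open>The definition of \<open>sp\<close> provides a right inverse only. On a unipotent with
  symmetric parameter, \<open>hat\<close> negates the parameter, and anti-multiplicativity does the
  rest.\<close>

lemma sp_hat_left:
  fixes M :: "'k::field m2 m2"
  assumes "(2 :: 'k) \<noteq> 0" "M \<in> sp"
  shows "hat M * M = 1"
  using assms
proof (induction rule: sp_induct)
  case (mult M Y)
  have "hat (M * Y) * (M * Y) = hat Y * (hat M * M) * Y" by (simp add: hat_mult mult.assoc)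
  then show ?case using mult by simp
qed (simp_all add: m2_eq_iff symm_iff)

lemma sp_hat:
  fixes M :: "'k::field m2 m2"
  assumes "(2 :: 'k) \<noteq> 0" "M \<in> sp"
  shows "hat M \<in> sp"
  using sp_hat_left[OF assms] by (simp add: sp_def)



section \<open>Sp(4) acting on hermitian matrices\<close>

section \<open>The action on the five-dimensional quadratic space\<close>

lemma exhaust_5: "x = 1 \<or> x = 2 \<or> x = 3 \<or> x = 4 \<or> x = 5" for x :: 5
proof (induct x)
  case (of_int z)
  then have "z = 0 \<or> z = 1 \<or> z = 2 \<or> z = 3 \<or> z = 4" by fastforce
  then show ?case by auto
qed

lemma forall_5: "(\<forall>i::5. P i) \<longleftrightarrow> P 1 \<and> P 2 \<and> P 3 \<and> P 4 \<and> P 5"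
  by (metis exhaust_5)

lemma UNIV_5: "UNIV = {1, 2, 3, 4, 5::5}"
  using exhaust_5 by auto

lemma sum_5: "sum f (UNIV :: 5 set) = f 1 + f 2 + f 3 + f 4 + f 5"
  unfolding UNIV_5 by (simp add: ac_simps)

definition vec5 :: "'k \<Rightarrow> 'k \<Rightarrow> 'k \<Rightarrow> 'k \<Rightarrow> 'k \<Rightarrow> 'k ^ 5" where
  "vec5 s t x y z = (\<chi> i. if i = 1 then s else if i = 2 then t else if i = 3 then x else if i = 4 then y else z)"

lemma vec5_nth [simp]: "vec5 s t x y z $ 1 = s" "vec5 s t x y z $ 2 = t" "vec5 s t x y z $ 3 = x"
    "vec5 s t x y z $ 4 = y" "vec5 s t x y z $ 5 = z"
  by (simp_all add: vec5_def)

lemma vec5_eq_iff: "v = w \<longleftrightarrow> v $ 1 = w $ 1 \<and> v $ 2 = w $ 2 \<and> v $ 3 = w $ 3 \<and> v $ 4 = w $ 4 \<and> v $ 5 = w $ 5"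
  for v w :: "'k ^ 5"
  by (simp add: vec_eq_iff forall_5)

text \<open>
  A vector \<open>(s, t, x, y, z)\<close> stands for the hermitian matrix with diagonal \<open>s\<close>, \<open>t\<close> and
  off-diagonal entry \<open>Z = (x, y; y, z)\<close>, on which \<open>M\<close> acts by \<open>M * H * star M\<close>.
\<close>

definition herm :: "'k::ring_1 ^ 5 \<Rightarrow> 'k m2 m2" where
  "herm v = M2 (scal (v $ 1)) (M2 (v $ 3) (v $ 4) (v $ 4) (v $ 5))
     (adj (M2 (v $ 3) (v $ 4) (v $ 4) (v $ 5))) (scal (v $ 2))"

definition unherm :: "'k m2 m2 \<Rightarrow> 'k ^ 5" where
  "unherm H = vec5 (m11 (m11 H)) (m11 (m22 H)) (m11 (m12 H)) (m12 (m12 H)) (m22 (m12 H))"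

definition act :: "'k::comm_ring_1 m2 m2 \<Rightarrow> 'k ^ 5 \<Rightarrow> 'k ^ 5" where
  "act M v = unherm (M * herm v * star M)"

text \<open>The split form of \<open>q_H\<close>: the product of the diagonal entries minus the
  determinant of the symmetric block.\<close>

definition qf :: "'k::comm_ring_1 ^ 5 \<Rightarrow> 'k" where
  "qf v = v $ 1 * v $ 2 - v $ 3 * v $ 5 + v $ 4 * v $ 4"

text \<open>The polar form of \<open>qf\<close>, without the factor 1/2, so that
  \<open>bf v v = 2 * qf v\<close>.\<close>

definition bf :: "'k::comm_ring_1 ^ 5 \<Rightarrow> 'k ^ 5 \<Rightarrow> 'k" where
  "bf v w = v $ 1 * w $ 2 + v $ 2 * w $ 1 - v $ 3 * w $ 5 - v $ 5 * w $ 3 + 2 * (v $ 4 * w $ 4)"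

lemma qf_add: "qf (v + w) = qf v + qf w + bf v w"
  by (simp add: qf_def bf_def algebra_simps)

lemma unherm_herm [simp]: "unherm (herm v) = v"
  by (simp add: unherm_def herm_def vec5_eq_iff)

lemma herm_upper: "upper x * herm v * star (upper x) = herm (vec5
    (v $ 1 + m11 x * v $ 5 - m12 x * v $ 4 - m21 x * v $ 4 + m22 x * v $ 3 + v $ 2 * det2 x)
    (v $ 2) (v $ 3 + v $ 2 * m11 x) (v $ 4 + v $ 2 * m12 x) (v $ 5 + v $ 2 * m22 x))"
  if "symm x" for x :: "'k::comm_ring_1 m2"
  using that by (simp add: symm_iff herm_def m2_eq_iff det2_def algebra_simps)

lemma herm_lower: "lower x * herm v * star (lower x) = herm (vec5 (v $ 1)
    (v $ 2 + m11 x * v $ 3 + m12 x * v $ 4 + m21 x * v $ 4 + m22 x * v $ 5 + v $ 1 * det2 x)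
    (v $ 3 + v $ 1 * m22 x) (v $ 4 - v $ 1 * m12 x) (v $ 5 + v $ 1 * m11 x))"
  if "symm x" for x :: "'k::comm_ring_1 m2"
  using that by (simp add: symm_iff herm_def m2_eq_iff det2_def algebra_simps)

lemma act_upper: "symm x \<Longrightarrow> act (upper x) v = vec5
    (v $ 1 + m11 x * v $ 5 - m12 x * v $ 4 - m21 x * v $ 4 + m22 x * v $ 3 + v $ 2 * det2 x)
    (v $ 2) (v $ 3 + v $ 2 * m11 x) (v $ 4 + v $ 2 * m12 x) (v $ 5 + v $ 2 * m22 x)"
  and act_lower: "symm x \<Longrightarrow> act (lower x) v = vec5 (v $ 1)
    (v $ 2 + m11 x * v $ 3 + m12 x * v $ 4 + m21 x * v $ 4 + m22 x * v $ 5 + v $ 1 * det2 x)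
    (v $ 3 + v $ 1 * m22 x) (v $ 4 - v $ 1 * m12 x) (v $ 5 + v $ 1 * m11 x)"
  for x :: "'k::comm_ring_1 m2"
  by (simp_all add: act_def herm_upper herm_lower)

text \<open>That \<open>M * h * star M\<close> is again hermitian is formal; that its off-diagonal
  block stays symmetric depends on \<open>sp\<close> and is seen on the unipotents. It makes
  \<open>act\<close> a true action, since \<open>unherm\<close> then loses no information.\<close>

lemma herm_act:
  fixes M :: "'k::field m2 m2"
  assumes "(2 :: 'k) \<noteq> 0" "M \<in> sp"
  shows "M * herm v * star M = herm (act M v)"
proof -
  have "\<forall>v. \<exists>w. M * herm v * star M = herm w"
    using assms
  proof (induction rule: sp_induct)
    case (upper x)
    then show ?case using herm_upper by blast
  next
    case (lower x)
    then show ?case using herm_lower by blast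
  next
    case (mult M Y)
    have eq: "M * Y * herm v * star (M * Y) = M * (Y * herm v * star Y) * star M" for v
      by (simp only: star_mult mult.assoc)
    show ?case unfolding eq using mult.IH by metis
  qed
  then obtain w where "M * herm v * star M = herm w" by blast
  then show ?thesis by (simp add: act_def)
qed

lemma act_mult:
  fixes M :: "'k::field m2 m2"
  assumes "(2 :: 'k) \<noteq> 0" "Y \<in> sp"
  shows "act (M * Y) v = act M (act Y v)"
proof -
  have "M * Y * herm v * star (M * Y) = M * (Y * herm v * star Y) * star M"
    by (simp only: star_mult mult.assoc)
  then show ?thesis by (simp add: act_def[of "M * Y"] herm_act assms) (simp add: act_def)
qed

lemma act_1 [simp]: "act 1 v = v" by (simp add: act_def)

lemma herm_linear: "herm (v + w) = herm v + herm w" "herm (c *s v) = scal (scal c) * herm v"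
  for v w :: "'k::comm_ring_1 ^ 5"
  by (simp_all add: herm_def m2_eq_iff)

lemma act_linear: "Vector_Spaces.linear (*s) (*s) (act M)" for M :: "'k::field m2 m2"
proof -
  have "act M (v + w) = act M v + act M w" for v w
    by (simp add: act_def herm_linear unherm_def vec5_eq_iff algebra_simps)
  moreover have "act M (c *s v) = c *s act M v" for c v
    by (simp add: act_def herm_linear unherm_def vec5_eq_iff algebra_simps)
  ultimately show ?thesis
    by (simp add: Vector_Spaces.linear_iff vec.vector_space_axioms)
qed

lemma qf_act:
  fixes M :: "'k::field m2 m2"
  assumes "(2 :: 'k) \<noteq> 0" "M \<in> sp"
  shows "qf (act M v) = qf v"
  using assms
proof (induction arbitrary: v rule: sp_induct)
  case (upper x)
  then show ?case by (simp add: act_upper qf_def symm_iff det2_def algebra_simps)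
next
  case (lower x)
  then show ?case by (simp add: act_lower qf_def symm_iff det2_def algebra_simps)
next
  case (mult M Y)
  then show ?case by (simp add: act_mult assms(1))
qed

definition act_mat :: "'k::field m2 m2 \<Rightarrow> 'k ^ 5 ^ 5" where "act_mat M = matrix (act M)"

lemma act_mat_apply: "act_mat M *v v = act M v"
  unfolding act_mat_def by (rule matrix_works[OF act_linear])

lemma act_mat_mult:
  fixes M :: "'k::field m2 m2"
  assumes "(2 :: 'k) \<noteq> 0" "Y \<in> sp"
  shows "act_mat (M * Y) = act_mat M ** act_mat Y"
  unfolding matrix_eq by (simp add: act_mat_apply act_mult assms flip: matrix_vector_mul_assoc)

lemma act_mat_1: "act_mat 1 = mat 1"
  unfolding matrix_eq by (simp add: act_mat_apply)

text \<open>The Levi subgroup: the second block is the inverse transpose of the first.\<close>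

definition diag2 :: "'k::field m2 \<Rightarrow> 'k m2 m2" where
  "diag2 a = M2 a 0 0 (scal (1 / det2 a) * adj (tp a))"

lemma sp_diag2:
  fixes a :: "'k::field m2"
  assumes "det2 a \<noteq> 0"
  shows "diag2 a \<in> sp"
proof -
  have "tp (scal (1 / det2 a) * adj (tp a)) = scal (1 / det2 a) * adj a" by (simp add: m2_eq_iff)
  then show ?thesis
    using mult_scal_adj[OF assms] by (simp add: diag2_def sp_iff symm_iff)
qed

lemma exists_square_root: "\<exists>y. y * y = x" for x :: "'k::alg_closed_field"
  using nth_root_exists[of 2 x] by (auto simp: power2_eq_square)

text \<open>Both kinds of generators are commutators with a scalar diagonal matrix.\<close>

lemma det_act_mat:
  fixes M :: "'k::alg_closed_field m2 m2"
  assumes two: "(2 :: 'k) \<noteq> 0" and "M \<in> sp"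
  shows "det (act_mat M) = 1"
proof -
  have "finite {k :: 'k. k = 0 \<or> k = 1 \<or> k = - 1}" by simp
  then obtain k :: 'k where k: "k \<noteq> 0" "k \<noteq> 1" "k \<noteq> - 1"
    using alg_closed_infinite[where ?'k = 'k] by (metis (mono_tags, lifting) UNIV_I ex_new_if_finite mem_Collect_eq)
  then have kk: "k * k - 1 \<noteq> 0" by (simp add: square_eq_1_iff)
  have E: "diag2 (scal c) \<in> sp" if "c \<noteq> 0" for c :: 'k
    by (rule sp_diag2) (use that in \<open>simp add: det2_def\<close>)
  have comm: "det (act_mat (P * Q * P' * Q')) = 1"
    if "P \<in> sp" "Q \<in> sp" "P' \<in> sp" "Q' \<in> sp" "P * P' = 1" "Q * Q' = 1" for P Q P' Q' :: "'k m2 m2"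
  proof -
    have "det (act_mat P) * det (act_mat P') = 1"
      using that by (simp add: two act_mat_1 flip: det_mul act_mat_mult)
    moreover have "det (act_mat Q) * det (act_mat Q') = 1"
      using that by (simp add: two act_mat_1 flip: det_mul act_mat_mult)
    ultimately show ?thesis using that
      by (simp add: two act_mat_mult det_mul sp_mult mult.commute mult.left_commute)
  qed
  \<comment> \<open>Conjugation by the diagonal matrix multiplies the unipotent parameter
    \<open>y\<close> by \<open>k * k\<close>, so the commutator has parameter
    \<open>(k * k - 1) * y\<close>. With this \<open>j\<close>, the choice
    \<open>y = scal j * x\<close> gives back \<open>x\<close>.\<close>
  define j where "j = 1 / (k * k - 1)"
  have j: "j * (k * (k * m)) - j * m = m" for m
  proof -
    have "j * (k * (k * m)) - j * m = (k * k - 1) * j * m" by (simp add: algebra_simps)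
    then show ?thesis using kk by (simp add: j_def)
  qed
  have diag: "diag2 (scal c) = M2 (scal c) 0 0 (scal (1 / c))" if "c \<noteq> 0" for c :: 'k
    using that by (simp add: diag2_def m2_eq_iff det2_def)
  have EE: "diag2 (scal c) * diag2 (scal (1 / c)) = 1" if "c \<noteq> 0" for c :: 'k
    using that by (simp add: diag2_def m2_eq_iff det2_def)
  show ?thesis
    using two \<open>M \<in> sp\<close>
  proof (induction rule: sp_induct)
    case (upper x)
    define y where "y = scal j * x"
    have y: "symm y" using upper by (simp add: y_def symm_iff)
    have "upper x = diag2 (scal k) * upper y * diag2 (scal (1 / k)) * upper (- y)"
      using k by (simp add: diag m2_eq_iff y_def j mult.commute mult.left_commute)
    moreover have "det (act_mat \<dots>) = 1"
      by (rule comm) (use k y in \<open>auto simp: E EE sp_upper upper_lower_inverse symm_closed\<close>)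
    ultimately show ?case by simp
  next
    case (lower x)
    define y where "y = scal j * x"
    have y: "symm y" using lower by (simp add: y_def symm_iff)
    have "lower x = diag2 (scal (1 / k)) * lower y * diag2 (scal k) * lower (- y)"
      using k by (simp add: diag m2_eq_iff y_def j mult.commute mult.left_commute)
    moreover have "det (act_mat \<dots>) = 1"
      by (rule comm) (use k y EE[of "1 / k"] in \<open>auto simp: E sp_lower upper_lower_inverse symm_closed\<close>)
    ultimately show ?case by simp
  next
    case (mult M Y)
    then show ?case by (simp add: act_mat_mult two det_mul)
  qed
qed

section \<open>Every isometry comes from Sp(4), up to a reflection\<close>

section \<open>The special orthogonal group in dimension five\<close>

text \<open>Transitivity on nonzero isotropic vectors. If the second coordinate is nonzero, an upper
  unipotent clears the symmetric block, isotropy then makes the first coordinate zero, and a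
  diagonal element normalizes the second to 1. Otherwise some element first makes the second
  coordinate nonzero.\<close>

lemma exists_act_e2:
  fixes v :: "'k::alg_closed_field ^ 5"
  assumes two: "(2 :: 'k) \<noteq> 0" and v: "qf v = 0" "v \<noteq> 0"
  shows "\<exists>M\<in>sp. act M v = vec5 0 1 0 0 0"
proof -
  have 1: "\<exists>M\<in>sp. act M v = vec5 0 1 0 0 0" if "qf v = 0" "v $ 2 \<noteq> 0" for v :: "'k ^ 5"
  proof -
    let ?x = "scal (- 1 / v $ 2) * M2 (v $ 3) (v $ 4) (v $ 4) (v $ 5)"
    let ?D = "diag2 (M2 (v $ 2) 0 0 1)"
    have x: "symm ?x" by (simp add: symm_iff)
    have D: "?D \<in> sp" by (rule sp_diag2) (use that in \<open>simp add: det2_def\<close>)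
    have "act (upper ?x) v = vec5 0 (v $ 2) 0 0 0"
      unfolding act_upper[OF x] using that by (simp add: vec5_eq_iff qf_def det2_def field_simps)
    moreover have "act ?D (vec5 0 (v $ 2) 0 0 0) = vec5 0 1 0 0 0"
      using that by (simp add: act_def diag2_def herm_def unherm_def vec5_eq_iff det2_def)
    ultimately have "act (?D * upper ?x) v = vec5 0 1 0 0 0"
      by (simp only: act_mult[OF two sp_upper[OF x]])
    then show ?thesis using sp_mult[OF D sp_upper[OF x]] by blast
  qed
  have 2: "\<exists>M\<in>sp. act M v = vec5 0 1 0 0 0" if N: "N \<in> sp" "act N v $ 2 \<noteq> 0" for N
  proof -
    obtain M where "M \<in> sp" "act M (act N v) = vec5 0 1 0 0 0"
      using 1[of "act N v"] N v qf_act[OF two] by auto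
    then show ?thesis using N sp_mult act_mult[OF two] by metis
  qed
  consider "v $ 2 \<noteq> 0" | "v $ 2 = 0" "v $ 1 \<noteq> 0" | "v $ 2 = 0" "v $ 1 = 0" "v $ 3 \<noteq> 0"
    | "v $ 2 = 0" "v $ 1 = 0" "v $ 4 \<noteq> 0" | "v $ 2 = 0" "v $ 1 = 0" "v $ 5 \<noteq> 0"
    using v(2) by (auto simp: vec5_eq_iff)
  then show ?thesis
  proof cases
    case 1
    then show ?thesis using 2[of 1] by simp
  next
    case t0: 2
    \<comment> \<open>The Weyl element that exchanges the two diagonal entries of a hermitian
      matrix.\<close>
    have "M2 0 1 (- 1) 0 \<in> (sp :: 'k m2 m2 set)" by (simp add: sp_iff symm_iff m2_eq_iff)
    moreover have "act (M2 0 1 (- 1) 0) v $ 2 \<noteq> 0" using t0 by (simp add: act_def herm_def unherm_def)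
    ultimately show ?thesis by (rule 2)
  next
    case 3
    then show ?thesis using sp_lower[of "M2 1 0 0 0"] 
      by (intro 2[of "lower (M2 1 0 0 0)"]) (simp_all add: act_lower symm_iff det2_def)
  next
    case 4
    then show ?thesis using sp_lower[of "M2 0 1 1 0"] two
      by (intro 2[of "lower (M2 0 1 1 0)"]) (simp_all add: act_lower symm_iff det2_def flip: mult_2)
  next
    case 5
    then show ?thesis using sp_lower[of "M2 0 0 0 1"] 
      by (intro 2[of "lower (M2 0 0 0 1)"]) (simp_all add: act_lower symm_iff det2_def)
  qed
qed

text \<open>For \<open>a\<close> of determinant 1 the diagonal entries stay fixed and the symmetric
  block \<open>Z\<close> becomes \<open>a * Z * tp a\<close>, here written out.\<close>

lemma act_diag2:
  assumes "det2 a = 1"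
  shows "act (diag2 a) (vec5 s t x y z) = vec5 s t
    (m11 a * m11 a * x + 2 * (m11 a * m12 a * y) + m12 a * m12 a * z)
    (m11 a * m21 a * x + (m11 a * m22 a + m12 a * m21 a) * y + m12 a * m22 a * z)
    (m21 a * m21 a * x + 2 * (m21 a * m22 a * y) + m22 a * m22 a * z)"
proof -
  have 1: "m11 a * m22 a - m12 a * m21 a = 1" using assms by (simp add: det2_def)
  have "m11 a * (s * m22 a) - m12 a * (s * m21 a) = s * (m11 a * m22 a - m12 a * m21 a)"
    "m22 a * (t * m11 a) - m21 a * (t * m12 a) = t * (m11 a * m22 a - m12 a * m21 a)"
    by (simp_all add: algebra_simps)
  then show ?thesis
    using 1 by (simp add: act_def diag2_def herm_def unherm_def vec5_eq_iff assms) (simp add: algebra_simps)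
qed

text \<open>The hypothesis says that the symmetric block has rank one, so it is the column
  \<open>(p, q)\<close> times its transpose, by extraction of square roots. The witnesses are
  matrices of determinant 1 that send \<open>(p, q)\<close> to \<open>(1, 0)\<close>.\<close>

lemma exists_act_e3:
  fixes x y z :: "'k::alg_closed_field"
  assumes "x * z = y * y" "x \<noteq> 0 \<or> z \<noteq> 0"
  shows "\<exists>a. det2 a = 1 \<and> act (diag2 a) (vec5 0 0 x y z) = vec5 0 0 1 0 0"
proof -
  obtain p q where p: "p * p = x" and q: "q * q = z" using exists_square_root by metis
  have "(p * q) * (p * q) = y * y" using assms(1) p q by (metis mult.assoc mult.left_commute)
  \<comment> \<open>The two square roots were chosen independently, so the sign of \<open>q\<close>
    may need correction to match \<open>y\<close>.\<close>
  then have "p * q = y \<or> p * (- q) = y" by (auto simp: square_eq_iff)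
  then obtain q where q: "q * q = z" "p * q = y" using q by (metis minus_mult_minus)
  show ?thesis
  proof (cases "p = 0")
    case False
    then show ?thesis using p q
      by (intro exI[of _ "M2 (1 / p) 0 (- q) p"]) (auto simp: det2_def act_diag2 vec5_eq_iff field_simps)
  next
    case True
    then have "q \<noteq> 0" using assms(2) p q by auto
    then show ?thesis using True p q
      by (intro exI[of _ "M2 0 (1 / q) (- q) 0"]) (auto simp: det2_def act_diag2 vec5_eq_iff field_simps)
  qed
qed

text \<open>The reflection in the anisotropic basis vector, which represents the isometries of
  determinant -1.\<close>

definition refl4 :: "'k::field ^ 5 ^ 5" where
  "refl4 = (\<chi> i j. if i = j then if i = 4 then - 1 else 1 else 0)"

lemma det_refl4: "det refl4 = - 1"
proof -
  have "det (refl4 :: 'a ^ 5 ^ 5) = (\<Prod>i\<in>UNIV. refl4 $ i $ i)"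
    by (rule det_diagonal) (simp add: refl4_def)
  also have "\<dots> = - 1" unfolding UNIV_5 by (simp add: refl4_def)
  finally show ?thesis .
qed

lemma mat5_eqI:
  fixes A B :: "'k::field ^ 5 ^ 5"
  assumes "A *v vec5 1 0 0 0 0 = B *v vec5 1 0 0 0 0" "A *v vec5 0 1 0 0 0 = B *v vec5 0 1 0 0 0"
    "A *v vec5 0 0 1 0 0 = B *v vec5 0 0 1 0 0" "A *v vec5 0 0 0 1 0 = B *v vec5 0 0 0 1 0"
    "A *v vec5 0 0 0 0 1 = B *v vec5 0 0 0 0 1"
  shows "A = B"
  using assms by (simp add: vec_eq_iff matrix_vector_mult_def sum_5 forall_5)

text \<open>The images of the basis vectors are normalized in turn, each time by an element fixing
  those already treated: first the hyperbolic pair \<open>e1\<close>, \<open>e2\<close>, then the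
  pair \<open>e3\<close>, \<open>e5\<close>. The image of \<open>e4\<close> is then orthogonal to
  all of these and has norm 1, so it is \<open>e4\<close> up to sign.\<close>

lemma preserves_qf_reduction:
  fixes g :: "'k::alg_closed_field ^ 5 ^ 5"
  assumes two: "(2 :: 'k) \<noteq> 0" and g: "\<And>v. qf (g *v v) = qf v"
  shows "\<exists>M\<in>sp. act_mat M ** g = mat 1 \<or> act_mat M ** g = refl4"
proof -
  let ?e1 = "vec5 1 0 0 0 0 :: 'k ^ 5" and ?e2 = "vec5 0 1 0 0 0 :: 'k ^ 5" and ?e3 = "vec5 0 0 1 0 0 :: 'k ^ 5"
    and ?e4 = "vec5 0 0 0 1 0 :: 'k ^ 5" and ?e5 = "vec5 0 0 0 0 1 :: 'k ^ 5"
  have b_pres: "bf (f v) (f w) = bf v w" if "\<And>v. qf (f v) = qf v" "\<And>v w. f (v + w) = f v + f w"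
    for f :: "'k ^ 5 \<Rightarrow> 'k ^ 5" and v w
    using that qf_add[of "f v" "f w"] qf_add[of v w] by (metis add_left_cancel)
  define G where "G M v = act M (g *v v)" for M v
  have G_q: "qf (G M v) = qf v" if "M \<in> sp" for M v using that by (simp add: G_def qf_act two g)
  have G_add: "G M (v + w) = G M v + G M w" for M v w
    unfolding G_def act_mat_apply[symmetric] by (simp add: matrix_vector_right_distrib)
  have G_b: "bf (G M v) (G M w) = bf v w" if "M \<in> sp" for M v w
    by (rule b_pres) (use that G_q G_add in auto)
  have G_mult: "G (N * M) v = act N (G M v)" if "M \<in> sp" for M N v
    using that by (simp add: G_def act_mult two)
  have G_nz: "G M v \<noteq> 0" if "M \<in> sp" "bf v w \<noteq> 0" for M v w
    using G_b[OF that(1), of v w] that(2) by (auto simp: bf_def)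
  have "G 1 ?e2 \<noteq> 0" by (rule G_nz[of _ _ ?e1]) (simp_all add: bf_def)
  moreover have "qf (G 1 ?e2) = 0" by (subst G_q) (simp_all add: qf_def)
  ultimately obtain M1 where M1: "M1 \<in> sp" "act M1 (G 1 ?e2) = ?e2" using exists_act_e2[OF two] by blast
  then have M1e2: "G M1 ?e2 = ?e2" using G_mult[of 1 M1] by simp
  define u where "u = G M1 ?e1"
  have "bf u ?e2 = bf ?e1 ?e2" using G_b[OF M1(1), of ?e1 ?e2] M1e2 by (simp add: u_def)
  then have u1: "u $ 1 = 1" by (simp add: bf_def)
  have uq: "qf u = 0" unfolding u_def using G_q[OF M1(1)] by (simp add: qf_def)
  \<comment> \<open>The parameter clears the symmetric block of \<open>u\<close>, whose first
    coordinate is 1; the second coordinate then vanishes because \<open>u\<close> is isotropic.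
    \<open>lower ?y\<close> fixes \<open>e2\<close>.\<close>
  let ?y = "- M2 (u $ 5) (- u $ 4) (- u $ 4) (u $ 3)"
  have y: "symm ?y" by (simp add: symm_iff)
  define M2' where "M2' = lower ?y * M1"
  have M2: "M2' \<in> sp" unfolding M2'_def by (intro sp_mult sp_lower y M1)
  have "act (lower ?y) u = ?e1"
    unfolding act_lower[OF y] using u1 uq by (simp add: vec5_eq_iff det2_def qf_def algebra_simps)
  then have M2e1: "G M2' ?e1 = ?e1" by (simp add: M2'_def G_mult M1 u_def)
  have "act (lower ?y) ?e2 = ?e2" unfolding act_lower[OF y] by (simp add: vec5_eq_iff)
  then have M2e2: "G M2' ?e2 = ?e2" by (simp add: M2'_def G_mult M1 M1e2)
  define v where "v = G M2' ?e3"
  have "bf v ?e1 = bf ?e3 ?e1" using G_b[OF M2, of ?e3 ?e1] M2e1 by (simp add: v_def)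
  moreover have "bf v ?e2 = bf ?e3 ?e2" using G_b[OF M2, of ?e3 ?e2] M2e2 by (simp add: v_def)
  ultimately have v12: "v $ 1 = 0" "v $ 2 = 0" by (simp_all add: bf_def)
  have "qf v = 0" unfolding v_def using G_q[OF M2] by (simp add: qf_def)
  then have vq: "v $ 3 * v $ 5 = v $ 4 * v $ 4" using v12 by (simp add: qf_def)
  have "v \<noteq> 0" unfolding v_def by (rule G_nz[OF M2, of _ ?e5]) (simp add: bf_def)
  then have "v $ 3 \<noteq> 0 \<or> v $ 5 \<noteq> 0" using v12 vq by (auto simp: vec5_eq_iff)
  with exists_act_e3[OF vq] obtain a where a: "det2 a = 1"
    "act (diag2 a) (vec5 0 0 (v $ 3) (v $ 4) (v $ 5)) = ?e3" by blast
  have v_eq: "vec5 0 0 (v $ 3) (v $ 4) (v $ 5) = v" using v12 by (simp add: vec5_eq_iff)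
  have Da: "diag2 a \<in> sp" by (rule sp_diag2) (simp add: a)
  define M3 where "M3 = diag2 a * M2'"
  have M3: "M3 \<in> sp" unfolding M3_def by (intro sp_mult Da M2)
  have M3e: "G M3 ?e1 = ?e1" "G M3 ?e2 = ?e2" "G M3 ?e3 = ?e3"
    using a(2) by (simp_all add: M3_def G_mult M2 M2e1 M2e2 act_diag2 a(1) v_eq flip: v_def)
  define n where "n = G M3 ?e5"
  have "bf n ?e1 = bf ?e5 ?e1" "bf n ?e2 = bf ?e5 ?e2" "bf n ?e3 = bf ?e5 ?e3"
    using G_b[OF M3, of ?e5] M3e unfolding n_def by metis+
  then have n: "n $ 1 = 0" "n $ 2 = 0" "n $ 5 = 1" by (simp_all add: bf_def)
  have "qf n = 0" unfolding n_def using G_q[OF M3] by (simp add: qf_def)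
  then have n3: "n $ 3 = n $ 4 * n $ 4" using n by (simp add: qf_def)
  \<comment> \<open>The symmetric block of \<open>n\<close> is the column \<open>(n $ 4, 1)\<close>
    times its transpose. This shear sends that column to \<open>(0, 1)\<close> and fixes
    \<open>(1, 0)\<close>, hence also \<open>e3\<close>.\<close>
  let ?a = "M2 1 (- n $ 4) 0 1"
  have Da': "diag2 ?a \<in> sp" by (rule sp_diag2) (simp add: det2_def)
  define M4 where "M4 = diag2 ?a * M3"
  have M4: "M4 \<in> sp" unfolding M4_def by (intro sp_mult Da' M3)
  have n_eq: "n = vec5 0 0 (n $ 4 * n $ 4) (n $ 4) 1" using n n3 by (simp add: vec5_eq_iff)
  have "act (diag2 ?a) (vec5 0 0 (n $ 4 * n $ 4) (n $ 4) 1) = ?e5"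
    by (simp add: act_diag2 det2_def vec5_eq_iff)
  then have M4e: "G M4 ?e1 = ?e1" "G M4 ?e2 = ?e2" "G M4 ?e3 = ?e3" "G M4 ?e5 = ?e5"
    using n_eq by (simp_all add: M4_def G_mult M3 M3e act_diag2 det2_def flip: n_def)
  define w where "w = G M4 ?e4"
  have "bf w ?e1 = bf ?e4 ?e1" "bf w ?e2 = bf ?e4 ?e2" "bf w ?e3 = bf ?e4 ?e3" "bf w ?e5 = bf ?e4 ?e5"
    using G_b[OF M4, of ?e4] M4e unfolding w_def by metis+
  then have w: "w $ 1 = 0" "w $ 2 = 0" "w $ 5 = 0" "w $ 3 = 0" by (simp_all add: bf_def)
  have "qf w = 1" unfolding w_def using G_q[OF M4] by (simp add: qf_def)
  then have "w $ 4 * w $ 4 = 1" using w by (simp add: qf_def)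
  then have "w $ 4 = 1 \<or> w $ 4 = - 1" by (simp add: square_eq_1_iff)
  then have "w = ?e4 \<or> w = - ?e4" using w by (auto simp: vec5_eq_iff)
  then have M4e4: "G M4 ?e4 = ?e4 \<or> G M4 ?e4 = - ?e4" by (simp add: w_def)
  have G_mat: "G M4 v = (act_mat M4 ** g) *v v" for v
    by (simp add: G_def act_mat_apply flip: matrix_vector_mul_assoc)
  have r: "refl4 *v v = vec5 (v $ 1) (v $ 2) (v $ 3) (- v $ 4) (v $ 5)" for v :: "'k ^ 5"
    by (simp add: vec5_eq_iff matrix_vector_mult_def sum_5 refl4_def)
  have "act_mat M4 ** g = mat 1" if "G M4 ?e4 = ?e4"
    using that M4e unfolding G_mat by (intro mat5_eqI) simp_all
  moreover have "act_mat M4 ** g = refl4" if "G M4 ?e4 = - ?e4"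
    using that M4e unfolding G_mat by (intro mat5_eqI) (simp_all add: r vec5_eq_iff)
  ultimately show ?thesis using M4e4 M4 by blast
qed

text \<open>In the first case of the reduction \<open>g\<close> is the action of
  \<open>hat M\<close>; in the second its determinant is that of the reflection, since the group
  acts with determinant 1.\<close>

lemma preserves_qf_cases:
  fixes g :: "'k::alg_closed_field ^ 5 ^ 5"
  assumes two: "(2 :: 'k) \<noteq> 0" and g: "\<And>v. qf (g *v v) = qf v"
  shows "det g = - 1 \<or> (\<exists>M\<in>sp. g = act_mat M)"
proof -
  obtain M where M: "M \<in> sp" and cases: "act_mat M ** g = mat 1 \<or> act_mat M ** g = refl4"
    using preserves_qf_reduction[OF assms] by blast
  show ?thesis
  proof (cases "act_mat M ** g = mat 1")
    case True
    have "act_mat (hat M) ** act_mat M = mat 1"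
      by (simp add: sp_hat_left[OF two M] act_mat_1 flip: act_mat_mult[OF two M])
    then have "g = act_mat (hat M)"
      using True by (metis matrix_mul_assoc matrix_mul_lid matrix_mul_rid)
    then show ?thesis using sp_hat[OF two M] by blast
  next
    case False
    then have "det (act_mat M) * det g = det (refl4 :: 'k ^ 5 ^ 5)" using cases by (metis det_mul)
    then show ?thesis by (simp add: det_act_mat[OF two M] det_refl4)
  qed
qed



section \<open>Pure quaternions and a standard basis adapted to the orthogonal involution\<close>

section \<open>Splitting a quaternion algebra with orthogonal involution\<close>

context quaternion_algebra
begin

lemma scale_one_inject: "scl c 1 = scl d 1 \<Longrightarrow> c = d"
  by simp

lemma double_zero: "(2 :: 'a) \<noteq> 0 \<Longrightarrow> x + x = 0 \<Longrightarrow> x = 0" for x :: 'h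
proof -
  assume "(2 :: 'a) \<noteq> 0" "x + x = 0"
  have "scl 2 x = scl (1 + 1) x" by simp
  also have "\<dots> = 0" unfolding scale_left_distrib using \<open>x + x = 0\<close> by simp
  finally show ?thesis using \<open>(2 :: 'a) \<noteq> 0\<close> by simp
qed

lemma bar_add: "bar (x + y) = bar x + bar y" and bar_scale: "bar (scl c x) = scl c (bar x)"
  and bar_diff: "bar (x - y) = bar x - bar y"
proof -
  have add: "bar (x + y) = bar x + bar y" and scale: "bar (scl c x) = scl c (bar x)" for c x y
    using bar_linear unfolding Vector_Spaces.linear_iff by blast+
  have minus: "bar (- x) = - bar x" for x using scale[of "- 1" x] by simp
  have diff: "bar (x - y) = bar x - bar y" for x y using add[of x "- y"] minus[of y] by simp
  show "bar (x + y) = bar x + bar y" "bar (scl c x) = scl c (bar x)"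
    "bar (x - y) = bar x - bar y" by (fact add scale diff)+
qed

lemma bar_1: "bar 1 = 1"
  using bar_mult[of "bar 1" 1] by (simp add: bar_bar)

text \<open>The trace is the difference of the norms of \<open>x + 1\<close> and \<open>x\<close>,
  less 1.\<close>

lemma trace_scalar: "\<exists>t. x + bar x = scl t 1"
proof -
  obtain m n where "(x + 1) * bar (x + 1) = scl m 1" "x * bar x = scl n 1" using bar_standard by blast
  then have "x + bar x = scl (m - n - 1) 1"
    by (simp add: bar_add bar_1 scale_left_diff_distrib distrib_left distrib_right) (metis add.commute add_diff_cancel_left' add_diff_eq)
  then show ?thesis by blast
qed

lemma scalar_mult: "scl c 1 * x = scl c x" "x * scl c 1 = scl c x"
  by (simp_all add: scale_mult_left scale_mult_right)

lemma bar_mult_self: "bar x * x = x * bar x"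
proof -
  obtain t where "x + bar x = scl t 1" using trace_scalar by blast
  then have "bar x = scl t 1 - x" by (metis add_diff_cancel_left')
  then show ?thesis by (simp add: left_diff_distrib right_diff_distrib scalar_mult)
qed

end

locale quaternion_orthogonal = quaternion_algebra +
  fixes dag :: "'b \<Rightarrow> 'b"
  assumes two: "(2 :: 'a) \<noteq> 0" and orth: "orthogonal_involution scl bar dag"
begin

lemma dag_linear: "Vector_Spaces.linear scl scl dag" and dag_dag: "dag (dag x) = x"
  and dag_mult: "dag (x * y) = dag y * dag x" and dag_neq_bar: "dag \<noteq> bar"
  using orth unfolding orthogonal_involution_def by auto

lemma dag_add: "dag (x + y) = dag x + dag y" and dag_scale: "dag (scl c x) = scl c (dag x)"
  and dag_minus: "dag (- x) = - dag x" and dag_diff: "dag (x - y) = dag x - dag y"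
proof -
  have add: "dag (x + y) = dag x + dag y" and scale: "dag (scl c x) = scl c (dag x)" for c x y
    using dag_linear unfolding Vector_Spaces.linear_iff by blast+
  have minus: "dag (- x) = - dag x" for x using scale[of "- 1" x] by simp
  have diff: "dag (x - y) = dag x - dag y" for x y using add[of x "- y"] minus[of y] by simp
  show "dag (x + y) = dag x + dag y" "dag (scl c x) = scl c (dag x)" "dag (- x) = - dag x"
    "dag (x - y) = dag x - dag y" by (fact add scale minus diff)+
qed

lemma dag_1: "dag 1 = 1"
  using dag_mult[of "dag 1" 1] by (simp add: dag_dag)

text \<open>
  The standard involution is unique, so it is fixed under conjugation by \<open>dag\<close>.
\<close>

lemma dag_bar: "dag (bar x) = bar (dag x)"
proof -
  define b where "b x = dag (bar (dag x))" for x
  obtain s where s: "x + bar x = scl s 1" using trace_scalar by blast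
  obtain t where "dag x + bar (dag x) = scl t 1" using trace_scalar by blast
  then have "dag (dag x + bar (dag x)) = dag (scl t 1)" by simp
  then have t: "x + b x = scl t 1" by (simp add: dag_add dag_dag dag_scale dag_1 b_def)
  obtain m where m: "bar x * x = scl m 1" using bar_standard bar_mult_self by metis
  obtain n where "dag x * bar (dag x) = scl n 1" using bar_standard by blast
  then have "dag (dag x * bar (dag x)) = dag (scl n 1)" by simp
  then have n: "b x * x = scl n 1" by (simp add: dag_mult dag_dag dag_scale dag_1 b_def)
  have d: "b x - bar x = scl (t - s) 1"
    using s t by (simp add: scale_left_diff_distrib) (metis add_diff_cancel_left)
  then have "scl (t - s) x = (b x - bar x) * x" by (simp add: scalar_mult)
  also have "\<dots> = scl (n - m) 1" by (simp add: left_diff_distrib m n scale_left_diff_distrib)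
  finally have eq: "scl (t - s) x = scl (n - m) 1" .
  have "b x = bar x"
  proof (cases "t = s")
    case True
    then show ?thesis using d by simp
  next
    case False
    then have "x = scl ((n - m) / (t - s)) 1"
      using arg_cong[OF eq, of "scl (1 / (t - s))"] by simp
    then show ?thesis unfolding b_def by (metis bar_scale bar_1 dag_scale dag_1)
  qed
  then have "dag (b x) = dag (bar x)" by simp
  then show ?thesis by (simp add: b_def dag_dag)
qed

definition pure :: "'b set" where "pure = {x. bar x = - x}"

lemma pure_decomposition: "\<exists>c y. y \<in> pure \<and> x = scl c 1 + y"
proof -
  obtain t where t: "x + bar x = scl t 1" using trace_scalar by blast
  have "scl (t / 2) 1 + scl (t / 2) 1 = scl t 1"
    using two by (simp flip: scale_left_distrib add: field_simps)
  then have "bar (x - scl (t / 2) 1) = - (x - scl (t / 2) 1)"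
    using t by (simp add: bar_diff bar_scale bar_1) (metis add_diff_cancel_left' add_diff_eq diff_add_eq)
  then show ?thesis by (intro exI[of _ "t / 2"] exI[of _ "x - scl (t / 2) 1"]) (simp add: pure_def)
qed

lemma pure_square: "x \<in> pure \<Longrightarrow> \<exists>c. x * x = scl c 1"
proof -
  assume x: "x \<in> pure"
  obtain c where "x * bar x = scl c 1" using bar_standard by blast
  then have "x * x = scl (- c) 1" using x by (simp add: pure_def) (metis minus_minus)
  then show ?thesis by blast
qed

lemma pure_add: "x \<in> pure \<Longrightarrow> y \<in> pure \<Longrightarrow> x + y \<in> pure"
  and pure_diff: "x \<in> pure \<Longrightarrow> y \<in> pure \<Longrightarrow> x - y \<in> pure"
  and pure_scale: "x \<in> pure \<Longrightarrow> scl c x \<in> pure"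
  and pure_dag: "x \<in> pure \<Longrightarrow> dag x \<in> pure"
  by (simp_all add: pure_def bar_add bar_diff bar_scale flip: dag_bar) (simp_all add: dag_minus)

lemma anticommutator: "x * y + y * x = (x + y) * (x + y) - x * x - y * y" for x y :: 'b
  by (simp add: distrib_left distrib_right)

lemma pure_anticommutator: "x \<in> pure \<Longrightarrow> y \<in> pure \<Longrightarrow> \<exists>c. x * y + y * x = scl c 1"
  unfolding anticommutator using pure_square[of x] pure_square[of y] pure_square[OF pure_add[of x y]]
  by (metis scale_left_diff_distrib)

text \<open>If \<open>x\<close> anticommutes with all pure quaternions, then
  \<open>x * x = 0\<close>, and the right ideal generated by \<open>x\<close> is two-sided. By
  simplicity it is zero or everything; the latter gives \<open>1 = x * h\<close>, hence
  \<open>x = x * x * h = 0\<close>.\<close>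

lemma pure_nondegenerate:
  assumes x: "x \<in> pure" and perp: "\<And>y. y \<in> pure \<Longrightarrow> x * y + y * x = 0"
  shows "x = 0"
proof -
  have "x * x = 0" using double_zero[OF two] perp[OF x] by blast
  let ?I = "range (\<lambda>h. x * h)"
  have "y * (x * h) \<in> ?I" for y h
  proof -
    obtain c z where z: "z \<in> pure" "y = scl c 1 + z" using pure_decomposition by blast
    have "z * x = - (x * z)" using perp[OF z(1)] by (simp add: eq_neg_iff_add_eq_0 add.commute)
    then have "y * x = x * (scl c 1 - z)" by (simp add: z(2) distrib_right right_diff_distrib scalar_mult)
    then have "y * (x * h) = x * ((scl c 1 - z) * h)" by (metis mult.assoc)
    then show ?thesis by blast
  qed
  moreover have "x * h + x * k \<in> ?I" for h k by (metis distrib_left rangeI)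
  moreover have "x * h * y \<in> ?I" for h y by (metis mult.assoc rangeI)
  moreover have "0 \<in> ?I" by (metis mult_zero_right rangeI)
  ultimately have "?I = {0} \<or> ?I = UNIV" by (intro simple) auto
  then show ?thesis
  proof
    assume "?I = {0}"
    then show ?thesis by (metis mult_1_right rangeI singletonD)
  next
    assume "?I = UNIV"
    then obtain h where "1 = x * h" by (metis UNIV_I imageE)
    then have "x = (x * x) * h" by (metis mult.assoc mult_1_right)
    then show ?thesis using \<open>x * x = 0\<close> by simp
  qed
qed

definition pplus :: "'b set" where "pplus = {x \<in> pure. dag x = x}"
definition pminus :: "'b set" where "pminus = {x \<in> pure. dag x = - x}"

lemma pure_split:
  assumes "x \<in> pure"
  obtains p m where "p \<in> pplus" "m \<in> pminus" "x = p + m"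
proof -
  let ?p = "scl (1 / 2) (x + dag x)" and ?m = "scl (1 / 2) (x - dag x)"
  have "?p \<in> pplus" unfolding pplus_def using assms
    by (simp add: pure_scale pure_add pure_dag dag_scale dag_add dag_dag add.commute)
  moreover have "?m \<in> pminus" unfolding pminus_def using assms
    by (simp add: pure_scale pure_diff pure_dag dag_scale dag_diff dag_dag flip: scale_minus_right)
  moreover have "x = ?p + ?m"
  proof -
    have "?p + ?m = scl (1 / 2) (x + x)" by (simp flip: scale_right_distrib)
    also have "x + x = scl 2 x" using scale_left_distrib[of 1 1 x] by simp
    finally show ?thesis using two by simp
  qed
  ultimately show ?thesis by (rule that)
qed

lemma pplus_perp_pminus:
  assumes "x \<in> pplus" "y \<in> pminus"
  shows "x * y + y * x = 0"
proof -
  obtain c where c: "x * y + y * x = scl c 1"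
    using pure_anticommutator assms by (auto simp: pplus_def pminus_def)
  have "dag (x * y + y * x) = - (x * y + y * x)"
    using assms by (simp add: pplus_def pminus_def dag_add dag_mult)
  moreover have "dag (x * y + y * x) = x * y + y * x" unfolding c by (simp add: dag_scale dag_1)
  ultimately have "(x * y + y * x) + (x * y + y * x) = 0" by (metis add.right_inverse)
  then show ?thesis by (rule double_zero[OF two])
qed

text \<open>If all squares on \<open>pplus\<close> vanished, then by polarization so would all
  anticommutators there; as \<open>pplus\<close> is orthogonal to \<open>pminus\<close>,
  nondegeneracy would give \<open>pplus = {0}\<close>. Then \<open>dag\<close> would be -1 on pure
  quaternions, that is, equal to \<open>bar\<close>.\<close>

lemma exists_i: "\<exists>i a. i \<in> pplus \<and> i * i = scl a 1 \<and> a \<noteq> 0"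
proof (rule ccontr)
  assume neg: "\<not> ?thesis"
  have sq: "x * x = 0" if x: "x \<in> pplus" for x
  proof -
    obtain c where "x * x = scl c 1" using pure_square[of x] x by (auto simp: pplus_def)
    then show ?thesis using neg that by (metis scale_zero_left)
  qed
  have zero: "x = 0" if x: "x \<in> pplus" for x
  proof (rule pure_nondegenerate)
    show "x \<in> pure" using x by (simp add: pplus_def)
    fix y assume "y \<in> pure"
    then obtain p m where y: "p \<in> pplus" "m \<in> pminus" "y = p + m" by (rule pure_split)
    have "x + p \<in> pplus" using x y(1) by (simp add: pplus_def pure_add dag_add)
    then have "x * p + p * x = 0" unfolding anticommutator using sq x y(1) by simp
    moreover have "x * m + m * x = 0" using pplus_perp_pminus x y(2) .
    moreover have "x * y + y * x = (x * p + p * x) + (x * m + m * x)"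
      by (simp add: y(3) distrib_left distrib_right)
    ultimately show "x * y + y * x = 0" by simp
  qed
  have "dag x = bar x" for x
  proof -
    obtain c y where y: "y \<in> pure" "x = scl c 1 + y" using pure_decomposition by blast
    obtain p m where pm: "p \<in> pplus" "m \<in> pminus" "y = p + m" using y(1) by (rule pure_split)
    then have "y = m" using zero[of p] by simp
    then have "dag y = - y" using pm(2) by (simp add: pminus_def)
    then show ?thesis using y by (simp add: pure_def dag_add bar_add dag_scale bar_scale dag_1 bar_1)
  qed
  then show False using dag_neq_bar by blast
qed

text \<open>Without such a \<open>j\<close>, the orthogonal complement of \<open>i\<close> in
  \<open>pplus\<close> is zero by nondegeneracy, so \<open>pplus\<close> is the line of
  \<open>i\<close>. This forces \<open>pminus\<close> to be zero as well, so that 1 and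
  \<open>i\<close> span the algebra, against its dimension 4.\<close>

lemma exists_j:
  assumes i: "i \<in> pplus" "i * i = scl a 1" "a \<noteq> 0"
  shows "\<exists>j b. j \<in> pplus \<and> j * j = scl b 1 \<and> b \<noteq> 0 \<and> i * j + j * i = 0"
proof (rule ccontr)
  assume neg: "\<not> ?thesis"
  have sq: "x * x = 0" if x: "x \<in> pplus" "i * x + x * i = 0" for x
  proof -
    obtain c where "x * x = scl c 1" using pure_square[of x] x(1) by (auto simp: pplus_def)
    then show ?thesis using neg that by (metis scale_zero_left)
  qed
  have split: "\<exists>c q. p = scl c i + q \<and> q \<in> pplus \<and> i * q + q * i = 0" if p: "p \<in> pplus" for p
  proof -
    obtain d where d: "i * p + p * i = scl d 1" using pure_anticommutator i(1) p by (auto simp: pplus_def)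
    \<comment> \<open>The component of \<open>p\<close> orthogonal to \<open>i\<close>; the
      anticommutator of \<open>i\<close> with itself is \<open>2 * a\<close>.\<close>
    let ?q = "p - scl (d / (2 * a)) i"
    have "i * ?q + ?q * i = scl d 1 - (scl (d / (2 * a) * a) 1 + scl (d / (2 * a) * a) 1)"
      by (simp add: left_diff_distrib right_diff_distrib scale_mult_left scale_mult_right i(2) flip: d)
    also have "\<dots> = 0" using two i(3) by (simp add: field_simps flip: scale_left_distrib)
    finally have "i * ?q + ?q * i = 0" .
    moreover have "?q \<in> pplus" using i(1) p by (simp add: pplus_def pure_diff pure_scale dag_diff dag_scale)
    ultimately show ?thesis by (intro exI[of _ "d / (2 * a)"] exI[of _ ?q]) simp
  qed
  have zero: "x = 0" if x: "x \<in> pplus" "i * x + x * i = 0" for x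
  proof (rule pure_nondegenerate)
    show "x \<in> pure" using x by (simp add: pplus_def)
    fix y assume "y \<in> pure"
    then obtain p m where y: "p \<in> pplus" "m \<in> pminus" "y = p + m" by (rule pure_split)
    obtain c q where q: "p = scl c i + q" "q \<in> pplus" "i * q + q * i = 0" using split[OF y(1)] by blast
    have "x + q \<in> pplus" using x(1) q(2) by (simp add: pplus_def pure_add dag_add)
    moreover have "i * (x + q) + (x + q) * i = (i * x + x * i) + (i * q + q * i)"
      by (simp add: distrib_left distrib_right)
    ultimately have "(x + q) * (x + q) = 0" using sq[of "x + q"] x(2) q(3) by simp
    then have "x * q + q * x = 0" using sq[OF x] sq[OF q(2,3)] anticommutator[of x q] by simp
    moreover have "x * m + m * x = 0" using pplus_perp_pminus x(1) y(2) .
    moreover have "x * y + y * x = scl c (i * x + x * i) + (x * q + q * x) + (x * m + m * x)"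
      by (simp add: y(3) q(1) distrib_left distrib_right scale_mult_left scale_mult_right scale_right_distrib)
    ultimately show "x * y + y * x = 0" using x(2) by simp
  qed
  have plus: "\<exists>c. p = scl c i" if "p \<in> pplus" for p
    using split[OF that] zero by force
  have minus: "m = 0" if m: "m \<in> pminus" for m
  proof -
    have "i * m + m * i = 0" using pplus_perp_pminus i(1) m .
    then have mi: "m * i = - (i * m)" by (simp add: eq_neg_iff_add_eq_0 add.commute)
    \<comment> \<open>Since \<open>i\<close> and \<open>m\<close> anticommute, \<open>i * m\<close>
      is pure and fixed by \<open>dag\<close>, hence a multiple of \<open>i\<close>. Cancelling
      \<open>i\<close> makes \<open>m\<close> a scalar, and a pure scalar is zero.\<close>
    have "i * m \<in> pplus"
      using i(1) m mi by (simp add: pplus_def pminus_def pure_def bar_mult dag_mult)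
    then obtain c where "i * m = scl c i" using plus by blast
    then have "i * (i * m) = scl (c * a) 1" by (simp add: scale_mult_right i(2))
    moreover have "i * (i * m) = scl a m" by (simp add: i(2) scalar_mult flip: mult.assoc)
    ultimately have "scl (1 / a) (scl a m) = scl (1 / a) (scl (c * a) 1)" by simp
    then have "m = scl c 1" using i(3) by simp
    then have "bar m = m" by (simp add: bar_scale bar_1)
    then have "m + m = 0" using m by (simp add: pminus_def pure_def) (metis add.right_inverse)
    then show ?thesis by (rule double_zero[OF two])
  qed
  have "UNIV \<subseteq> span {1, i}"
  proof
    fix x
    obtain c y where y: "y \<in> pure" "x = scl c 1 + y" using pure_decomposition by blast
    obtain p m where "p \<in> pplus" "m \<in> pminus" "y = p + m" using y(1) by (rule pure_split)
    then obtain d where "y = scl d i" using plus minus by force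
    then have "x = scl c 1 + scl d i" using y by simp
    then show "x \<in> span {1, i}" by (simp add: span_add span_scale span_base)
  qed
  then have "dim UNIV \<le> card {1, i}" by (intro dim_le_card) auto
  also have "\<dots> \<le> 2" by (simp add: card_insert_if)
  finally show False using dim_4 by simp
qed

lemma quaternion_basis:
  "\<exists>i j a b. a \<noteq> 0 \<and> b \<noteq> 0 \<and> i * i = scl a 1 \<and> j * j = scl b 1 \<and> j * i = - (i * j) \<and>
    bar i = - i \<and> bar j = - j \<and> dag i = i \<and> dag j = j"
proof -
  obtain i a where i: "i \<in> pplus" "i * i = scl a 1" "a \<noteq> 0" using exists_i by blast
  obtain j b where j: "j \<in> pplus" "j * j = scl b 1" "b \<noteq> 0" "i * j + j * i = 0" using exists_j[OF i] by blast
  then have "j * i = - (i * j)" by (simp add: eq_neg_iff_add_eq_0 add.commute)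
  then show ?thesis using i j by (auto simp: pplus_def pure_def)
qed

end

section \<open>The multiplication table and the splitting by square roots\<close>

locale quaternion_split = quaternion_orthogonal +
  fixes i j :: 'b and a b :: 'a
  assumes ab: "a \<noteq> 0" "b \<noteq> 0" and ii: "i * i = scl a 1" and jj: "j * j = scl b 1"
    and ji: "j * i = - (i * j)" and bar_i: "bar i = - i" and bar_j: "bar j = - j"
    and dag_i: "dag i = i" and dag_j: "dag j = j"
begin

definition lin :: "'a \<Rightarrow> 'a \<Rightarrow> 'a \<Rightarrow> 'a \<Rightarrow> 'b" where
  "lin p q r s = scl p 1 + scl q i + scl r j + scl s (i * j)"

lemma products:
  "i * (i * j) = scl a j" "j * (i * j) = - scl b i" "i * j * i = - scl a j" "i * j * j = scl b i"
  "i * j * (i * j) = - scl (a * b) 1"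
proof -
  show 1: "i * (i * j) = scl a j" by (simp add: ii scalar_mult flip: mult.assoc)
  show "i * j * j = scl b i" by (simp add: jj scalar_mult mult.assoc)
  show 2: "j * (i * j) = - scl b i" unfolding mult.assoc[symmetric] ji by (simp add: mult.assoc jj scalar_mult)
  show 3: "i * j * i = - scl a j" unfolding mult.assoc ji by (simp add: 1)
  show "i * j * (i * j) = - scl (a * b) 1"
    unfolding mult.assoc 2 by (simp add: scale_mult_right ii mult.commute)
qed

lemma lin_mult: "lin p q r s * lin p' q' r' s' = lin
   (p * p' + a * q * q' + b * r * r' - a * b * s * s') (p * q' + q * p' - b * r * s' + b * s * r')
   (p * r' + r * p' + a * q * s' - a * s * q') (p * s' + s * p' + q * r' - r * q')"
  unfolding lin_def
  by (simp add: distrib_left distrib_right scale_mult_left scale_mult_right ii jj ji products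
      scale_left_distrib scale_left_diff_distrib)
     (simp add: algebra_simps)

lemma lin_add: "lin p q r s + lin p' q' r' s' = lin (p + p') (q + q') (r + r') (s + s')"
  unfolding lin_def by (simp add: scale_left_distrib algebra_simps)

lemma lin_scale: "scl c (lin p q r s) = lin (c * p) (c * q) (c * r) (c * s)"
  unfolding lin_def by (simp add: scale_right_distrib)

lemma lin_basis: "1 = lin 1 0 0 0" "i = lin 0 1 0 0" "j = lin 0 0 1 0" "i * j = lin 0 0 0 1"
  unfolding lin_def by simp_all

text \<open>Multiplication by \<open>i\<close> on both sides changes the sign of the last two
  coefficients relative to the first two, which separates the pairs. Multiplication by
  \<open>j\<close> carries the second pair to the first, and conjugation separates 1 from
  \<open>i\<close>.\<close>

lemma lin_zero:
  assumes zero: "lin p q r s = 0"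
  shows "p = 0 \<and> q = 0 \<and> r = 0 \<and> s = 0"
proof -
  have dbl: "x = 0" if "x + x = 0" for x :: 'a
    using that two by (simp flip: mult_2)
  have neg: "- x = x \<longleftrightarrow> x = 0" for x :: 'b
    using double_zero[OF two, of x] by (metis add.left_inverse neg_0_equal_iff_equal)
  have l00: "p = 0 \<and> q = 0" if "lin p q 0 0 = 0" for p q
  proof -
    have "i * lin p q 0 0 + lin p q 0 0 * i = 0" "bar (lin p q 0 0) = 0"
      using that bar_add[of 0 0] by simp_all
    then have "lin p (- q) 0 0 = 0"
      by (simp add: lin_def bar_add bar_scale bar_1 bar_i)
    then have "lin (p + p) 0 0 0 = 0" using that lin_add[of p q 0 0 p "- q" 0 0] by simp
    then have "p + p = 0" by (simp add: lin_def)
    then have "p = 0" by (rule dbl)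
    then have "scl q i = 0" using that by (simp add: lin_def)
    then have "q = 0" using ii ab(1) by (metis mult_zero_left scale_eq_0_iff zero_neq_one)
    with \<open>p = 0\<close> show ?thesis by simp
  qed
  have "lin 0 1 0 0 * lin p q r s * lin 0 1 0 0 = 0" using zero by simp
  then have "lin (a * p) (a * q) (- a * r) (- a * s) = 0" by (simp add: lin_mult)
  then have "scl (1 / a) (lin (a * p) (a * q) (- a * r) (- a * s)) = 0" by simp
  then have 1: "lin p q (- r) (- s) = 0" using ab by (simp add: lin_scale)
  have "lin (p + p) (q + q) 0 0 = 0" using lin_add[of p q r s p q "- r" "- s"] zero 1 by simp
  then have pq: "p = 0" "q = 0" using l00 dbl by blast+
  have "lin p q r s * lin 0 0 1 0 = 0" using zero by simp
  then have "lin (b * r) (b * s) 0 0 = 0" using pq by (simp add: lin_mult)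
  then show ?thesis using l00 ab pq by (metis mult_eq_0_iff)
qed

lemma lin_inject: "lin p q r s = lin p' q' r' s' \<longleftrightarrow> p = p' \<and> q = q' \<and> r = r' \<and> s = s'"
proof
  assume "lin p q r s = lin p' q' r' s'"
  then have "lin p q r s + scl (- 1) (lin p' q' r' s') = 0" by simp
  then show "p = p' \<and> q = q' \<and> r = r' \<and> s = s'"
    unfolding lin_scale lin_add using lin_zero by fastforce
qed simp

lemma lin_surj: "\<exists>p q r s. x = lin p q r s"
proof -
  let ?S = "{1, i, j, i * j}"
  have not_span: "i * j \<notin> span {}" "j \<notin> span {i * j}" "i \<notin> span {j, i * j}" "1 \<notin> span {i, j, i * j}"
  proof -
    have "lin 0 0 0 1 = 0 \<Longrightarrow> False" using lin_zero by fastforce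
    then show "i * j \<notin> span {}" by (auto simp: lin_def)
    have "False" if "j - scl k (i * j) = 0" for k
      using that lin_zero[of 0 0 1 "- k"] by (simp add: lin_def)
    then show "j \<notin> span {i * j}" unfolding span_insert span_empty by auto
    have "False" if "i - scl k j - scl l (i * j) = 0" for k l
      using that lin_zero[of 0 1 "- k" "- l"] by (simp add: lin_def)
    then show "i \<notin> span {j, i * j}" unfolding span_insert span_empty by auto
    have "False" if "1 - scl m i - scl k j - scl l (i * j) = 0" for k l m
      using that lin_zero[of 1 "- m" "- k" "- l"] by (simp add: lin_def)
    then show "1 \<notin> span {i, j, i * j}" unfolding span_insert span_empty by auto
  qed
  have base: "y \<notin> span S \<Longrightarrow> y \<notin> S" for y S using span_base[of y S] by blast
  have "j \<notin> {i * j}" "i \<notin> {j, i * j}" "1 \<notin> {i, j, i * j}"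
    by (rule base, rule not_span)+
  then have card: "card ?S = 4" by simp
  have ind: "independent ?S" by (intro independent_insertI not_span independent_empty)
  obtain B where B: "independent B" "UNIV \<subseteq> span B" "card B = dim UNIV" using basis_exists[of UNIV] by metis
  then have "finite B" using dim_4 card.infinite by fastforce
  have "x \<in> span ?S"
  proof (rule ccontr)
    assume x: "x \<notin> span ?S"
    then have "independent (insert x ?S)" using ind by (rule independent_insertI)
    then have "card (insert x ?S) \<le> card B"
      using independent_span_bound[OF \<open>finite B\<close>] B(2) by blast
    moreover have "x \<notin> ?S" using x by (rule base)
    ultimately show False using card dim_4 B(3) by simp
  qed
  then obtain p q r s where "x - scl p 1 - scl q i - scl r j - scl s (i * j) = 0"
    unfolding span_insert span_empty by auto
  then have "x = lin p q r s" unfolding lin_def by (simp add: algebra_simps)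
  then show ?thesis by blast
qed

text \<open>With square roots \<open>A\<close> of \<open>a\<close> and \<open>B\<close> of
  \<open>b\<close>, send \<open>i\<close> to the diagonal matrix with entries \<open>A\<close>,
  \<open>-A\<close> and \<open>j\<close> to \<open>B\<close> times the swap matrix. Both are
  symmetric of trace zero and their product is skew, so conjugation becomes the adjugate and
  \<open>dag\<close> becomes transposition.\<close>

lemma exists_splitting:
  "\<exists>T :: 'b \<Rightarrow> 'a alg_closure m2.
     (\<forall>x y. T (x + y) = T x + T y) \<and> (\<forall>c x. T (scl c x) = scal (to_ac c) * T x) \<and>
     T 1 = 1 \<and> (\<forall>x y. T (x * y) = T x * T y) \<and> (\<forall>x. T (bar x) = adj (T x)) \<and>
     (\<forall>x. T (dag x) = tp (T x)) \<and>
     (\<forall>m. \<exists>k1 k2 k3 k4 x1 x2 x3 x4.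
       m = scal k1 * T x1 + scal k2 * T x2 + scal k3 * T x3 + scal k4 * T x4)"
proof -
  obtain A where A: "A * A = to_ac a" using nth_root_exists[of 2 "to_ac a"] by (auto simp: power2_eq_square)
  obtain B where B: "B * B = to_ac b" using nth_root_exists[of 2 "to_ac b"] by (auto simp: power2_eq_square)
  have AB: "A \<noteq> 0" "B \<noteq> 0" using A B ab by auto
  have two_ac: "(2 :: 'a alg_closure) \<noteq> 0"
    using two to_ac_numeral[of "num.Bit0 num.One"] by (metis to_ac_eq_0_iff)
  have "\<forall>x. \<exists>c. x = lin (c 0) (c 1) (c 2) (c (3 :: nat))"
  proof
    fix x
    obtain p q r s where "x = lin p q r s" using lin_surj by blast
    then show "\<exists>c. x = lin (c 0) (c 1) (c 2) (c (3 :: nat))"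
      by (intro exI[of _ "\<lambda>n. if n = 0 then p else if n = 1 then q else if n = 2 then r else s"]) simp
  qed
  then obtain c where c: "\<And>x. x = lin (c x 0) (c x 1) (c x 2) (c x (3 :: nat))" by metis
  define N where "N p q r s = M2 (to_ac p + A * to_ac q) (B * to_ac r + A * B * to_ac s)
    (B * to_ac r - A * B * to_ac s) (to_ac p - A * to_ac q)" for p q r s
  define T where "T x = N (c x 0) (c x 1) (c x 2) (c x 3)" for x
  have T: "T (lin p q r s) = N p q r s" for p q r s
    using c[of "lin p q r s"] unfolding lin_inject T_def by metis
  have "T (x + y) = T x + T y" for x y
    using lin_surj[of x] lin_surj[of y] by (auto simp: lin_add T) (simp add: N_def algebra_simps)
  moreover have "T (scl d x) = scal (to_ac d) * T x" for d x
    using lin_surj[of x] by (auto simp: lin_scale T) (simp add: N_def scal_def algebra_simps)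
  moreover have "T (lin 1 0 0 0) = 1" by (simp add: T N_def one_m2_def)
  then have "T 1 = 1" by (simp only: lin_basis(1)[symmetric])
  moreover have "T (x * y) = T x * T y" for x y
  proof -
    obtain p q r s where x: "x = lin p q r s" using lin_surj by blast
    obtain p' q' r' s' where y: "y = lin p' q' r' s'" using lin_surj by blast
    show ?thesis unfolding x y lin_mult T N_def
      by (simp flip: A B) (simp add: algebra_simps)
  qed
  moreover have "bar (lin p q r s) = lin p (- q) (- r) (- s)" for p q r s
    by (simp add: lin_def bar_add bar_scale bar_1 bar_i bar_j bar_mult ji)
  then have "T (bar x) = adj (T x)" for x
    using lin_surj[of x] by (auto simp: T) (simp add: N_def adj_def)
  moreover have "dag (lin p q r s) = lin p q r (- s)" for p q r s
    by (simp add: lin_def dag_add dag_scale dag_1 dag_i dag_j dag_mult ji)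
  then have "T (dag x) = tp (T x)" for x
    using lin_surj[of x] by (auto simp: T) (simp add: N_def tp_def)
  moreover have "\<exists>k1 k2 k3 k4 x1 x2 x3 x4.
       m = scal k1 * T x1 + scal k2 * T x2 + scal k3 * T x3 + scal k4 * T x4" for m
  proof -
    have "m = scal ((m11 m + m22 m) / 2) * T (lin 1 0 0 0) + scal ((m11 m - m22 m) / (2 * A)) * T (lin 0 1 0 0)
      + scal ((m12 m + m21 m) / (2 * B)) * T (lin 0 0 1 0) + scal ((m12 m - m21 m) / (2 * A * B)) * T (lin 0 0 0 1)"
      using AB two_ac by (simp add: T N_def m2_eq_iff) (simp add: field_simps)
    then show ?thesis by blast
  qed
  ultimately show ?thesis by blast
qed

end

lemma (in quaternion_orthogonal) splitting:
  "\<exists>T :: 'b \<Rightarrow> 'a alg_closure m2.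
     (\<forall>x y. T (x + y) = T x + T y) \<and> (\<forall>c x. T (scl c x) = scal (to_ac c) * T x) \<and>
     T 1 = 1 \<and> (\<forall>x y. T (x * y) = T x * T y) \<and> (\<forall>x. T (bar x) = adj (T x)) \<and>
     (\<forall>x. T (dag x) = tp (T x)) \<and>
     (\<forall>m. \<exists>k1 k2 k3 k4 x1 x2 x3 x4.
       m = scal k1 * T x1 + scal k2 * T x2 + scal k3 * T x3 + scal k4 * T x4)"
proof -
  obtain i j a b where "a \<noteq> 0" "b \<noteq> 0" "i * i = scl a 1" "j * j = scl b 1" "j * i = - (i * j)"
    "bar i = - i" "bar j = - j" "dag i = i" "dag j = j" using quaternion_basis by blast
  then interpret quaternion_split scl bar dag i j a b by unfold_locales
  show ?thesis by (rule exists_splitting)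
qed



section \<open>Identification of the group of \<open>K\<close>-points with Sp(4)\<close>

section \<open>Passage to the algebraic closure\<close>

lemma surj_matrix_inverse:
  fixes A :: "'k::field ^ 'n ^ 'n"
  assumes "\<And>y. \<exists>x. A *v x = y"
  obtains B where "A ** B = mat 1" "B ** A = mat 1"
proof -
  have "surj (\<lambda>x. A *v x)" using assms by (metis surjI surj_def)
  then obtain B where "A ** B = mat 1" using matrix_right_invertible_surjective by blast
  then show ?thesis using that matrix_left_right_inverse by blast
qed

lemma regular_onI:
  assumes "\<And>w. (\<lambda>x. g x w) \<in> polyfun C" "\<And>x. x \<in> S \<Longrightarrow> f x = g x"
  shows "regular_on C S f"
  unfolding regular_on_def
proof
  fix w
  show "\<exists>p\<in>polyfun C. \<forall>x\<in>S. f x w = p x"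
    by (rule bexI[OF _ assms(1)[of w]]) (simp add: assms(2))
qed

lemma (in vector_space) is_basis_sum_coords:
  fixes e :: "'i::finite \<Rightarrow> 'b"
  assumes "is_basis scale e W" "w \<in> W"
  shows "(\<Sum>k\<in>UNIV. scale (coords scale e w k) (e k)) = w"
proof -
  have e: "inj e" "independent (range e)" "span (range e) = W"
    using assms(1) unfolding is_basis_def by auto
  have "(\<Sum>k\<in>UNIV. scale (coords scale e w k) (e k)) =
      (\<Sum>v\<in>range e. scale (representation (range e) w v) v)"
    unfolding coords_def by (subst sum.reindex[OF e(1)]) simp
  also have "\<dots> = w"
    by (rule sum_representation_eq) (use e assms(2) in auto)
  finally show ?thesis .
qed

lemma (in quaternion_algebra) vector_space_FFH: "vector_space (scale_FFH scl)"
  by unfold_locales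
     (auto simp: scale_FFH_def algebra_simps scale_right_distrib scale_left_distrib)

lemma scal_simps:
  "scal (x + y) = scal x + scal y" "scal (x * y) = scal x * scal y" "scal 1 = 1" "scal 0 = 0"
  "scal (- x) = - scal x"
  for x y :: "'k::comm_ring_1"
  by (simp_all add: m2_eq_iff)

lemma scal_commute: "scal x * m = m * scal x" for x :: "'k::comm_ring_1"
  by (simp add: m2_eq_iff mult.commute)

lemma tp_sum: "tp (sum f A) = (\<Sum>i\<in>A. tp (f i))" for f :: "'i \<Rightarrow> 'k::comm_ring_1 m2"
  by (simp add: m2_eq_iff m2_sel_sum)

lemma tp_simps: "tp (scal k * x) = scal k * tp x" "tp (x + y) = tp x + tp y" "tp (tp x) = x"
  for x y :: "'k::comm_ring_1 m2"
  by (simp_all add: m2_eq_iff)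

lemma adj_simps: "adj (scal k * x) = scal k * adj x" "adj (x + y) = adj x + adj y"
  for x y :: "'k::comm_ring_1 m2"
  by (simp_all add: m2_eq_iff)

lemma adj_sum: "adj (sum f A) = (\<Sum>i\<in>A. adj (f i))" for f :: "'i \<Rightarrow> 'k::comm_ring_1 m2"
  by (induction A rule: infinite_finite_induct) (simp_all add: adj_simps)

locale split_setting = quaternion_orthogonal scl bar dag
  for scl :: "'a::field \<Rightarrow> 'h::ring_1 \<Rightarrow> 'h" and bar dag :: "'h \<Rightarrow> 'h" +
  fixes e :: "4 \<Rightarrow> 'h" and b :: "5 \<Rightarrow> 'a \<times> 'a \<times> 'h" and T :: "'h \<Rightarrow> 'a alg_closure m2"
  assumes e: "is_basis scl e UNIV"
    and b: "is_basis (scale_FFH scl) b (UNIV \<times> UNIV \<times> Hplus dag)"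
    and T_add: "T (x + y) = T x + T y" and T_scale: "T (scl c x) = scal (to_ac c) * T x"
    and T_1: "T 1 = 1" and T_mult: "T (x * y) = T x * T y"
    and T_bar: "T (bar x) = adj (T x)" and T_dag: "T (dag x) = tp (T x)"
    and T_span: "\<exists>k1 k2 k3 k4 x1 x2 x3 x4.
       m = scal k1 * T x1 + scal k2 * T x2 + scal k3 * T x3 + scal k4 * T x4"
begin

abbreviation C :: "'a alg_closure set" where "C \<equiv> range to_ac"

lemma two_ac: "(2 :: 'a alg_closure) \<noteq> 0"
  using two to_ac_numeral[of "num.Bit0 num.One"] by (metis to_ac_eq_0_iff)

lemma T_0: "T 0 = 0" using T_add[of 0 0] by simp

lemma T_sum: "T (sum f A) = (\<Sum>i\<in>A. T (f i))"
  by (induction A rule: infinite_finite_induct) (simp_all add: T_0 T_add)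

text \<open>The \<open>K\<close>-linear extension of \<open>T\<close>, as an isomorphism from the
  scalar extension of \<open>H\<close> in coordinates to the 2-by-2 matrices.\<close>

definition tau :: "(4 \<Rightarrow> 'a alg_closure) \<Rightarrow> 'a alg_closure m2" where
  "tau x = (\<Sum>k\<in>UNIV. scal (x k) * T (e k))"

lemma tau_embed: "tau (HK_embed scl e h) = T h"
proof -
  have "T h = T (\<Sum>k\<in>UNIV. scl (coords scl e h k) (e k))"
    by (subst is_basis_sum_coords[OF e]) simp_all
  then show ?thesis by (simp add: T_sum T_scale tau_def HK_embed_def)
qed

lemma tau_add: "tau (\<lambda>k. x k + y k) = tau x + tau y" and tau_scale: "tau (\<lambda>k. c * x k) = scal c * tau x"
  and tau_0: "tau (\<lambda>k. 0) = 0" and tau_minus: "tau (\<lambda>k. - x k) = - tau x"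
  by (simp_all add: tau_def scal_simps distrib_right sum.distrib sum_distrib_left mult.assoc sum_negf)

lemma tau_sum: "tau (\<lambda>k. \<Sum>i\<in>A. f i k) = (\<Sum>i\<in>A. tau (f i))"
  by (induction A rule: infinite_finite_induct) (simp_all add: tau_0 tau_add)

lemma tau_mult: "tau (HK_mult scl e x y) = tau x * tau y"
proof -
  have "tau (HK_mult scl e x y) = (\<Sum>i\<in>UNIV. \<Sum>j\<in>UNIV. scal (x i * y j) * T (e i * e j))"
    unfolding HK_mult_def tau_sum tau_scale tau_embed ..
  also have "\<dots> = (\<Sum>i\<in>UNIV. \<Sum>j\<in>UNIV. (scal (x i) * T (e i)) * (scal (y j) * T (e j)))"
  proof (intro sum.cong refl)
    fix i j
    have "scal (x i) * T (e i) * (scal (y j) * T (e j)) = scal (x i) * (T (e i) * scal (y j)) * T (e j)"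
      by (simp only: mult.assoc)
    also have "\<dots> = scal (x i * y j) * T (e i * e j)"
      by (simp only: scal_commute[of "y j" "T (e i)", symmetric] scal_simps(2) T_mult mult.assoc)
    finally show "scal (x i * y j) * T (e i * e j) = scal (x i) * T (e i) * (scal (y j) * T (e j))" ..
  qed
  also have "\<dots> = tau x * tau y" by (simp add: tau_def sum_product)
  finally show ?thesis .
qed

lemma tau_linear: "tau (HK_linear scl e f x) = (\<Sum>k\<in>UNIV. scal (x k) * T (f (e k)))"
  unfolding HK_linear_def tau_sum tau_scale tau_embed ..

lemma tau_dag: "tau (HK_linear scl e dag x) = tp (tau x)"
  and tau_bar: "tau (HK_linear scl e bar x) = adj (tau x)"
  unfolding tau_linear by (simp_all add: tau_def T_dag T_bar tp_sum tp_simps adj_sum adj_simps)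

lemma tau_surj: "\<exists>x. tau x = m"
proof -
  obtain k1 k2 k3 k4 x1 x2 x3 x4 where
    "m = scal k1 * T x1 + scal k2 * T x2 + scal k3 * T x3 + scal k4 * T x4" using T_span by blast
  then have "tau (\<lambda>k. k1 * HK_embed scl e x1 k + k2 * HK_embed scl e x2 k +
      k3 * HK_embed scl e x3 k + k4 * HK_embed scl e x4 k) = m"
    by (simp add: tau_add tau_scale tau_embed)
  then show ?thesis by blast
qed

text \<open>A linear surjection between spaces of dimension 4 is invertible. The inverse is kept as
  an explicit linear formula because it later expresses coordinate functions through matrix
  entries.\<close>

lemma tau_inverse:
  "\<exists>D :: 'a alg_closure ^ 4 ^ 4. \<forall>x k. x k =
     D $ k $ 1 * m11 (tau x) + D $ k $ 2 * m12 (tau x) + D $ k $ 3 * m21 (tau x) + D $ k $ 4 * m22 (tau x)"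
proof -
  define vec where "vec m = ((\<chi> p. if p = 1 then m11 m else if p = 2 then m12 m else if p = 3 then m21 m else m22 m) :: 'a alg_closure ^ 4)"
    for m :: "'a alg_closure m2"
  have vec_sel: "vec m $ 1 = m11 m" "vec m $ 2 = m12 m" "vec m $ 3 = m21 m" "vec m $ 4 = m22 m" for m
    by (simp_all add: vec_def)
  define A :: "'a alg_closure ^ 4 ^ 4" where "A = (\<chi> p k. vec (T (e k)) $ p)"
  have A: "A *v x = vec (tau (\<lambda>k. x $ k))" for x
    by (simp add: vec_eq_iff forall_4 matrix_vector_mult_def A_def vec_sel tau_def m2_sel_sum mult.commute)
  have "\<exists>x. A *v x = y" for y
  proof -
    obtain x where "tau x = M2 (y $ 1) (y $ 2) (y $ 3) (y $ 4)" using tau_surj by blast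
    then have "A *v (\<chi> k. x k) = y" by (simp add: A vec_eq_iff forall_4 vec_sel)
    then show ?thesis by blast
  qed
  then obtain D where D: "D ** A = mat 1" using surj_matrix_inverse by metis
  have "x k = D $ k $ 1 * m11 (tau x) + D $ k $ 2 * m12 (tau x) + D $ k $ 3 * m21 (tau x) + D $ k $ 4 * m22 (tau x)" for x k
  proof -
    have "D *v (A *v (\<chi> k. x k)) = (\<chi> k. x k)" by (simp add: matrix_vector_mul_assoc D)
    then have "x k = (D *v vec (tau x)) $ k" by (simp add: A)
    then show ?thesis by (simp add: matrix_vector_mult_def sum_4 vec_sel)
  qed
  then show ?thesis by blast
qed

lemma tau_inject: "tau x = tau y \<longleftrightarrow> x = y"
  using tau_inverse by (metis ext)

definition toM :: "(2 \<times> 2 \<times> 4 \<Rightarrow> 'a alg_closure) \<Rightarrow> 'a alg_closure m2 m2" where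
  "toM M = M2 (tau (entry M 1 1)) (tau (entry M 1 2)) (tau (entry M 2 1)) (tau (entry M 2 2))"

lemma toM_inject: "toM M = toM N \<longleftrightarrow> M = N"
proof
  assume "toM M = toM N"
  then have "entry M i j = entry N i j" for i j
    using exhaust_2[of i] exhaust_2[of j] by (auto simp: toM_def tau_inject)
  then show "M = N" unfolding entry_def fun_eq_iff by auto
qed simp

lemma toM_surj: "\<exists>M. toM M = X'"
proof -
  obtain x y z w where "tau x = m11 X'" "tau y = m12 X'" "tau z = m21 X'" "tau w = m22 X'"
    using tau_surj by metis
  then have "toM (\<lambda>(i, j, k). if i = 1 then if j = 1 then x k else y k else if j = 1 then z k else w k) = X'"
    by (simp add: toM_def entry_def m2_eq_iff)
  then show ?thesis by blast
qed

lemma entry_mult: "entry (mat2_mult scl e M N) i j =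
    (\<lambda>k. HK_mult scl e (entry M i 1) (entry N 1 j) k + HK_mult scl e (entry M i 2) (entry N 2 j) k)"
  by (simp add: entry_def mat2_mult_def sum_2)

lemma toM_mult: "toM (mat2_mult scl e M N) = toM M * toM N"
  by (simp add: toM_def entry_mult tau_add tau_mult)

lemma toM_1: "toM (mat2_one scl e) = 1"
proof -
  have "entry (mat2_one scl e) i j = (if i = j then HK_embed scl e 1 else (\<lambda>k. 0))" for i j
    by (auto simp: entry_def mat2_one_def)
  then show ?thesis by (simp add: toM_def tau_embed T_1 tau_0 m2_eq_iff)
qed

lemma toM_hat: "toM (mat2_hat scl e dag M) = hat (toM M)"
proof -
  have "entry (mat2_hat scl e dag M) 1 1 = HK_linear scl e dag (entry M 2 2)"
    "entry (mat2_hat scl e dag M) 2 2 = HK_linear scl e dag (entry M 1 1)"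
    "entry (mat2_hat scl e dag M) 1 2 = (\<lambda>k. - HK_linear scl e dag (entry M 1 2) k)"
    "entry (mat2_hat scl e dag M) 2 1 = (\<lambda>k. - HK_linear scl e dag (entry M 2 1) k)"
    by (simp_all add: entry_def mat2_hat_def)
  then show ?thesis by (simp add: toM_def hat_def tau_dag tau_minus)
qed

abbreviation G :: "(2 \<times> 2 \<times> 4 \<Rightarrow> 'a alg_closure) monoid" where "G \<equiv> SL_dag scl e dag"

lemma carrier_G: "carrier G = {M. toM M \<in> sp}"
  by (simp add: SL_dag_def sp_def toM_hat toM_mult toM_1 flip: toM_inject)

lemma mult_G [simp]: "M \<otimes>\<^bsub>G\<^esub> N = mat2_mult scl e M N" and one_G [simp]: "\<one>\<^bsub>G\<^esub> = mat2_one scl e"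
  by (simp_all add: SL_dag_def)

lemma mat2_hat_inverse:
  assumes "M \<in> carrier G"
  shows "mat2_hat scl e dag M \<in> carrier G" "mat2_mult scl e (mat2_hat scl e dag M) M = mat2_one scl e"
  using assms by (simp_all add: carrier_G toM_hat toM_mult toM_1 sp_hat two_ac sp_hat_left flip: toM_inject)

lemma group_G: "group G"
proof (rule groupI)
  fix x y z assume "x \<in> carrier G" "y \<in> carrier G" "z \<in> carrier G"
  then show "x \<otimes>\<^bsub>G\<^esub> y \<in> carrier G" by (simp add: carrier_G toM_mult sp_mult)
  show "x \<otimes>\<^bsub>G\<^esub> y \<otimes>\<^bsub>G\<^esub> z = x \<otimes>\<^bsub>G\<^esub> (y \<otimes>\<^bsub>G\<^esub> z)"
    by (simp add: toM_mult mult.assoc flip: toM_inject)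
next
  fix x assume "x \<in> carrier G"
  then show "\<exists>y\<in>carrier G. y \<otimes>\<^bsub>G\<^esub> x = \<one>\<^bsub>G\<^esub>" using mat2_hat_inverse by auto
qed (simp_all add: carrier_G toM_1 toM_mult flip: toM_inject)

lemma inv_G: "M \<in> carrier G \<Longrightarrow> inv\<^bsub>G\<^esub> M = mat2_hat scl e dag M"
  using group.inv_equality[OF group_G, of "mat2_hat scl e dag M" M] mat2_hat_inverse by simp

section \<open>The parametrization of the group over \<open>F\<close>\<close>

section \<open>Regular maps over the ground field\<close>

lemma C_closed: "0 \<in> C" "1 \<in> C" "- 1 \<in> C"
  by (rule range_to_ac_closed)+

lemma polyfun_HK_mult:
  assumes "\<And>k. (\<lambda>x. f x k) \<in> polyfun C" "\<And>k. (\<lambda>x. g x k) \<in> polyfun C"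
  shows "(\<lambda>x. HK_mult scl e (f x) (g x) k) \<in> polyfun C"
  unfolding HK_mult_def HK_embed_def
  by (intro polyfun_sum polyfun.mult polyfun.const C_closed assms rangeI)

lemma polyfun_HK_linear:
  assumes "\<And>k. (\<lambda>x. f x k) \<in> polyfun C"
  shows "(\<lambda>x. HK_linear scl e h (f x) k) \<in> polyfun C"
  unfolding HK_linear_def HK_embed_def
  by (intro polyfun_sum polyfun.mult polyfun.const C_closed assms rangeI)

lemma polyfun_mat2_mult:
  assumes "\<And>v. (\<lambda>x. f x v) \<in> polyfun C" "\<And>v. (\<lambda>x. g x v) \<in> polyfun C"
  shows "(\<lambda>x. mat2_mult scl e (f x) (g x) v) \<in> polyfun C"
proof (cases v)
  case (fields i j k)
  then show ?thesis unfolding mat2_mult_def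
    by (simp, intro polyfun_sum C_closed polyfun_HK_mult) (simp_all add: entry_def assms)
qed

lemma polyfun_mat2_hat:
  assumes "\<And>v. (\<lambda>x. f x v) \<in> polyfun C"
  shows "(\<lambda>x. mat2_hat scl e dag (f x) v) \<in> polyfun C"
proof (cases v)
  case (fields i j k)
  have "(\<lambda>x. HK_linear scl e dag (entry (f x) i j) k) \<in> polyfun C" for i j k
    by (rule polyfun_HK_linear) (simp add: entry_def assms)
  moreover from this have "(\<lambda>x. - HK_linear scl e dag (entry (f x) i j) k) \<in> polyfun C" for i j k
    by (rule polyfun_uminus[OF C_closed(3)])
  ultimately show ?thesis unfolding mat2_hat_def fields
    using exhaust_2[of i] exhaust_2[of j] by (elim disjE) simp_all
qed

text \<open>Symmetric parameters are obtained as \<open>x + dag x\<close> from arbitrary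
  \<open>x\<close>, so the parameter space is an affine space and the formula has coefficients in
  \<open>F\<close>.\<close>

definition unip :: "bool \<Rightarrow> (4 \<Rightarrow> 'a alg_closure) \<Rightarrow> 2 \<times> 2 \<times> 4 \<Rightarrow> 'a alg_closure" where
  "unip top_right x = (\<lambda>(i, j, k). if i = j then HK_embed scl e 1 k
     else if i = (if top_right then 1 else 2) then x k + HK_linear scl e dag x k else 0)"

lemma toM_unip: "toM (unip True x) = upper (tau x + tp (tau x))" "toM (unip False x) = lower (tau x + tp (tau x))"
  by (simp_all add: toM_def unip_def entry_def m2_eq_iff tau_add tau_0 tau_dag tau_embed[of 1, simplified] T_1)

lemma polyfun_unip:
  assumes "\<And>k. (\<lambda>x. f x k) \<in> polyfun C"
  shows "(\<lambda>x. unip top_right (f x) v) \<in> polyfun C"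
proof -
  have "(\<lambda>x. f x k + HK_linear scl e dag (f x) k) \<in> polyfun C" for k
    by (intro polyfun.add polyfun_HK_linear assms)
  moreover have "(\<lambda>_. HK_embed scl e 1 k) \<in> polyfun C" for k
    unfolding HK_embed_def by (intro polyfun.const rangeI)
  moreover obtain i j k where "v = (i, j, k)" by (cases v)
  ultimately show ?thesis unfolding unip_def using polyfun.const[OF C_closed(1)]
    exhaust_2[of i] exhaust_2[of j] by (elim disjE; cases top_right) simp_all
qed

definition psi :: "(5 \<times> 4 \<Rightarrow> 'a alg_closure) \<Rightarrow> 2 \<times> 2 \<times> 4 \<Rightarrow> 'a alg_closure" where
  "psi u = mat2_mult scl e (mat2_mult scl e (mat2_mult scl e (mat2_mult scl e
     (unip False (\<lambda>k. u (1, k))) (unip True (\<lambda>k. u (2, k)))) (unip False (\<lambda>k. u (3, k))))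
     (unip True (\<lambda>k. u (4, k)))) (unip False (\<lambda>k. u (5, k)))"

lemma polyfun_psi: "(\<lambda>u. psi u v) \<in> polyfun C"
  unfolding psi_def by (intro polyfun_mat2_mult polyfun_unip polyfun.coord)

lemma range_psi: "range psi = carrier G"
proof
  have s: "symm (m + tp m)" for m :: "'a alg_closure m2" by (simp add: symm_iff add.commute)
  show "range psi \<subseteq> carrier G"
    by (auto simp: carrier_G psi_def toM_mult toM_unip intro!: sp_mult sp_upper sp_lower s)
  show "carrier G \<subseteq> range psi"
  proof
    fix M assume "M \<in> carrier G"
    then obtain s1 s2 s3 s4 s5 where s: "symm s1" "symm s2" "symm s3" "symm s4" "symm s5"
      and M: "toM M = lower s1 * upper s2 * lower s3 * upper s4 * lower s5"
      using sp_factorization[OF two_ac, of "toM M"] by (auto simp: carrier_G)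
    have half: "\<exists>x. tau x + tp (tau x) = s" if "symm s" for s
    proof -
      \<comment> \<open>Half of a symmetric matrix symmetrizes to the matrix itself, as 2 is
        invertible.\<close>
      obtain x where x: "tau x = scal (1 / 2) * s" using tau_surj by blast
      have "tau x + tp (tau x) = s"
        using that two_ac unfolding x by (simp add: symm_iff m2_eq_iff)
      then show ?thesis by blast
    qed
    obtain x1 x2 x3 x4 x5 where "tau x1 + tp (tau x1) = s1" "tau x2 + tp (tau x2) = s2"
      "tau x3 + tp (tau x3) = s3" "tau x4 + tp (tau x4) = s4" "tau x5 + tp (tau x5) = s5"
      using half s by metis
    then have "toM (psi (\<lambda>(i, k). if i = 1 then x1 k else if i = 2 then x2 k else if i = 3 then x3 k
        else if i = 4 then x4 k else x5 k)) = toM M"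
      by (simp add: psi_def toM_mult toM_unip M)
    from this[unfolded toM_inject, symmetric] show "M \<in> range psi" by (rule range_eqI[where f = psi])
  qed
qed

lemma psi_0: "psi (\<lambda>_. 0) = mat2_one scl e"
  by (simp add: psi_def toM_mult toM_unip toM_1 tau_0 m2_eq_iff flip: toM_inject)

lemma algebraic_group_G: "algebraic_group C G"
  unfolding algebraic_group_def
proof (intro conjI)
  show "group G" by (rule group_G)
  let ?E = "range (\<lambda>v M. mat2_mult scl e M (mat2_hat scl e dag M) v - mat2_one scl e v)"
  have h: "(\<lambda>M. mat2_mult scl e M (mat2_hat scl e dag M) v) \<in> polyfun C" for v
    by (intro polyfun_mat2_mult polyfun_mat2_hat polyfun.coord)
  have "(\<lambda>M. mat2_mult scl e M (mat2_hat scl e dag M) v - mat2_one scl e v) \<in> polyfun UNIV" for v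
    by (rule polyfun_diff[OF _ polyfun_mono[OF subset_UNIV h] polyfun.const]) auto
  then have "?E \<subseteq> polyfun UNIV" by blast
  moreover have "carrier G = zero_set ?E"
    by (auto simp: SL_dag_def zero_set_def fun_eq_iff)
  \<comment> \<open>Equations over \<open>F\<close> by themselves would not show that the full
    vanishing ideal is generated over \<open>F\<close>; the parametrization does.\<close>
  moreover have "carrier G = (\<Union>i::unit. range psi)" by (simp add: range_psi)
  ultimately show "defined_over C (carrier G)"
    using polyfun_psi by (intro defined_over_images[where \<psi> = "\<lambda>_. psi"])
  show "regular_on C {case_sum x y |x y. x \<in> carrier G \<and> y \<in> carrier G}
      (\<lambda>z. (z \<circ> Inl) \<otimes>\<^bsub>G\<^esub> (z \<circ> Inr))"
    by (rule regular_onI[where g = "\<lambda>z. mat2_mult scl e (\<lambda>v. z (Inl v)) (\<lambda>v. z (Inr v))"])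
       (intro polyfun_mat2_mult polyfun.coord, simp add: comp_def)
  show "regular_on C (carrier G) (\<lambda>x. inv\<^bsub>G\<^esub> x)"
    by (rule regular_onI[where g = "mat2_hat scl e dag"])
       (intro polyfun_mat2_hat polyfun.coord, rule inv_G)
qed

end



section \<open>Comparison of \<open>q_H\<close> with the split form\<close>

section \<open>The orthogonal group and its identity component\<close>

lemma to_mat_of_mat [simp]: "to_mat (of_mat A) = A" and of_mat_to_mat [simp]: "of_mat (to_mat g) = g"
  by (simp_all add: to_mat_def of_mat_def vec_eq_iff fun_eq_iff)

lemma qf_eq_bf: "2 * qf v = bf v v" for v :: "'k::comm_ring_1 ^ 5"
  by (simp add: qf_def bf_def algebra_simps)

lemma bf_sum: "bf (\<Sum>i\<in>A. x i *s u i) (\<Sum>j\<in>B. y j *s w j) = (\<Sum>i\<in>A. \<Sum>j\<in>B. bf (u i) (w j) * x i * y j)"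
  for u w :: "'i \<Rightarrow> 'k::comm_ring_1 ^ 5"
proof -
  have prod: "(\<Sum>i\<in>A. x i * f i) * (\<Sum>j\<in>B. y j * g j) = (\<Sum>i\<in>A. \<Sum>j\<in>B. f i * g j * x i * y j)" for f g
    unfolding sum_product by (intro sum.cong refl) (simp add: algebra_simps)
  show ?thesis
    unfolding bf_def sum_component vector_smult_component prod
    by (simp add: algebra_simps sum.distrib sum_subtractf sum_distrib_left)
qed

context split_setting
begin

lemma T_sel_simps: "m11 (T (scl c h)) = to_ac c * m11 (T h)" "m12 (T (scl c h)) = to_ac c * m12 (T h)"
  "m21 (T (scl c h)) = to_ac c * m21 (T h)" "m22 (T (scl c h)) = to_ac c * m22 (T h)"
  by (simp_all add: T_scale)

text \<open>The entry \<open>m21 (T h)\<close> is left out because \<open>T h\<close> is symmetric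
  for \<open>h\<close> in \<open>Hplus dag\<close>, the only case in which the vector is meant to
  represent \<open>h\<close>.\<close>

definition vecT :: "'a \<times> 'a \<times> 'h \<Rightarrow> 'a alg_closure ^ 5" where
  "vecT = (\<lambda>(s, t, h). vec5 (to_ac s) (to_ac t) (m11 (T h)) (m12 (T h)) (m22 (T h)))"

lemma vecT_add: "vecT (w + w') = vecT w + vecT w'"
  by (cases w; cases w') (simp add: vecT_def vec5_eq_iff T_add)

lemma vecT_scale: "vecT (scale_FFH scl c w) = to_ac c *s vecT w"
  by (cases w) (simp add: vecT_def scale_FFH_def vec5_eq_iff T_sel_simps)

lemma vecT_0: "vecT 0 = 0"
  by (simp add: vecT_def zero_prod_def vec5_eq_iff T_0)

lemma vecT_sum: "vecT (sum f A) = (\<Sum>i\<in>A. vecT (f i))"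
  by (induction A rule: infinite_finite_induct) (simp_all add: vecT_0 vecT_add)

abbreviation W :: "('a \<times> 'a \<times> 'h) set" where "W \<equiv> UNIV \<times> UNIV \<times> Hplus dag"

definition coordb :: "'a \<times> 'a \<times> 'h \<Rightarrow> 5 \<Rightarrow> 'a alg_closure" where
  "coordb w j = to_ac (coords (scale_FFH scl) b w j)"

lemma vecT_coordb: "w \<in> W \<Longrightarrow> (\<Sum>j\<in>UNIV. coordb w j *s vecT (b j)) = vecT w"
  unfolding coordb_def vecT_scale[symmetric] vecT_sum[symmetric]
  using vector_space.is_basis_sum_coords[OF vector_space_FFH b] by simp

lemma b_in_W: "b j \<in> W"
proof -
  have "range b \<subseteq> module.span (scale_FFH scl) (range b)"
    by (rule module.span_superset) (simp add: module_iff_vector_space vector_space_FFH)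
  then show ?thesis using b unfolding is_basis_def by blast
qed

text \<open>The change of coordinates from the basis \<open>b\<close> to the split
  coordinates.\<close>

definition P :: "'a alg_closure ^ 5 ^ 5" where "P = (\<chi> r j. vecT (b j) $ r)"

lemma P_apply: "P *v x = (\<Sum>j\<in>UNIV. x $ j *s vecT (b j))"
  by (simp add: vec_eq_iff matrix_vector_mult_def P_def mult.commute)

definition sym_part :: "'h \<Rightarrow> 'h" where "sym_part h = scl (1 / 2) (h + dag h)"

lemma sym_part: "sym_part h \<in> Hplus dag" "T (sym_part h) = scal (1 / 2) * (T h + tp (T h))"
  by (simp_all add: sym_part_def Hplus_def dag_scale dag_add dag_dag add.commute T_scale T_add T_dag)

text \<open>A symmetric matrix is a \<open>K\<close>-combination of values of \<open>T\<close>;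
  symmetrizing the combination replaces the arguments by elements of \<open>Hplus dag\<close>, which
  \<open>b\<close> spans.\<close>

lemma P_surj: "\<exists>x. P *v x = y"
proof -
  have lin: "\<exists>x. P *v x = p + q" if "\<exists>x. P *v x = p" "\<exists>x. P *v x = q" for p q
    using that by (metis matrix_vector_right_distrib)
  have W: "\<exists>x. P *v x = c *s vecT w" if "w \<in> W" for c w
  proof -
    have "P *v (\<chi> j. c * coordb w j) = c *s (\<Sum>j\<in>UNIV. coordb w j *s vecT (b j))"
      by (simp add: P_apply vec_eq_iff sum_distrib_left mult.assoc)
    then show ?thesis using vecT_coordb[OF that] by metis
  qed
  define m where "m = M2 (y $ 3) (y $ 4) (y $ 4) (y $ 5)"
  obtain k1 k2 k3 k4 x1 x2 x3 x4 where
    m: "m = scal k1 * T x1 + scal k2 * T x2 + scal k3 * T x3 + scal k4 * T x4" using T_span by blast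
  have "m11 m = y $ 3" "m12 m + m21 m = y $ 4 + y $ 4" "m22 m = y $ 5" by (simp_all add: m_def)
  then have y_eq: "y = y $ 1 *s vecT (1, 0, 0) + y $ 2 *s vecT (0, 1, 0) + k1 *s vecT (0, 0, sym_part x1) +
      k2 *s vecT (0, 0, sym_part x2) + k3 *s vecT (0, 0, sym_part x3) + k4 *s vecT (0, 0, sym_part x4)"
    using two_ac unfolding m
    by (simp add: vec5_eq_iff vecT_def sym_part T_0) (simp add: field_simps)
  have "(1, 0, 0) \<in> W" "(0, 1, 0) \<in> W" "(0, 0, sym_part h) \<in> W" for h
    using sym_part by (simp_all add: Hplus_def dag_diff[of 0 0, simplified])
  then show ?thesis by (subst y_eq) (intro lin W)
qed

definition Pinv :: "'a alg_closure ^ 5 ^ 5" where "Pinv = (SOME B. P ** B = mat 1 \<and> B ** P = mat 1)"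

lemma P_Pinv: "P ** Pinv = mat 1" "Pinv ** P = mat 1"
proof -
  have "\<exists>B. P ** B = mat 1 \<and> B ** P = mat 1" using surj_matrix_inverse[OF P_surj] by metis
  then have "P ** Pinv = mat 1 \<and> Pinv ** P = mat 1" unfolding Pinv_def by (rule someI_ex)
  then show "P ** Pinv = mat 1" "Pinv ** P = mat 1" by simp_all
qed

lemma to_ac_nrm: "to_ac (nrm scl bar h) = det2 (T h)"
proof -
  obtain c where c: "h * bar h = scl c 1" using bar_standard by blast
  have "nrm scl bar h = c" unfolding nrm_def c by (rule the_equality) (auto dest: scale_one_inject)
  moreover have "scal (to_ac c) = scal (det2 (T h))"
    using arg_cong[OF c, of T] by (simp add: T_mult T_bar T_scale T_1 adj_mult_self)
  ultimately show ?thesis by (simp add: m2_eq_iff)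
qed

lemma to_ac_q: "w \<in> W \<Longrightarrow> to_ac (q_H scl bar w) = qf (vecT w)"
proof -
  assume "w \<in> W"
  then obtain s t h where w: "w = (s, t, h)" and h: "dag h = h" by (auto simp: Hplus_def)
  have "m12 (T h) = m21 (T h)" using T_dag[of h] h by (metis tp_sel(2))
  then show ?thesis by (simp add: w q_H_def vecT_def qf_def to_ac_nrm det2_def)
qed

lemma qform_ac_eq: "qform_ac (q_H scl bar) b v = qf (P *v v)"
proof -
  have W_add: "w + w' \<in> W" if "w \<in> W" "w' \<in> W" for w w'
    using that by (auto simp: Hplus_def dag_add)
  have "to_ac ((q_H scl bar (b i + b j) - q_H scl bar (b i) - q_H scl bar (b j)) / 2) = bf (vecT (b i)) (vecT (b j)) / 2" for i j
    using b_in_W[of i] b_in_W[of j] W_add[of "b i" "b j"] by (simp add: to_ac_q vecT_add qf_add)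
  then have "qform_ac (q_H scl bar) b v = (\<Sum>i\<in>UNIV. \<Sum>j\<in>UNIV. bf (vecT (b i)) (vecT (b j)) / 2 * v $ i * v $ j)"
    by (simp only: qform_ac_def)
  also have "\<dots> = bf (P *v v) (P *v v) / 2"
    unfolding P_apply bf_sum sum_divide_distrib by simp
  also have "\<dots> = qf (P *v v)" using two_ac by (simp flip: qf_eq_bf)
  finally show ?thesis .
qed

abbreviation ortho :: "(5 \<times> 5 \<Rightarrow> 'a alg_closure) monoid" where
  "ortho \<equiv> orthogonal_group_ac (q_H scl bar) b"

definition ortho_det :: "'a alg_closure \<Rightarrow> (5 \<times> 5 \<Rightarrow> 'a alg_closure) set" where
  "ortho_det d = {g. det (to_mat g) = d \<and>
     (\<forall>v. qform_ac (q_H scl bar) b (to_mat g *v v) = qform_ac (q_H scl bar) b v)}"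

lemma mult_ortho [simp]: "g \<otimes>\<^bsub>ortho\<^esub> h = of_mat (to_mat g ** to_mat h)"
  and one_ortho [simp]: "\<one>\<^bsub>ortho\<^esub> = of_mat (mat 1)"
  by (simp_all add: orthogonal_group_ac_def)

definition phi :: "(2 \<times> 2 \<times> 4 \<Rightarrow> 'a alg_closure) \<Rightarrow> 5 \<times> 5 \<Rightarrow> 'a alg_closure" where
  "phi M = of_mat (Pinv ** act_mat (toM M) ** P)"

lemma conj_P:
  "P *v ((Pinv ** A ** P) *v v) = A *v (P *v v)"
  "Pinv ** (P ** B ** Pinv) ** P = B"
proof -
  have "P ** (Pinv ** A ** P) = (P ** Pinv) ** A ** P" by (simp only: matrix_mul_assoc)
  then show "P *v ((Pinv ** A ** P) *v v) = A *v (P *v v)"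
    by (simp add: matrix_vector_mul_assoc P_Pinv)
  have "Pinv ** (P ** B ** Pinv) ** P = (Pinv ** P) ** B ** (Pinv ** P)" by (simp only: matrix_mul_assoc)
  then show "Pinv ** (P ** B ** Pinv) ** P = B" by (simp add: P_Pinv)
qed

lemma det_conj_P: "det (Pinv ** A ** P) = det A" "det (P ** A ** Pinv) = det A"
proof -
  have "det Pinv * det P = 1" using arg_cong[OF P_Pinv(2), of det] by (simp add: det_mul)
  then show "det (Pinv ** A ** P) = det A" "det (P ** A ** Pinv) = det A"
    by (simp_all add: det_mul mult.commute mult.left_commute)
qed

lemma phi_image: "phi ` carrier G = ortho_det 1"
proof
  show "phi ` carrier G \<subseteq> ortho_det 1"
    by (auto simp: phi_def ortho_det_def det_conj_P carrier_G det_act_mat two_ac qform_ac_eq conj_P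
        act_mat_apply qf_act)
  show "ortho_det 1 \<subseteq> phi ` carrier G"
  proof
    fix g assume g: "g \<in> ortho_det 1"
    define g' where "g' = P ** to_mat g ** Pinv"
    have g_eq: "to_mat g = Pinv ** g' ** P" unfolding g'_def conj_P ..
    have "qf (g' *v v) = qf v" for v
    proof -
      have v: "v = P *v (Pinv *v v)" by (simp add: matrix_vector_mul_assoc P_Pinv)
      have "g' *v v = P *v (to_mat g *v (Pinv *v v))" unfolding g_eq conj_P(1) by (simp flip: v)
      then show ?thesis using g v by (metis (mono_tags, lifting) mem_Collect_eq ortho_det_def qform_ac_eq)
    qed
    moreover have "det g' = 1" using g by (simp add: g'_def det_conj_P ortho_det_def)
    moreover have "(1 :: 'a alg_closure) \<noteq> - 1" using two_ac by (simp add: eq_neg_iff_add_eq_0)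
    ultimately obtain N where N: "N \<in> sp" "g' = act_mat N" using preserves_qf_cases[OF two_ac] by metis
    obtain M where "toM M = N" using toM_surj by blast
    then have "g = phi M" "M \<in> carrier G" using N g_eq of_mat_to_mat[of g] by (simp_all add: phi_def carrier_G)
    then show "g \<in> phi ` carrier G" by (rule image_eqI)
  qed
qed

text \<open>Conjugation by \<open>P\<close> turns an isometry of \<open>q_H\<close> into one of
  \<open>qf\<close>, and those either come from the group, with determinant 1, or have determinant
  -1.\<close>

lemma carrier_ortho: "carrier ortho = ortho_det 1 \<union> ortho_det (- 1)"
proof
  show "ortho_det 1 \<union> ortho_det (- 1) \<subseteq> carrier ortho"
    by (auto simp: ortho_det_def orthogonal_group_ac_def invertible_det_nz)
  show "carrier ortho \<subseteq> ortho_det 1 \<union> ortho_det (- 1)"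
  proof
    fix g assume "g \<in> carrier ortho"
    then have g: "qform_ac (q_H scl bar) b (to_mat g *v v) = qform_ac (q_H scl bar) b v" for v
      by (simp add: orthogonal_group_ac_def)
    define g' where "g' = P ** to_mat g ** Pinv"
    have g_eq: "to_mat g = Pinv ** g' ** P" unfolding g'_def conj_P ..
    have "qf (g' *v v) = qf v" for v
    proof -
      have v: "v = P *v (Pinv *v v)" by (simp add: matrix_vector_mul_assoc P_Pinv)
      have "g' *v v = P *v (to_mat g *v (Pinv *v v))" unfolding g_eq conj_P(1) by (simp flip: v)
      then show ?thesis using g v by (metis qform_ac_eq)
    qed
    then have "det g' = 1 \<or> det g' = - 1"
      using preserves_qf_cases[OF two_ac, of g'] det_act_mat[OF two_ac] by blast
    then show "g \<in> ortho_det 1 \<union> ortho_det (- 1)"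
      using g by (auto simp: g'_def det_conj_P ortho_det_def)
  qed
qed

lemma ortho_det_closed: "\<exists>E \<subseteq> polyfun UNIV. ortho_det d = zero_set E"
proof -
  let ?f = "\<lambda>v g. qform_ac (q_H scl bar) b (to_mat g *v v) - qform_ac (q_H scl bar) b v"
  have c: "(\<lambda>g. (to_mat g *v v) $ i) \<in> polyfun UNIV" for v :: "'a alg_closure ^ 5" and i
    unfolding matrix_vector_mult_def to_mat_def
    by (simp, intro polyfun_sum polyfun.mult polyfun.coord polyfun.const) auto
  have "?f v \<in> polyfun UNIV" for v
    unfolding qform_ac_def
    by (intro polyfun_diff polyfun_sum polyfun.mult polyfun.const c) auto
  moreover have "(\<lambda>g. det (to_mat g) - d) \<in> polyfun UNIV"
    by (intro polyfun_diff polyfun_det polyfun.const) (auto simp: to_mat_def intro: polyfun.coord)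
  ultimately have "insert (\<lambda>g. det (to_mat g) - d) (range ?f) \<subseteq> polyfun UNIV" by blast
  moreover have "ortho_det d = zero_set (insert (\<lambda>g. det (to_mat g) - d) (range ?f))"
    by (auto simp: ortho_det_def zero_set_def)
  ultimately show ?thesis by blast
qed

section \<open>The homomorphism is defined over the ground field\<close>

text \<open>The \<open>F\<close>-linear projection of \<open>H\<close> onto its scalars; it is
  determined by the condition since 2 is invertible.\<close>

definition half_trace :: "'h \<Rightarrow> 'a" where "half_trace h = (SOME c. h + bar h = scl (2 * c) 1)"

lemma half_trace: "m11 (T h) + m22 (T h) = 2 * to_ac (half_trace h)"
proof -
  obtain t where "h + bar h = scl t 1" using trace_scalar by blast
  then have "h + bar h = scl (2 * (t / 2)) 1" using two by simp
  then have "h + bar h = scl (2 * half_trace h) 1" unfolding half_trace_def by (rule someI)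
  then have "T (h + bar h) = T (scl (2 * half_trace h) 1)" by simp
  then show ?thesis by (simp add: T_add T_bar T_scale T_1 m2_eq_iff)
qed

definition herm_point :: "'a \<times> 'a \<times> 'h \<Rightarrow> 2 \<times> 2 \<times> 4 \<Rightarrow> 'a alg_closure" where
  "herm_point w = (\<lambda>(i, j, k). HK_embed scl e
     (if i = 1 then if j = 1 then scl (fst w) 1 else snd (snd w)
      else if j = 1 then bar (snd (snd w)) else scl (fst (snd w)) 1) k)"

lemma toM_herm_point: "w \<in> W \<Longrightarrow> toM (herm_point w) = herm (vecT w)"
proof -
  assume "w \<in> W"
  then obtain s t h where w: "w = (s, t, h)" and h: "dag h = h" by (auto simp: Hplus_def)
  have "m12 (T h) = m21 (T h)" using T_dag[of h] h by (metis tp_sel(2))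
  moreover have "entry (herm_point w) 1 1 = HK_embed scl e (scl s 1)" "entry (herm_point w) 1 2 = HK_embed scl e h"
    "entry (herm_point w) 2 1 = HK_embed scl e (bar h)" "entry (herm_point w) 2 2 = HK_embed scl e (scl t 1)"
    by (simp_all add: entry_def herm_point_def w)
  ultimately show ?thesis
    by (simp add: toM_def tau_embed w herm_def vecT_def T_scale T_1 T_bar m2_eq_iff)
qed

definition star_point :: "(2 \<times> 2 \<times> 4 \<Rightarrow> 'a alg_closure) \<Rightarrow> 2 \<times> 2 \<times> 4 \<Rightarrow> 'a alg_closure" where
  "star_point M = (\<lambda>(i, j, k). HK_linear scl e bar (entry M j i) k)"

lemma toM_star_point: "toM (star_point M) = star (toM M)"
proof -
  have "entry (star_point M) i j = HK_linear scl e bar (entry M j i)" for i j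
    by (simp add: entry_def star_point_def)
  then show ?thesis by (simp add: toM_def star_def tau_bar)
qed

definition act_point :: "(2 \<times> 2 \<times> 4 \<Rightarrow> 'a alg_closure) \<Rightarrow> 'a \<times> 'a \<times> 'h \<Rightarrow> 2 \<times> 2 \<times> 4 \<Rightarrow> 'a alg_closure" where
  "act_point M w = mat2_mult scl e (mat2_mult scl e M (herm_point w)) (star_point M)"

lemma toM_act_point:
  assumes "M \<in> carrier G" "w \<in> W"
  shows "toM (act_point M w) = herm (act (toM M) (vecT w))"
  using assms by (simp add: act_point_def toM_mult toM_herm_point toM_star_point carrier_G herm_act two_ac)

lemma polyfun_act_point: "(\<lambda>M. act_point M w v) \<in> polyfun C"
proof -
  have "(\<lambda>M. HK_linear scl e bar (entry M j i) k) \<in> polyfun C" for i j k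
    by (rule polyfun_HK_linear) (simp add: entry_def polyfun.coord)
  then have "(\<lambda>M. star_point M v) \<in> polyfun C" for v
    by (cases v) (simp add: star_point_def)
  moreover have "(\<lambda>M. herm_point w v) \<in> polyfun C" for v
    by (rule polyfun.const) (cases v, simp add: herm_point_def HK_embed_def)
  ultimately show ?thesis unfolding act_point_def by (intro polyfun_mat2_mult polyfun.coord)
qed

text \<open>Reads the coordinates in the basis \<open>b\<close> off a hermitian matrix, by
  \<open>half_trace\<close> on the diagonal and \<open>sym_part\<close> off it. Both are
  \<open>F\<close>-linear projections, so the coefficients lie in \<open>F\<close>, whereas
  \<open>P\<close> and \<open>T\<close> have entries in \<open>K\<close> only.\<close>

definition act_coord :: "(2 \<times> 2 \<times> 4 \<Rightarrow> 'a alg_closure) \<Rightarrow> 'a \<times> 'a \<times> 'h \<Rightarrow> 5 \<Rightarrow> 'a alg_closure" where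
  "act_coord M w i = (\<Sum>k\<in>UNIV. act_point M w (1, 1, k) * coordb (half_trace (e k), 0, 0) i +
     act_point M w (2, 2, k) * coordb (0, half_trace (e k), 0) i +
     act_point M w (1, 2, k) * coordb (0, 0, sym_part (e k)) i)"

lemma polyfun_act_coord: "(\<lambda>M. act_coord M w i) \<in> polyfun C"
  unfolding act_coord_def
  by (intro polyfun_sum polyfun.add polyfun.mult polyfun_act_point polyfun.const C_closed)
     (simp_all add: coordb_def)

lemma act_coord:
  assumes "M \<in> carrier G" "w \<in> W"
  shows "P *v (\<chi> i. act_coord M w i) = act (toM M) (vecT w)"
proof -
  define y where "y i j k = act_point M w (i, j, k)" for i j k
  define v where "v = act (toM M) (vecT w)"
  have y: "y i j = entry (act_point M w) i j" for i j
    by (simp add: y_def entry_def fun_eq_iff)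
  have "herm v = toM (act_point M w)" using toM_act_point[OF assms] by (simp add: v_def)
  then have v: "tau (y 1 1) = scal (v $ 1)" "tau (y 2 2) = scal (v $ 2)"
    "tau (y 1 2) = M2 (v $ 3) (v $ 4) (v $ 4) (v $ 5)"
    unfolding y by (simp_all add: toM_def herm_def)
  have 0: "0 \<in> Hplus dag" using dag_diff[of 0 0] by (simp add: Hplus_def)
  have "P *v (\<chi> i. act_coord M w i) = (\<Sum>k\<in>UNIV. y 1 1 k *s (\<Sum>i\<in>UNIV. coordb (half_trace (e k), 0, 0) i *s vecT (b i)) +
     y 2 2 k *s (\<Sum>i\<in>UNIV. coordb (0, half_trace (e k), 0) i *s vecT (b i)) +
     y 1 2 k *s (\<Sum>i\<in>UNIV. coordb (0, 0, sym_part (e k)) i *s vecT (b i)))"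
    unfolding P_apply vec_eq_iff
    by (simp add: act_coord_def y_def sum_distrib_left sum_distrib_right sum.distrib distrib_right mult.assoc
        sum.swap[of _ "UNIV :: 4 set" "UNIV :: 5 set"])
  also have "\<dots> = (\<Sum>k\<in>UNIV. y 1 1 k *s vecT (half_trace (e k), 0, 0) + y 2 2 k *s vecT (0, half_trace (e k), 0) +
     y 1 2 k *s vecT (0, 0, sym_part (e k)))"
    using 0 sym_part(1) by (simp add: vecT_coordb)
  also have "\<dots> = v"
  proof -
    have tr: "(\<Sum>k\<in>UNIV. x k * to_ac (half_trace (e k))) = (m11 (tau x) + m22 (tau x)) / 2" for x
    proof -
      have "to_ac (half_trace h) = (m11 (T h) + m22 (T h)) / 2" for h
        using half_trace[of h] two_ac by simp
      then show ?thesis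
        by (simp add: tau_def m2_sel_sum sum_divide_distrib distrib_left sum.distrib add_divide_distrib)
    qed
    have s: "(\<Sum>k\<in>UNIV. scal (x k) * T (sym_part (e k))) = scal (1 / 2) * (tau x + tp (tau x))" for x
    proof -
      have "scal (x k) * (scal (1 / 2) * m) = scal (1 / 2) * (scal (x k) * m)" for k m
        by (simp add: m2_eq_iff)
      then show ?thesis
        by (simp add: tau_def sym_part(2) tp_sum tp_simps distrib_left sum.distrib sum_distrib_left)
    qed
    have "m11 (\<Sum>k\<in>UNIV. scal (y 1 2 k) * T (sym_part (e k))) = v $ 3"
      "m12 (\<Sum>k\<in>UNIV. scal (y 1 2 k) * T (sym_part (e k))) = v $ 4"
      "m22 (\<Sum>k\<in>UNIV. scal (y 1 2 k) * T (sym_part (e k))) = v $ 5"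
      unfolding s v using two_ac by simp_all
    then have "(\<Sum>k\<in>UNIV. y 1 2 k * m11 (T (sym_part (e k)))) = v $ 3"
      "(\<Sum>k\<in>UNIV. y 1 2 k * m12 (T (sym_part (e k)))) = v $ 4"
      "(\<Sum>k\<in>UNIV. y 1 2 k * m22 (T (sym_part (e k)))) = v $ 5"
      by (simp_all add: m2_sel_sum)
    moreover have "(\<Sum>k\<in>UNIV. y 1 1 k * to_ac (half_trace (e k))) = v $ 1"
      "(\<Sum>k\<in>UNIV. y 2 2 k * to_ac (half_trace (e k))) = v $ 2"
      unfolding tr v using two_ac by simp_all
    ultimately show ?thesis by (simp add: vec5_eq_iff vecT_def T_0)
  qed
  finally show ?thesis by (simp add: v_def)
qed

text \<open>The columns of \<open>phi M\<close> are the coordinates of the transformed basis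
  vectors. This formula makes no use of the splitting, so it shows that \<open>phi\<close> descends
  to \<open>F\<close>.\<close>

lemma phi_eq_act_coord:
  assumes "M \<in> carrier G"
  shows "phi M = (\<lambda>(i, j). act_coord M (b j) i)"
proof -
  have "phi M (i, j) = act_coord M (b j) i" for i j
  proof -
    have "phi M (i, j) = ((Pinv ** act_mat (toM M)) *v vecT (b j)) $ i"
      by (simp add: phi_def of_mat_def P_def matrix_matrix_mult_def[of _ "\<chi> r j. vecT (b j) $ r"] matrix_vector_mult_def)
    also have "\<dots> = (Pinv *v act (toM M) (vecT (b j))) $ i"
      by (simp add: act_mat_apply flip: matrix_vector_mul_assoc)
    also have "\<dots> = (Pinv *v (P *v (\<chi> i. act_coord M (b j) i))) $ i"
      by (simp only: act_coord[OF assms b_in_W])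
    finally show ?thesis by (simp add: matrix_vector_mul_assoc P_Pinv)
  qed
  then show ?thesis by (simp add: fun_eq_iff)
qed

lemma regular_phi: "regular_on C (carrier G) phi"
proof (rule regular_onI[OF _ phi_eq_act_coord])
  fix w :: "5 \<times> 5"
  show "(\<lambda>M. (\<lambda>(i, j). act_coord M (b j) i) w) \<in> polyfun C"
    by (cases w) (simp add: polyfun_act_coord)
qed

lemma polyfun_phi_psi: "(\<lambda>u. phi (psi u) w) \<in> polyfun C"
proof -
  obtain i j where w: "w = (i, j)" by (cases w)
  have "phi (psi u) w = act_coord (psi u) (b j) i" for u
  proof -
    have "psi u \<in> carrier G" using range_psi by blast
    from phi_eq_act_coord[OF this] show ?thesis by (simp add: w)
  qed
  then show ?thesis using polyfun_comp[OF polyfun_act_coord polyfun_psi] by simp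
qed

section \<open>The identity component as an algebraic group\<close>

abbreviation Q :: "(5 \<times> 5 \<Rightarrow> 'a alg_closure) monoid" where "Q \<equiv> identity_component ortho"

lemma phi_1: "phi (mat2_one scl e) = of_mat (mat 1)"
  by (simp add: phi_def toM_1 act_mat_1 P_Pinv)

lemma carrier_Q: "carrier Q = ortho_det 1"
proof -
  obtain D where D: "D \<subseteq> polyfun UNIV" "ortho_det 1 = zero_set D" using ortho_det_closed by blast
  obtain E where E: "E \<subseteq> polyfun UNIV" "ortho_det (- 1) = zero_set E" using ortho_det_closed by blast
  have range: "range (\<lambda>u. phi (psi u)) = ortho_det 1"
    unfolding phi_image[symmetric] range_psi[symmetric] by (simp add: image_image)
  have "(1 :: 'a alg_closure) \<noteq> - 1" using two_ac by (simp add: eq_neg_iff_add_eq_0)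
  then have disj: "ortho_det 1 \<inter> ortho_det (- 1) = {}" by (auto simp: ortho_det_def)
  have "connected_component_of_set (subtopology zariski (carrier ortho)) \<one>\<^bsub>ortho\<^esub> = range (\<lambda>u. phi (psi u))"
  proof (rule connected_component_of_zariski)
    show "(\<lambda>x. phi (psi x) v) \<in> polyfun UNIV" for v
      using polyfun_mono[OF subset_UNIV polyfun_phi_psi] .
    show "phi (psi (\<lambda>_. 0)) = \<one>\<^bsub>ortho\<^esub>" by (simp add: psi_0 phi_1)
    show "range (\<lambda>u. phi (psi u)) = zero_set D" by (simp add: range D(2))
    show "carrier ortho = zero_set D \<union> zero_set E" by (simp add: carrier_ortho D(2) E(2))
    show "zero_set D \<inter> zero_set E = {}" using disj by (simp add: D(2) E(2))
  qed (fact D E)+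
  then show ?thesis by (simp add: identity_component_def range)
qed

lemma mult_Q [simp]: "g \<otimes>\<^bsub>Q\<^esub> h = of_mat (to_mat g ** to_mat h)" and one_Q [simp]: "\<one>\<^bsub>Q\<^esub> = of_mat (mat 1)"
  by (simp_all add: identity_component_def)

lemma phi_mult: "M \<in> carrier G \<Longrightarrow> N \<in> carrier G \<Longrightarrow> phi (mat2_mult scl e M N) = of_mat (to_mat (phi M) ** to_mat (phi N))"
proof -
  assume "M \<in> carrier G" "N \<in> carrier G"
  have "(Pinv ** A ** P) ** (Pinv ** B ** P) = Pinv ** A ** (P ** Pinv) ** B ** P" for A B by (simp only: matrix_mul_assoc)
  then show ?thesis using \<open>N \<in> carrier G\<close>
    by (simp add: phi_def toM_mult act_mat_mult two_ac carrier_G P_Pinv matrix_mul_assoc)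
qed

lemma phi_hom: "phi \<in> hom G Q"
  using phi_mult phi_image by (auto simp: hom_def carrier_Q)

lemma group_Q: "group Q"
proof (rule groupI)
  fix x y z assume x: "x \<in> carrier Q" and y: "y \<in> carrier Q"
  then obtain M N where "x = phi M" "M \<in> carrier G" "y = phi N" "N \<in> carrier G"
    unfolding carrier_Q phi_image[symmetric] by blast
  then show "x \<otimes>\<^bsub>Q\<^esub> y \<in> carrier Q"
    using phi_mult[of M N] group.is_monoid[OF group_G] monoid.m_closed[of G M N]
    unfolding carrier_Q phi_image[symmetric] by (auto intro: image_eqI[where x = "mat2_mult scl e M N"])
  show "x \<otimes>\<^bsub>Q\<^esub> y \<otimes>\<^bsub>Q\<^esub> z = x \<otimes>\<^bsub>Q\<^esub> (y \<otimes>\<^bsub>Q\<^esub> z)" by (simp add: matrix_mul_assoc)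
next
  show "\<one>\<^bsub>Q\<^esub> \<in> carrier Q" by (simp add: carrier_Q ortho_det_def)
  fix x assume x: "x \<in> carrier Q"
  then show "\<one>\<^bsub>Q\<^esub> \<otimes>\<^bsub>Q\<^esub> x = x" by simp
  from x obtain M where M: "x = phi M" "M \<in> carrier G"
    unfolding carrier_Q phi_image[symmetric] by blast
  have "phi (mat2_hat scl e dag M) \<in> carrier Q"
    unfolding carrier_Q phi_image[symmetric] by (rule imageI) (rule mat2_hat_inverse[OF M(2)])
  moreover have "phi (mat2_hat scl e dag M) \<otimes>\<^bsub>Q\<^esub> x = \<one>\<^bsub>Q\<^esub>"
    using phi_mult[OF mat2_hat_inverse(1)[OF M(2)] M(2)] mat2_hat_inverse(2)[OF M(2)] by (simp add: M phi_1)
  ultimately show "\<exists>y\<in>carrier Q. y \<otimes>\<^bsub>Q\<^esub> x = \<one>\<^bsub>Q\<^esub>" by blast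
qed

text \<open>Cramer's rule; as the determinant is 1 there is no division, so inversion is
  polynomial.\<close>

lemma inv_Q:
  assumes "g \<in> carrier Q"
  shows "inv\<^bsub>Q\<^esub> g = (\<lambda>(k, l). det (\<chi> i j. if j = k then mat 1 $ i $ l else to_mat g $ i $ j))"
proof -
  let ?h = "inv\<^bsub>Q\<^esub> g"
  have "g \<otimes>\<^bsub>Q\<^esub> ?h = \<one>\<^bsub>Q\<^esub>" by (rule group.r_inv[OF group_Q assms])
  then have eq: "to_mat g ** to_mat ?h = mat 1" by simp (metis to_mat_of_mat)
  have d: "det (to_mat g) = 1" using assms by (simp add: carrier_Q ortho_det_def)
  have "?h (k, l) = det (\<chi> i j. if j = k then mat 1 $ i $ l else to_mat g $ i $ j)" for k l
  proof -
    have "to_mat g *v (\<chi> i. to_mat ?h $ i $ l) = (\<chi> i. (to_mat g ** to_mat ?h) $ i $ l)"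
      by (simp add: vec_eq_iff matrix_vector_mult_def matrix_matrix_mult_def)
    then have "to_mat g *v (\<chi> i. to_mat ?h $ i $ l) = (\<chi> i. mat 1 $ i $ l)" by (simp add: eq)
    then have "(\<chi> i. to_mat ?h $ i $ l) =
        (\<chi> k. det (\<chi> i j. if j = k then (\<chi> i. mat 1 $ i $ l) $ i else to_mat g $ i $ j) / det (to_mat g))"
      using cramer[of "to_mat g" "\<chi> i. to_mat ?h $ i $ l" "\<chi> i. mat 1 $ i $ l"] d by simp
    then have "to_mat ?h $ k $ l = det (\<chi> i j. if j = k then (\<chi> i. mat 1 $ i $ l) $ i else to_mat g $ i $ j)"
      by (simp add: vec_eq_iff d)
    then show ?thesis unfolding vec_lambda_beta by (simp add: to_mat_def)
  qed
  then show ?thesis by (simp add: fun_eq_iff)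
qed

lemma algebraic_group_Q: "algebraic_group C Q"
  unfolding algebraic_group_def
proof (intro conjI)
  show "group Q" by (rule group_Q)
  obtain D where "D \<subseteq> polyfun UNIV" "carrier Q = zero_set D"
    using ortho_det_closed unfolding carrier_Q by blast
  moreover have "carrier Q = (\<Union>i::unit. range (\<lambda>u. phi (psi u)))"
    unfolding carrier_Q phi_image[symmetric] range_psi[symmetric] by (simp add: image_image)
  ultimately show "defined_over C (carrier Q)"
    using polyfun_phi_psi by (intro defined_over_images[where \<psi> = "\<lambda>_ u. phi (psi u)"])
  show "regular_on C {case_sum x y |x y. x \<in> carrier Q \<and> y \<in> carrier Q}
      (\<lambda>z. (z \<circ> Inl) \<otimes>\<^bsub>Q\<^esub> (z \<circ> Inr))"
  proof (rule regular_onI)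
    fix w :: "5 \<times> 5"
    obtain i j where w: "w = (i, j)" by (cases w)
    have "(\<lambda>z. \<Sum>k\<in>UNIV. z (Inl (i, k)) * z (Inr (k, j))) \<in> polyfun C"
      by (intro polyfun_sum polyfun.mult polyfun.coord C_closed)
    then show "(\<lambda>z. ((z \<circ> Inl) \<otimes>\<^bsub>Q\<^esub> (z \<circ> Inr)) w) \<in> polyfun C"
      by (simp add: w of_mat_def to_mat_def matrix_matrix_mult_def)
  qed simp
  show "regular_on C (carrier Q) (\<lambda>x. inv\<^bsub>Q\<^esub> x)"
  proof (rule regular_onI[OF _ inv_Q])
    fix w :: "5 \<times> 5"
    obtain k l where w: "w = (k, l)" by (cases w)
    have "(\<lambda>g. (if j = k then mat 1 $ i $ l else to_mat g $ i $ j)) \<in> polyfun C" for i j :: 5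
      using C_closed by (cases "j = k") (auto simp: mat_def to_mat_def intro: polyfun.const polyfun.coord)
    then show "(\<lambda>g. (\<lambda>(k, l). det (\<chi> i j. if j = k then mat 1 $ i $ l else to_mat g $ i $ j)) w) \<in> polyfun C"
      unfolding w by (simp, intro polyfun_det C_closed) simp
  qed
qed

end



section \<open>The scheme-theoretic kernel\<close>

section \<open>The kernel\<close>

lemma poly_ideal_diff:
  assumes "p \<in> poly_ideal A" "q \<in> poly_ideal A"
  shows "(\<lambda>x. p x - q x) \<in> poly_ideal A"
  using poly_ideal.add[OF assms(1) poly_ideal.mult[OF polyfun.const[of "- 1"] assms(2)]] by simp

lemma poly_ideal_mult_right:
  assumes "p \<in> poly_ideal A" "r \<in> polyfun UNIV"
  shows "(\<lambda>x. p x * r x) \<in> poly_ideal A"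
  using poly_ideal.mult[OF assms(2,1)] by (simp add: mult.commute)

definition entries_in :: "('x \<Rightarrow> 'k) set \<Rightarrow> ('x \<Rightarrow> 'k m2) \<Rightarrow> bool" where
  "entries_in A F \<longleftrightarrow> (\<lambda>x. m11 (F x)) \<in> A \<and> (\<lambda>x. m12 (F x)) \<in> A \<and>
     (\<lambda>x. m21 (F x)) \<in> A \<and> (\<lambda>x. m22 (F x)) \<in> A"

lemma entries_in_polyfun:
  fixes F H :: "('v \<Rightarrow> 'k::comm_ring_1) \<Rightarrow> 'k m2"
  assumes "entries_in (polyfun UNIV) F"
  shows "entries_in (polyfun UNIV) (\<lambda>x. adj (F x))"
    and "entries_in (polyfun UNIV) H \<Longrightarrow> entries_in (polyfun UNIV) (\<lambda>x. F x * H x)"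
    and "entries_in (polyfun UNIV) H \<Longrightarrow> entries_in (polyfun UNIV) (\<lambda>x. F x + H x)"
    and "entries_in (polyfun UNIV) H \<Longrightarrow> entries_in (polyfun UNIV) (\<lambda>x. F x - H x)"
  using assms unfolding entries_in_def
  by (auto intro!: polyfun.add polyfun.mult polyfun_uminus polyfun_diff)

lemma entries_in_polyfun_const: "entries_in (polyfun UNIV) (\<lambda>x. m)"
  unfolding entries_in_def by (auto intro: polyfun.const)

lemma entries_in_poly_ideal:
  fixes F H :: "('v \<Rightarrow> 'k::comm_ring_1) \<Rightarrow> 'k m2"
  assumes "entries_in (poly_ideal A) F"
  shows "entries_in (polyfun UNIV) H \<Longrightarrow> entries_in (poly_ideal A) (\<lambda>x. H x * F x)"
    and "entries_in (polyfun UNIV) H \<Longrightarrow> entries_in (poly_ideal A) (\<lambda>x. F x * H x)"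
    and "entries_in (poly_ideal A) H \<Longrightarrow> entries_in (poly_ideal A) (\<lambda>x. F x + H x)"
    and "entries_in (poly_ideal A) H \<Longrightarrow> entries_in (poly_ideal A) (\<lambda>x. F x - H x)"
    and "entries_in (poly_ideal A) (\<lambda>x. adj (F x))"
proof -
  have neg: "(\<lambda>x. - p x) \<in> poly_ideal A" if "p \<in> poly_ideal A" for p
    using poly_ideal_diff[OF poly_ideal.zero that] by simp
  show "entries_in (polyfun UNIV) H \<Longrightarrow> entries_in (poly_ideal A) (\<lambda>x. H x * F x)"
    using assms unfolding entries_in_def by (auto intro!: poly_ideal.add poly_ideal.mult)
  show "entries_in (polyfun UNIV) H \<Longrightarrow> entries_in (poly_ideal A) (\<lambda>x. F x * H x)"
    using assms unfolding entries_in_def by (auto intro!: poly_ideal.add poly_ideal_mult_right)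
  show "entries_in (poly_ideal A) H \<Longrightarrow> entries_in (poly_ideal A) (\<lambda>x. F x + H x)"
    using assms unfolding entries_in_def by (auto intro!: poly_ideal.add)
  show "entries_in (poly_ideal A) H \<Longrightarrow> entries_in (poly_ideal A) (\<lambda>x. F x - H x)"
    using assms unfolding entries_in_def by (auto intro!: poly_ideal_diff)
  show "entries_in (poly_ideal A) (\<lambda>x. adj (F x))"
    using assms unfolding entries_in_def by (auto intro!: neg)
qed

context split_setting
begin

abbreviation N :: "(2 \<times> 2 \<times> 4 \<Rightarrow> 'a alg_closure) monoid" where "N \<equiv> plus_minus_one G"

definition minus_one :: "2 \<times> 2 \<times> 4 \<Rightarrow> 'a alg_closure" where "minus_one = (\<lambda>v. - mat2_one scl e v)"

lemma carrier_N: "carrier N = {mat2_one scl e, minus_one}"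
  by (simp add: plus_minus_one_def minus_one_def)

lemma toM_minus_one: "toM minus_one = - 1"
proof -
  have "entry minus_one i j = (\<lambda>k. - entry (mat2_one scl e) i j k)" for i j
    by (simp add: entry_def minus_one_def)
  then have "toM minus_one = - toM (mat2_one scl e)" by (simp add: toM_def tau_minus)
  then show ?thesis by (simp add: toM_1)
qed

lemma N_in_G: "mat2_one scl e \<in> carrier G" "minus_one \<in> carrier G"
  by (simp_all add: carrier_G toM_1 toM_minus_one sp_def)

lemma phi_minus_one: "phi minus_one = \<one>\<^bsub>Q\<^esub>"
proof -
  have "star (- 1 :: 'a alg_closure m2 m2) = - 1" by (simp add: m2_eq_iff)
  then have "act (- 1) v = act 1 v" for v :: "'a alg_closure ^ 5" by (simp add: act_def)
  then have "act_mat (- 1) = (act_mat 1 :: 'a alg_closure ^ 5 ^ 5)" unfolding matrix_eq act_mat_apply by simp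
  then show ?thesis by (simp add: phi_def toM_minus_one act_mat_1 P_Pinv)
qed

lemma subgroup_N: "subgroup (carrier N) G"
proof
  have inv: "inv\<^bsub>G\<^esub> x = x" if "x \<in> carrier N" for x
  proof -
    have "x \<in> carrier G" using that N_in_G by (auto simp: carrier_N)
    moreover have "mat2_mult scl e x x = mat2_one scl e"
      using that by (auto simp: carrier_N toM_mult toM_1 toM_minus_one simp flip: toM_inject)
    ultimately show ?thesis using group.inv_equality[OF group_G, of x x] by simp
  qed
  show "carrier N \<subseteq> carrier G" using N_in_G by (auto simp: carrier_N)
  fix x assume x: "x \<in> carrier N"
  then show "inv\<^bsub>G\<^esub> x \<in> carrier N" using inv by simp
  fix y assume "y \<in> carrier N"
  then show "x \<otimes>\<^bsub>G\<^esub> y \<in> carrier N"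
    using x by (auto simp: carrier_N toM_mult toM_1 toM_minus_one simp flip: toM_inject)
qed (simp add: carrier_N)

lemma N_eq: "N = G\<lparr>carrier := carrier N\<rparr>" by (simp add: plus_minus_one_def)

text \<open>A union of two points is cut out by the products of an equation of one with an equation
  of the other.\<close>

lemma carrier_N_closed: "\<exists>E \<subseteq> polyfun UNIV. carrier N = zero_set E"
proof -
  let ?E = "range (\<lambda>(v, w) x. (x v - mat2_one scl e v) * (x w - minus_one w))"
  have "?E \<subseteq> polyfun UNIV"
    by (auto intro!: polyfun.mult polyfun_diff polyfun.coord polyfun.const)
  moreover have "x \<in> carrier N" if x: "x \<in> zero_set ?E" for x
  proof (rule ccontr)
    assume "x \<notin> carrier N"
    then have "x \<noteq> mat2_one scl e" "x \<noteq> minus_one" by (simp_all add: carrier_N)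
    then obtain v w where "x v \<noteq> mat2_one scl e v" "x w \<noteq> minus_one w" by (metis ext)
    moreover have "(x v - mat2_one scl e v) * (x w - minus_one w) = 0"
    proof -
      have "\<forall>p\<in>?E. p x = 0" using x unfolding zero_set_def by blast
      from bspec[OF this rangeI[of _ "(v, w)"]] show ?thesis by simp
    qed
    ultimately show False by simp
  qed
  moreover have "carrier N \<subseteq> zero_set ?E" by (auto simp: carrier_N zero_set_def)
  ultimately show ?thesis by blast
qed

lemma algebraic_group_N: "algebraic_group C N"
  unfolding algebraic_group_def
proof (intro conjI)
  show group_N: "group N"
    by (subst N_eq) (rule subgroup.subgroup_is_group[OF subgroup_N group_G])
  have mult_N: "x \<otimes>\<^bsub>N\<^esub> y = mat2_mult scl e x y" for x y by (simp add: plus_minus_one_def)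
  obtain E where "E \<subseteq> polyfun UNIV" "carrier N = zero_set E" using carrier_N_closed by blast
  moreover have "carrier N = (\<Union>i. range (\<lambda>u :: unit \<Rightarrow> 'a alg_closure. if i then mat2_one scl e else minus_one))"
    by (auto simp: carrier_N)
  moreover have "(\<lambda>_. (if i then mat2_one scl e else minus_one) v) \<in> polyfun C" for i v
  proof (rule polyfun.const)
    have "mat2_one scl e v \<in> C"
      by (cases v) (auto simp: mat2_one_def HK_embed_def C_closed(1))
    then show "(if i then mat2_one scl e else minus_one) v \<in> C"
      by (auto simp: minus_one_def simp flip: to_ac_minus)
  qed
  ultimately show "defined_over C (carrier N)"
    by (intro defined_over_images[where \<psi> = "\<lambda>i (u :: unit \<Rightarrow> 'a alg_closure). if i then mat2_one scl e else minus_one"])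
  show "regular_on C {case_sum x y |x y. x \<in> carrier N \<and> y \<in> carrier N}
      (\<lambda>z. (z \<circ> Inl) \<otimes>\<^bsub>N\<^esub> (z \<circ> Inr))"
    by (rule regular_onI[where g = "\<lambda>z. mat2_mult scl e (\<lambda>v. z (Inl v)) (\<lambda>v. z (Inr v))"])
       (intro polyfun_mat2_mult polyfun.coord, simp add: comp_def mult_N)
  have "inv\<^bsub>N\<^esub> x = x" if x: "x \<in> carrier N" for x
  proof (rule group.inv_equality[OF group_N _ x x])
    have "\<one>\<^bsub>N\<^esub> = mat2_one scl e" by (simp add: plus_minus_one_def)
    then show "x \<otimes>\<^bsub>N\<^esub> x = \<one>\<^bsub>N\<^esub>"
      using x by (auto simp: mult_N carrier_N toM_mult toM_1 toM_minus_one simp flip: toM_inject)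
  qed
  then show "regular_on C (carrier N) (\<lambda>x. inv\<^bsub>N\<^esub> x)"
    by (intro regular_onI[where g = "\<lambda>x. x"] polyfun.coord)
qed

abbreviation J :: "((2 \<times> 2 \<times> 4 \<Rightarrow> 'a alg_closure) \<Rightarrow> 'a alg_closure) set" where
  "J \<equiv> kernel_ideal G Q phi"

lemma kernel_ideal_vanishes:
  assumes "p \<in> J" "x \<in> carrier G" "phi x = \<one>\<^bsub>Q\<^esub>"
  shows "p x = 0"
  using assms(1) unfolding kernel_ideal_def
  by (rule poly_ideal_vanishes) (use assms(2,3) in \<open>auto simp: vanishing_ideal_def\<close>)

definition block :: "('a alg_closure m2 m2 \<Rightarrow> 'a alg_closure m2) \<Rightarrow> bool" where
  "block s \<longleftrightarrow> s \<in> {m11, m12, m21, m22}"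

lemma polyfun_toM:
  assumes "block s"
  shows "entries_in (polyfun UNIV) (\<lambda>M. s (toM M))"
proof -
  have "entries_in (polyfun UNIV) (\<lambda>M. tau (entry M i j))" for i j
    unfolding entries_in_def tau_def m2_sel_sum
    by (simp add: entry_def) (intro conjI polyfun_sum polyfun.mult polyfun.coord polyfun.const, auto)
  then show ?thesis using assms by (auto simp: block_def toM_def)
qed

text \<open>On the group, \<open>M * h * star M - h\<close> is computed from \<open>phi M\<close> by
  polynomials that vanish at the identity. Its entries, as polynomials in all \<open>M\<close>, are
  therefore generators of the kernel ideal.\<close>

lemma kernel_ideal_gen:
  assumes "block s"
  shows "entries_in J (\<lambda>M. s (toM M * herm v * star (toM M)) - s (herm v))"
proof -
  let ?F = "\<lambda>M. s (toM M * herm v * star (toM M)) - s (herm v)"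
  let ?w = "\<lambda>g. P *v (to_mat g *v (Pinv *v v))"
  let ?H = "\<lambda>g. s (herm (?w g)) - s (herm v)"
  have F: "entries_in (polyfun UNIV) ?F"
  proof -
    have "entries_in (polyfun UNIV) (\<lambda>M. m11 (toM M))" "entries_in (polyfun UNIV) (\<lambda>M. m12 (toM M))"
      "entries_in (polyfun UNIV) (\<lambda>M. m21 (toM M))" "entries_in (polyfun UNIV) (\<lambda>M. m22 (toM M))"
      by (rule polyfun_toM, simp add: block_def)+
    then show ?thesis using assms unfolding block_def
      by (auto intro!: entries_in_polyfun entries_in_polyfun_const)
  qed
  have H: "entries_in (polyfun UNIV) ?H"
  proof -
    have c: "(\<lambda>g. (to_mat g *v x) $ i) \<in> polyfun UNIV" for x :: "'a alg_closure ^ 5" and i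
      unfolding matrix_vector_mult_def to_mat_def
      by (simp, intro polyfun_sum polyfun.mult polyfun.coord polyfun.const) auto
    have w: "(\<lambda>g. ?w g $ i) \<in> polyfun UNIV" for i
      unfolding matrix_vector_mult_def[of P] vec_lambda_beta
      by (intro polyfun_sum polyfun.mult polyfun.const c) auto
    have "entries_in (polyfun UNIV) (\<lambda>g. s (herm (?w g)))"
      using assms unfolding block_def herm_def entries_in_def
      by (auto intro!: w polyfun.const polyfun_uminus)
    then show ?thesis by (intro entries_in_polyfun entries_in_polyfun_const)
  qed
  have eq: "?F x = ?H (phi x)" if "x \<in> carrier G" for x
  proof -
    have "?w (phi x) = act (toM x) v"
      unfolding phi_def to_mat_of_mat conj_P act_mat_apply by (simp add: matrix_vector_mul_assoc P_Pinv)
    then show ?thesis using that by (simp add: carrier_G herm_act two_ac)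
  qed
  have one: "?H \<one>\<^bsub>Q\<^esub> = 0" by (simp add: matrix_vector_mul_assoc P_Pinv)
  have "(\<lambda>M. f (?F M)) \<in> J" if f: "(\<lambda>M. f (?F M)) \<in> polyfun UNIV" "(\<lambda>g. f (?H g)) \<in> polyfun UNIV" "f 0 = 0" for f
    unfolding kernel_ideal_def
  proof (rule poly_ideal.gen, intro CollectI conjI bexI)
    show "\<forall>x\<in>carrier G. f (?F x) = f (?H (phi x))" using eq by simp
    show "(\<lambda>g. f (?H g)) \<in> vanishing_ideal UNIV {\<one>\<^bsub>Q\<^esub>}" using f one by (simp add: vanishing_ideal_def)
  qed (rule f)
  from this[of m11] this[of m12] this[of m21] this[of m22] F H show ?thesis
    unfolding entries_in_def by simp
qed

lemma J_add: "p \<in> J \<Longrightarrow> q \<in> J \<Longrightarrow> (\<lambda>x. p x + q x) \<in> J"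
  and J_diff: "p \<in> J \<Longrightarrow> q \<in> J \<Longrightarrow> (\<lambda>x. p x - q x) \<in> J"
  and J_mult: "r \<in> polyfun UNIV \<Longrightarrow> p \<in> J \<Longrightarrow> (\<lambda>x. r x * p x) \<in> J"
  and J_zero: "(\<lambda>_. 0) \<in> J"
  unfolding kernel_ideal_def by (rule poly_ideal.add poly_ideal_diff poly_ideal.mult poly_ideal.zero; assumption?)+

lemmas in_J = entries_in_poly_ideal[where A = "{p \<in> polyfun UNIV. \<exists>h\<in>vanishing_ideal UNIV {\<one>\<^bsub>Q\<^esub>}.
    \<forall>x\<in>carrier G. p x = h (phi x)}", folded kernel_ideal_def]

abbreviation corner :: "(2 \<times> 2 \<times> 4 \<Rightarrow> 'a alg_closure) \<Rightarrow> 'a alg_closure" where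
  "corner M \<equiv> m11 (m11 (toM M))"

text \<open>
  Modulo the kernel ideal the generic matrix of the group is scalar, with square one. The relations
  come from letting it act on the hermitian matrices \<open>diag(1, 0)\<close>, \<open>diag(0, 1)\<close> and those with
  zero diagonal.
\<close>

lemma kernel_relations:
  "entries_in J (\<lambda>M. m12 (toM M))" "entries_in J (\<lambda>M. m21 (toM M))"
  "entries_in J (\<lambda>M. m11 (toM M) - m22 (toM M))"
  "entries_in J (\<lambda>M. m11 (toM M) - scal (corner M))"
  "(\<lambda>M. corner M * corner M - 1) \<in> J"
proof -
  let ?a = "\<lambda>M. m11 (toM M)" and ?b = "\<lambda>M. m12 (toM M)" and ?c = "\<lambda>M. m21 (toM M)" and ?d = "\<lambda>M. m22 (toM M)"
  have pol: "entries_in (polyfun UNIV) ?a" "entries_in (polyfun UNIV) ?b"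
    "entries_in (polyfun UNIV) ?c" "entries_in (polyfun UNIV) ?d"
    by (rule polyfun_toM, simp add: block_def)+
  have blocks: "block m11" "block m12" "block m21" "block m22" by (simp_all add: block_def)
  have comm: "adj x * x = x * adj x" for x :: "'a alg_closure m2" by (simp only: adj_mult_self)
  have h1: "herm (vec5 1 0 0 0 0) = M2 1 0 0 (0 :: 'a alg_closure m2)"
    and h2: "herm (vec5 0 1 0 0 0) = M2 0 0 0 (1 :: 'a alg_closure m2)"
    and h3: "symm Z \<Longrightarrow> herm (vec5 0 0 (m11 Z) (m12 Z) (m22 Z)) = M2 0 Z (adj Z) (0 :: 'a alg_closure m2)" for Z
    by (simp_all add: herm_def m2_eq_iff symm_iff)
  have aa: "entries_in J (\<lambda>M. ?a M * adj (?a M) - 1)" and ca: "entries_in J (\<lambda>M. ?c M * adj (?a M))"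
    using kernel_ideal_gen[OF blocks(1), of "vec5 1 0 0 0 0"] kernel_ideal_gen[OF blocks(3), of "vec5 1 0 0 0 0"]
    by (simp_all add: h1)
  have dd: "entries_in J (\<lambda>M. ?d M * adj (?d M) - 1)" and bd: "entries_in J (\<lambda>M. ?b M * adj (?d M))"
    using kernel_ideal_gen[OF blocks(4), of "vec5 0 1 0 0 0"] kernel_ideal_gen[OF blocks(2), of "vec5 0 1 0 0 0"]
    by (simp_all add: h2)
  have cancel: "entries_in J F" if "entries_in J (\<lambda>M. F M * adj (H M))" "entries_in J (\<lambda>M. H M * adj (H M) - 1)"
    "entries_in (polyfun UNIV) F" "entries_in (polyfun UNIV) H" for F H
  proof -
    \<comment> \<open>Modulo the ideal, \<open>adj (H M)\<close> is inverse to \<open>H M\<close>,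
      so it can be cancelled.\<close>
    have "F M = F M * adj (H M) * H M - F M * (H M * adj (H M) - 1)" for M
      by (simp add: right_diff_distrib mult.assoc comm)
    then show ?thesis using in_J(4)[OF in_J(2)[OF that(1,4)] in_J(1)[OF that(2,3)]] by simp
  qed
  show b: "entries_in J ?b" by (rule cancel[OF bd dd pol(2,4)])
  show c: "entries_in J ?c" by (rule cancel[OF ca aa pol(3,1)])
  have z: "entries_in J (\<lambda>M. ?a M * Z * adj (?d M) - Z)" if "symm Z" for Z
  proof -
    have "entries_in J (\<lambda>M. (?b M * adj (Z) * adj (?c M) + ?a M * Z * adj (?d M)) - Z)"
      using kernel_ideal_gen[OF blocks(2), of "vec5 0 0 (m11 Z) (m12 Z) (m22 Z)"] that by (simp add: h3 add.commute)
    moreover have "entries_in J (\<lambda>M. ?b M * adj (Z) * adj (?c M))"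
      by (intro in_J(2) b entries_in_polyfun pol entries_in_polyfun_const)
    ultimately have "entries_in J (\<lambda>M. (?b M * adj (Z) * adj (?c M) + ?a M * Z * adj (?d M)) - Z
        - ?b M * adj (Z) * adj (?c M))"
      by (rule in_J(4))
    then show ?thesis by (simp add: algebra_simps)
  qed
  have "entries_in J (\<lambda>M. ?a M * adj (?d M) - 1)"
    using z[of 1] by (simp add: symm_iff)
  from in_J(4)[OF in_J(2)[OF this pol(4)] in_J(1)[OF dd pol(1)]]
  show ad: "entries_in J (\<lambda>M. ?a M - ?d M)"
    by (simp add: left_diff_distrib right_diff_distrib mult.assoc comm)
  \<comment> \<open>With \<open>?d\<close> replaced by \<open>?a\<close> and
    \<open>adj (?a M)\<close> inverse to \<open>?a M\<close> modulo the ideal, invariance of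
    \<open>Z\<close> becomes commutation with \<open>Z\<close>.\<close>
  have az: "entries_in J (\<lambda>M. ?a M * Z - Z * ?a M)" if "symm Z" for Z
  proof -
    have adj_diff: "adj (p - q) = adj p - adj q" for p q :: "'a alg_closure m2" by (simp add: m2_eq_iff)
    have "entries_in J (\<lambda>M. (?a M * Z * adj (?d M) - Z) + ?a M * Z * adj (?a M - ?d M))"
      by (intro in_J(3)[OF z[OF that]] in_J(1)[OF in_J(5)[OF ad]] entries_in_polyfun pol entries_in_polyfun_const)
    then have "entries_in J (\<lambda>M. ?a M * Z * adj (?a M) - Z)"
      by (simp add: adj_diff right_diff_distrib)
    from in_J(4)[OF in_J(2)[OF this pol(1)] in_J(1)[OF aa entries_in_polyfun(2)[OF pol(1) entries_in_polyfun_const[of Z]]]]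
    show ?thesis by (simp add: left_diff_distrib right_diff_distrib mult.assoc comm)
  qed
  let ?a1 = "\<lambda>M. m11 (?a M)" and ?a2 = "\<lambda>M. m12 (?a M)" and ?a3 = "\<lambda>M. m21 (?a M)" and ?a4 = "\<lambda>M. m22 (?a M)"
  have pol_a: "?a1 \<in> polyfun UNIV" "?a2 \<in> polyfun UNIV" using pol(1) by (simp_all add: entries_in_def)
  have a2: "?a2 \<in> J" and a3: "?a3 \<in> J" and a14: "(\<lambda>M. ?a1 M - ?a4 M) \<in> J"
  proof -
    have neg: "p \<in> J" if "(\<lambda>M. - p M) \<in> J" for p using J_diff[OF J_zero that] by simp
    \<comment> \<open>Commuting with the diagonal matrix with entries 1, 0 kills the off-diagonal
      entries; commuting with the swap matrix identifies the diagonal ones.\<close>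
    show "?a2 \<in> J" "?a3 \<in> J" using az[of "M2 1 0 0 0"] neg by (simp_all add: entries_in_def symm_iff)
    show "(\<lambda>M. ?a1 M - ?a4 M) \<in> J" using az[of "M2 0 1 1 0"] by (simp add: entries_in_def symm_iff)
  qed
  have "(\<lambda>M. ?a4 M - ?a1 M) \<in> J" using J_diff[OF J_zero a14] by simp
  then show "entries_in J (\<lambda>M. ?a M - scal (corner M))"
    using a2 a3 J_zero by (simp add: entries_in_def)
  \<comment> \<open>The determinant of \<open>?a\<close> is 1 modulo the ideal, and for a scalar
    matrix it is the square of \<open>corner\<close>.\<close>
  have "(\<lambda>M. ?a1 M * ?a4 M - ?a2 M * ?a3 M - 1) \<in> J" using aa by (simp add: entries_in_def)
  from J_add[OF J_add[OF this J_mult[OF pol_a(1) a14]] J_mult[OF pol_a(2) a3]]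
  show "(\<lambda>M. corner M * corner M - 1) \<in> J" by (simp add: algebra_simps)
qed

text \<open>Modulo \<open>J\<close> every coordinate function is a multiple of
  \<open>corner\<close>, whose square is 1, so the quotient ring is spanned by 1 and
  \<open>corner\<close>.\<close>

lemma mod_kernel_ideal:
  assumes "p \<in> polyfun UNIV"
  shows "\<exists>r s. (\<lambda>M. p M - (r + s * corner M)) \<in> J"
  using assms
proof (induction rule: polyfun.induct)
  case (const c)
  show ?case using J_zero by (intro exI[of _ c] exI[of _ 0]) simp
next
  case (coord v)
  obtain i j k where v: "v = (i, j, k)" by (cases v)
  obtain D :: "'a alg_closure ^ 4 ^ 4" where D: "\<And>x k. x k =
     D $ k $ 1 * m11 (tau x) + D $ k $ 2 * m12 (tau x) + D $ k $ 3 * m21 (tau x) + D $ k $ 4 * m22 (tau x)"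
    using tau_inverse by blast
  have D_J: "(\<lambda>M. D $ k $ 1 * m11 (F M) + D $ k $ 2 * m12 (F M) + D $ k $ 3 * m21 (F M) + D $ k $ 4 * m22 (F M)) \<in> J"
    if "entries_in J F" for F
    using that unfolding entries_in_def by (intro J_add J_mult polyfun.const) auto
  have M_v: "M v = D $ k $ 1 * m11 (tau (entry M i j)) + D $ k $ 2 * m12 (tau (entry M i j))
      + D $ k $ 3 * m21 (tau (entry M i j)) + D $ k $ 4 * m22 (tau (entry M i j))" for M
    using D[of "entry M i j" k] by (simp add: v entry_def)
  show ?case
  proof (cases "i = j")
    case True
    have "entries_in J (\<lambda>M. tau (entry M i j) - scal (corner M))"
      using exhaust_2[of i]
    proof
      assume "i = 1"
      then show ?thesis using True kernel_relations(4) by (simp add: toM_def)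
    next
      assume "i = 2"
      from in_J(4)[OF kernel_relations(4,3)] show ?thesis using True \<open>i = 2\<close> by (simp add: toM_def)
    qed
    from D_J[OF this] show ?thesis unfolding M_v
      by (intro exI[of _ 0] exI[of _ "D $ k $ 1 + D $ k $ 4"]) (simp add: algebra_simps)
  next
    case False
    then have "entries_in J (\<lambda>M. tau (entry M i j))"
      using exhaust_2[of i] exhaust_2[of j] kernel_relations(1,2) by (auto simp: toM_def)
    from D_J[OF this] show ?thesis unfolding M_v by (intro exI[of _ 0]) simp
  qed
next
  case (add p q)
  then obtain r s r' s' where "(\<lambda>M. p M - (r + s * corner M)) \<in> J" "(\<lambda>M. q M - (r' + s' * corner M)) \<in> J"
    by blast
  from J_add[OF this] show ?case
    by (intro exI[of _ "r + r'"] exI[of _ "s + s'"]) (simp add: algebra_simps)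
next
  case (mult p q)
  then obtain r s r' s' where pq: "(\<lambda>M. p M - (r + s * corner M)) \<in> J" "(\<lambda>M. q M - (r' + s' * corner M)) \<in> J"
    by blast
  have t: "corner \<in> polyfun UNIV"
    using polyfun_toM[of m11] by (simp add: block_def entries_in_def)
  have "(\<lambda>M. r + s * corner M) \<in> polyfun UNIV" by (intro polyfun.add polyfun.mult polyfun.const t) auto
  from J_add[OF J_add[OF J_mult[OF mult.hyps(2) pq(1)] J_mult[OF this pq(2)]]
      J_mult[OF polyfun.const[of "s * s'"] kernel_relations(5)]]
  show ?case
    by (intro exI[of _ "r * r' + s * s'"] exI[of _ "r * s' + s * r'"]) (simp add: algebra_simps)
qed

text \<open>A polynomial vanishing at 1 and -1 is congruent to some \<open>r + s * corner\<close>,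
  and evaluation at the two points gives \<open>r + s = 0\<close> and \<open>r - s = 0\<close>. As 2
  is invertible, both coefficients vanish.\<close>

lemma kernel_ideal_eq: "J = vanishing_ideal UNIV (carrier N)"
proof
  have van: "p x = 0" if "p \<in> J" "x \<in> carrier N" for p x
    using that kernel_ideal_vanishes[OF that(1), of x] N_in_G phi_1 phi_minus_one by (auto simp: carrier_N)
  show "J \<subseteq> vanishing_ideal UNIV (carrier N)"
    using van unfolding vanishing_ideal_def kernel_ideal_def by (auto intro: poly_ideal_polyfun)
  show "vanishing_ideal UNIV (carrier N) \<subseteq> J"
  proof
    fix p assume p: "p \<in> vanishing_ideal UNIV (carrier N)"
    then have "p \<in> polyfun UNIV" by (simp add: vanishing_ideal_def)
    from mod_kernel_ideal[OF this] obtain r s where rs: "(\<lambda>M. p M - (r + s * corner M)) \<in> J" by blast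
    have p0: "p (mat2_one scl e) = 0" "p minus_one = 0"
      using p by (simp_all add: vanishing_ideal_def carrier_N)
    have 1: "r + s = 0" using van[OF rs, of "mat2_one scl e"] p0 by (auto simp: carrier_N toM_1 add_eq_0_iff)
    have 2: "r = s" using van[OF rs, of minus_one] p0 by (simp add: carrier_N toM_minus_one)
    have "2 * s = 0" using 1 unfolding 2 mult_2 .
    then have "r = 0" "s = 0" using two_ac 2 by simp_all
    then show "p \<in> J" using rs by simp
  qed
qed

text \<open>The statement on points follows from the one on ideals: points of the kernel are zeros
  of \<open>J\<close>, the vanishing ideal of a closed set.\<close>

lemma kernel_eq: "kernel G Q phi = carrier N"
proof
  show "carrier N \<subseteq> kernel G Q phi"
    using N_in_G phi_1 phi_minus_one by (auto simp: kernel_def carrier_N)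
  show "kernel G Q phi \<subseteq> carrier N"
  proof
    fix x assume x: "x \<in> kernel G Q phi"
    have "p x = 0" if "p \<in> vanishing_ideal UNIV (carrier N)" for p
      using kernel_ideal_vanishes[of p x] that x unfolding kernel_ideal_eq by (simp add: kernel_def)
    then have "x \<in> zero_set (vanishing_ideal UNIV (carrier N))" by (simp add: zero_set_def)
    then show "x \<in> carrier N" using carrier_N_closed zero_set_vanishing_ideal by metis
  qed
qed

lemma short_exact_phi: "short_exact C N G Q phi"
  unfolding short_exact_def
  using algebraic_group_N algebraic_group_G algebraic_group_Q subgroup_N N_eq phi_hom regular_phi
    kernel_eq kernel_ideal_eq phi_image carrier_Q by (intro conjI) simp_all

end

theorem theorem5p4:
  fixes scl :: "'a::field \<Rightarrow> 'h::ring_1 \<Rightarrow> 'h"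
    and bar dag :: "'h \<Rightarrow> 'h"
    and e :: "4 \<Rightarrow> 'h"
    and b :: "5 \<Rightarrow> 'a \<times> 'a \<times> 'h"
  assumes "CHAR('a) \<noteq> 2"
    and "quaternion_algebra scl bar"
    and "orthogonal_involution scl bar dag"
    and "is_basis scl e UNIV"
    and "is_basis (scale_FFH scl) b (UNIV \<times> UNIV \<times> Hplus dag)"
  shows "\<exists>\<phi>. short_exact (range to_ac)
           (plus_minus_one (SL_dag scl e dag))
           (SL_dag scl e dag)
           (identity_component (orthogonal_group_ac (q_H scl bar) b)) \<phi>"
proof -
  have "(2 :: 'a) \<noteq> 0"
  proof
    assume "(2 :: 'a) = 0"
    then have "of_nat 2 = (0 :: 'a)" by simp
    then have "CHAR('a) dvd 2" by (simp only: of_nat_eq_0_iff_char_dvd)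
    then have "CHAR('a) = 1 \<or> CHAR('a) = 2" using two_is_prime_nat unfolding prime_nat_iff by blast
    moreover have "CHAR('a) \<noteq> 1" using of_nat_CHAR[where ?'a = 'a] by force
    ultimately show False using assms(1) by blast
  qed
  then have qo: "quaternion_orthogonal scl bar dag"
    using assms(2,3) by (simp add: quaternion_orthogonal_def quaternion_orthogonal_axioms_def)
  obtain T where "split_setting scl bar dag e b T"
    using quaternion_orthogonal.splitting[OF qo] assms(4,5) qo
    unfolding split_setting_def split_setting_axioms_def by blast
  then show ?thesis using split_setting.short_exact_phi by blast
qed

end
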